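(* Let $(\mathsf M^2,L)$ be a closed connected real analytic $\mathrm{gl}$-regular Nijenhuis $2$-manifold. Then - either $\mathsf{Sing}$ is empty (i.e. all points of $\mathsf M^2$ are of the same algebraic type), - or each $\mathsf p\in\mathsf{Sing}$ belongs to the series $M$, and then automatically one of the eigenvalues of $L$ is constant on $\mathsf M^2$.
   Context: A $(1,1)$-tensor field $L$ is Nijenhuis if $L^2[\xi,\eta]-L[L\xi,\eta]-L[\xi,L\eta]+[L\xi,L\eta]=0$ for all vector fields; on a $2$-manifold it is $\mathrm{gl}$-regular if $\mathrm{Id}$ and $L$ are linearly independent at every point. Closed means compact without boundary. $\mathsf{Sing}$ is the set of points where the algebraic type of $L$ changes: with $v=\operatorname{tr}L$ and $u=-\det L$, $\mathsf{Sing}=\{\mathsf p\in\mathsf M^2: v^2+4u=0\}$, unless $v^2+4u\equiv0$ on $\mathsf M^2$ ($L$ is similar to a Jordan block at each point), in which case $\mathsf{Sing}=\emptyset$. The algebraic types are: two distinct real eigenvalues; two complex conjugate eigenvalues; a $2\times2$ Jordan block. A point $\mathsf p$ belongs to the series $M$ if there are a constant $\lambda\in\mathbb R$ and local real analytic coordinates $(x,y)$ with $\mathsf p=(0,0)$ in which $L-\lambda\,\mathrm{Id}$ equals $\begin{pmatrix}0&1\\0&y^{2k-1}\end{pmatrix}$ or $\begin{pmatrix}0&1\\0&\epsilon y^{2k}\end{pmatrix}$ for some $k\ge1$, $\epsilon=\pm1$. *)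

theory Defs
  imports "HOL-Analysis.Analysis"
begin

section \<open>Real analytic maps on the plane\<close>

definition real_analytic_at :: "(real^2 \<Rightarrow> 'b::euclidean_space) \<Rightarrow> real^2 \<Rightarrow> bool" where
  "real_analytic_at f p \<longleftrightarrow>
     (\<exists>r>0. \<exists>a :: nat \<Rightarrow> nat \<Rightarrow> 'b. \<forall>x\<in>ball p r.
        ((\<lambda>(i, j). ((x$1 - p$1) ^ i * (x$2 - p$2) ^ j) *\<^sub>R a i j) has_sum f x) UNIV)"

text \<open>Used for open \<open>S\<close> only; \<open>f\<close> may be arbitrary outside \<open>S\<close>, since the radius of the
  ball above can be taken small.\<close>

definition real_analytic_on :: "(real^2) set \<Rightarrow> (real^2 \<Rightarrow> 'b::euclidean_space) \<Rightarrow> bool" where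
  "real_analytic_on S f \<longleftrightarrow> (\<forall>p\<in>S. real_analytic_at f p)"


section \<open>Real analytic surfaces\<close>

text \<open>The underlying topological space is the type \<open>'a\<close>; being Hausdorff and second countable
  is imposed by its type classes. A chart is a domain together with a coordinate map, whose
  values outside the domain are irrelevant. Coordinate images are open in the plane, so the
  surfaces have no boundary.\<close>

type_synonym 'a chart = "'a set \<times> ('a \<Rightarrow> real^2)"

definition coord_image :: "'a chart \<Rightarrow> (real^2) set" where
  "coord_image c = snd c ` fst c"

definition is_chart :: "'a::topological_space chart \<Rightarrow> bool" where
  "is_chart c \<longleftrightarrow> open (fst c) \<and> open (coord_image c) \<and>
     (\<exists>g. homeomorphism (fst c) (coord_image c) (snd c) g)"

definition transition :: "'a chart \<Rightarrow> 'a chart \<Rightarrow> real^2 \<Rightarrow> real^2" where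
  "transition c d = snd d \<circ> inv_into (fst c) (snd c)"

definition compatible :: "'a chart \<Rightarrow> 'a chart \<Rightarrow> bool" where
  "compatible c d \<longleftrightarrow>
     real_analytic_on (snd c ` (fst c \<inter> fst d)) (transition c d) \<and>
     real_analytic_on (snd d ` (fst c \<inter> fst d)) (transition d c)"

text \<open>All local analytic coordinate systems, i.e. the maximal atlas determined by \<open>A\<close>.\<close>

definition charts :: "'a::topological_space chart set \<Rightarrow> 'a chart set" where
  "charts A = {c. is_chart c \<and> (\<forall>d\<in>A. compatible c d)}"

definition analytic_atlas :: "'a::topological_space chart set \<Rightarrow> bool" where
  "analytic_atlas A \<longleftrightarrow> A \<subseteq> charts A \<and> (\<Union>c\<in>A. fst c) = UNIV"


section \<open>Vector fields and (1,1)-tensor fields\<close>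

text \<open>Fields are given by their components, as functions of the coordinates, in every analytic
  chart, subject to the usual transformation laws. Tangent vectors are columns, and the entry
  in row \<open>i\<close> and column \<open>j\<close> of the matrix of \<open>L\<close> is its component with upper index \<open>i\<close> and
  lower index \<open>j\<close>.\<close>

type_synonym 'a vfield = "'a chart \<Rightarrow> real^2 \<Rightarrow> real^2"
type_synonym 'a tfield = "'a chart \<Rightarrow> real^2 \<Rightarrow> real^2^2"

definition vector_field_on :: "'a::topological_space chart set \<Rightarrow> 'a set \<Rightarrow> 'a vfield \<Rightarrow> bool" where
  "vector_field_on A W X \<longleftrightarrow>
     (\<forall>c\<in>charts A. real_analytic_on (snd c ` (fst c \<inter> W)) (X c)) \<and>
     (\<forall>c\<in>charts A. \<forall>d\<in>charts A. \<forall>x\<in>snd c ` (fst c \<inter> fst d \<inter> W).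
        X d (transition c d x) = jacobian (transition c d) (at x) *v X c x)"

definition tensor_field :: "'a::topological_space chart set \<Rightarrow> 'a tfield \<Rightarrow> bool" where
  "tensor_field A L \<longleftrightarrow>
     (\<forall>c\<in>charts A. real_analytic_on (coord_image c) (L c)) \<and>
     (\<forall>c\<in>charts A. \<forall>d\<in>charts A. \<forall>x\<in>snd c ` (fst c \<inter> fst d).
        L d (transition c d x) =
          jacobian (transition c d) (at x) ** L c x ** matrix_inv (jacobian (transition c d) (at x)))"

definition tapply :: "'a tfield \<Rightarrow> 'a vfield \<Rightarrow> 'a vfield" where
  "tapply L X = (\<lambda>c x. L c x *v X c x)"

definition lie_bracket :: "'a vfield \<Rightarrow> 'a vfield \<Rightarrow> 'a vfield" where
  "lie_bracket X Y =
     (\<lambda>c x. jacobian (Y c) (at x) *v X c x - jacobian (X c) (at x) *v Y c x)"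

definition torsion :: "'a tfield \<Rightarrow> 'a vfield \<Rightarrow> 'a vfield \<Rightarrow> 'a vfield" where
  "torsion L X Y = (\<lambda>c x.
       tapply L (tapply L (lie_bracket X Y)) c x
     - tapply L (lie_bracket (tapply L X) Y) c x
     - tapply L (lie_bracket X (tapply L Y)) c x
     + lie_bracket (tapply L X) (tapply L Y) c x)"

text \<open>As usual in the analytic category, vector fields are taken on arbitrary open subsets. The
  torsion is bilinear over functions, so its vanishing does not depend on whether local or
  global, analytic or smooth vector fields are used.\<close>

definition nijenhuis :: "'a::topological_space chart set \<Rightarrow> 'a tfield \<Rightarrow> bool" where
  "nijenhuis A L \<longleftrightarrow>
     (\<forall>W X Y. open W \<longrightarrow> vector_field_on A W X \<longrightarrow> vector_field_on A W Y \<longrightarrow>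
        (\<forall>c\<in>charts A. \<forall>x\<in>snd c ` (fst c \<inter> W). torsion L X Y c x = 0))"

definition gl_regular :: "'a::topological_space chart set \<Rightarrow> 'a tfield \<Rightarrow> bool" where
  "gl_regular A L \<longleftrightarrow>
     (\<forall>c\<in>charts A. \<forall>x\<in>coord_image c. \<forall>a b :: real.
        a *\<^sub>R mat 1 + b *\<^sub>R L c x = 0 \<longrightarrow> a = 0 \<and> b = 0)"


section \<open>Algebraic type and singular points\<close>

text \<open>Trace and determinant are independent of the chart by the transformation law.\<close>

definition tr_at :: "'a::topological_space chart set \<Rightarrow> 'a tfield \<Rightarrow> 'a \<Rightarrow> real" where
  "tr_at A L p = (THE t. \<forall>c\<in>charts A. p \<in> fst c \<longrightarrow> trace (L c (snd c p)) = t)"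

definition det_at :: "'a::topological_space chart set \<Rightarrow> 'a tfield \<Rightarrow> 'a \<Rightarrow> real" where
  "det_at A L p = (THE t. \<forall>c\<in>charts A. p \<in> fst c \<longrightarrow> det (L c (snd c p)) = t)"

definition discr_at :: "'a::topological_space chart set \<Rightarrow> 'a tfield \<Rightarrow> 'a \<Rightarrow> real" where
  "discr_at A L p = (let v = tr_at A L p; u = - det_at A L p in v\<^sup>2 + 4 * u)"

definition Sing :: "'a::topological_space chart set \<Rightarrow> 'a tfield \<Rightarrow> 'a set" where
  "Sing A L = (if \<forall>p. discr_at A L p = 0 then {} else {p. discr_at A L p = 0})"

definition eigenvalue :: "'k::field^2^2 \<Rightarrow> 'k \<Rightarrow> bool" where
  "eigenvalue M z \<longleftrightarrow> (\<exists>w. w \<noteq> 0 \<and> M *v w = z *s w)"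

definition distinct_real_type :: "real^2^2 \<Rightarrow> bool" where
  "distinct_real_type M \<longleftrightarrow> (\<exists>l m. l \<noteq> m \<and> eigenvalue M l \<and> eigenvalue M m)"

definition complex_conjugate_type :: "real^2^2 \<Rightarrow> bool" where
  "complex_conjugate_type M \<longleftrightarrow>
     (\<exists>z. z \<noteq> cnj z \<and> eigenvalue (\<chi> i j. complex_of_real (M$i$j)) z
                    \<and> eigenvalue (\<chi> i j. complex_of_real (M$i$j)) (cnj z))"

definition jordan_type :: "real^2^2 \<Rightarrow> bool" where
  "jordan_type M \<longleftrightarrow>
     (\<exists>(P :: real^2^2) l. invertible P \<and> M = P ** (vector [vector [l, 1], vector [0, l]] :: real^2^2) ** matrix_inv P)"

definition everywhere :: "'a::topological_space chart set \<Rightarrow> 'a tfield \<Rightarrow> (real^2^2 \<Rightarrow> bool) \<Rightarrow> bool" where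
  "everywhere A L P \<longleftrightarrow> (\<forall>c\<in>charts A. \<forall>x\<in>coord_image c. P (L c x))"

definition same_algebraic_type :: "'a::topological_space chart set \<Rightarrow> 'a tfield \<Rightarrow> bool" where
  "same_algebraic_type A L \<longleftrightarrow>
     everywhere A L distinct_real_type \<or> everywhere A L complex_conjugate_type
     \<or> everywhere A L jordan_type"


section \<open>The series M\<close>

text \<open>With coordinates \<open>(x, y)\<close>, the letter \<open>y\<close> is the second component of \<open>z\<close>.\<close>

definition series_M :: "'a::topological_space chart set \<Rightarrow> 'a tfield \<Rightarrow> 'a \<Rightarrow> bool" where
  "series_M A L p \<longleftrightarrow>
     (\<exists>l::real. \<exists>c\<in>charts A. p \<in> fst c \<and> snd c p = 0 \<and> (\<exists>k::nat. k \<ge> 1 \<and>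
        ((\<forall>z\<in>coord_image c. L c z - l *\<^sub>R mat 1 =
            vector [vector [0, 1], vector [0, (z$2) ^ (2*k - 1)]]) \<or>
         (\<exists>\<epsilon>\<in>{1, -1}. \<forall>z\<in>coord_image c. L c z - l *\<^sub>R mat 1 =
            vector [vector [0, 1], vector [0, \<epsilon> * (z$2) ^ (2*k)]]))))"

end

theory Submission
  imports Defs "HOL-Complex_Analysis.Complex_Analysis"
begin

no_notation fps_nth (infixl \<open>$\<close> 75)

text \<open>With \<open>v = tr L\<close> and \<open>u = - det L\<close>, the Nijenhuis condition on a surface says
  \<open>L\<^sup>* dv = v dv + du\<close>, so every analytic eigenvalue satisfies \<open>L\<^sup>* d\<lambda> = \<lambda> d\<lambda>\<close>. Where
  \<open>l\<^sub>1\<^sub>2 \<noteq> 0\<close> this is a transport equation \<open>\<lambda>\<^sub>x = a \<lambda>\<^sub>y\<close>, which is solved after extension to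
  complex variables by the Cauchy--Kovalevskaya theorem.

  Suppose that \<open>Sing\<close> is non-empty. If the discriminant \<open>v\<^sup>2 + 4 u\<close> were negative at its minimum,
  a non-real eigenvalue would be a holomorphic function of a complex coordinate there, and the open
  mapping theorem would make the discriminant a negative constant. Hence both eigenvalues are real. If neither were constant, then near a
  singular point a suitable value of the larger eigenvalue has a compact level set, on which the
  smaller eigenvalue attains its maximum; but there the two eigenvalues are local coordinates, a
  contradiction. So one eigenvalue is a constant \<open>\<lambda>\<close>, the other one is \<open>v - \<lambda>\<close>, and
  an \<open>m\<close>-th root of \<open>\<plusminus> (v - 2 \<lambda>)\<close> is the second coordinate of the normal form.\<close>

section \<open>Holomorphic functions of two variables\<close>

text \<open>The eigenvalues contain the square root of the discriminant, so their analyticity at a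
  singular point is not given. It comes from a transport equation for the discriminant itself: in
  complex variables the discriminant is a function of one characteristic coordinate times a nowhere
  zero factor, hence a power times a unit, and if it is nonnegative it has a holomorphic square
  root.

  gl-regularity enters through \<open>l\<^sub>1\<^sub>2 \<noteq> 0\<close>: wherever the
  discriminant is not positive, some chart has this property, if necessary after exchanging the
  coordinates. Germs are taken at no other points.

  The level set of the larger eigenvalue is global and may leave the neighbourhood of the given
  singular point. Compactness gives a uniform bound: a point at which both eigenvalues are close to
  the double eigenvalue \<lambda> lies near a singular point with that same \<lambda>, and on the
  chosen level set the maximum of the smaller eigenvalue is squeezed into this range.\<close>

definition psr :: "(nat \<Rightarrow> nat \<Rightarrow> complex) \<Rightarrow> (complex \<times> complex \<Rightarrow> complex) \<Rightarrow> real \<Rightarrow> bool" where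
  "psr a F r \<longleftrightarrow> (\<forall>z w. norm z < r \<longrightarrow> norm w < r \<longrightarrow>
     ((\<lambda>(i, j). a i j * z ^ i * w ^ j) has_sum F (z, w)) UNIV)"

text \<open>A real Frechet derivative of complex-linear form in a whole neighbourhood: sums,
  products and composites then reduce to the real chain rule, and \<open>hol2_psr\<close> recovers
  the power series. In \<open>psr\<close> the summation over index pairs is unordered, so
  convergence is absolute and regrouping is free.\<close>

definition hol2 :: "(complex \<times> complex \<Rightarrow> complex) \<Rightarrow> complex \<times> complex \<Rightarrow> bool" where
  "hol2 F p \<longleftrightarrow> (\<forall>\<^sub>F q in nhds p. \<exists>a b. (F has_derivative (\<lambda>h. a * fst h + b * snd h)) (at q))"

definition dz :: "(complex \<times> complex \<Rightarrow> complex) \<Rightarrow> complex \<times> complex \<Rightarrow> complex" where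
  "dz F q = frechet_derivative F (at q) (1, 0)"

definition dw :: "(complex \<times> complex \<Rightarrow> complex) \<Rightarrow> complex \<times> complex \<Rightarrow> complex" where
  "dw F q = frechet_derivative F (at q) (0, 1)"

lemma dz_dw_eq:
  assumes "(F has_derivative (\<lambda>h. a * fst h + b * snd h)) (at q)"
  shows "dz F q = a" "dw F q = b"
proof -
  have "frechet_derivative F (at q) = (\<lambda>h. a * fst h + b * snd h)"
    using assms frechet_derivative_at by metis
  then show "dz F q = a" "dw F q = b" by (simp_all add: dz_def dw_def)
qed

section \<open>Double power series: coefficient bounds and termwise differentiation\<close>

lemma has_sum_geometric2:
  fixes C x :: real
  assumes "0 \<le> x" "x < 1"
  shows "((\<lambda>(i, j). C * x ^ (i + j)) has_sum C / (1 - x)\<^sup>2) (UNIV :: (nat \<times> nat) set)"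
proof -
  have g: "((\<lambda>i. x ^ i) has_sum (1 / (1 - x))) UNIV"
    by (rule sums_nonneg_imp_has_sum) (use assms geometric_sums[of x] in auto)
  have 1: "((\<lambda>j. x ^ (i + j)) has_sum x ^ i * (1 / (1 - x))) UNIV" for i
    unfolding power_add by (rule has_sum_cmult_right[OF g])
  have 2: "((\<lambda>i. x ^ i * (1 / (1 - x))) has_sum (1 / (1 - x)) * (1 / (1 - x))) UNIV"
    by (rule has_sum_cmult_left[OF g])
  have "(\<lambda>(i, j). x ^ (i + j)) summable_on (UNIV \<times> (UNIV :: nat set))"
    by (rule summable_on_SigmaI[where g = "\<lambda>i. x ^ i * (1 / (1 - x))"])
      (use 1 2 assms in \<open>auto simp: summable_on_def\<close>)
  then have "((\<lambda>(i, j). x ^ (i + j)) has_sum (1 / (1 - x)) * (1 / (1 - x))) (UNIV \<times> UNIV)"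
    by (intro has_sum_SigmaI[OF _ 2]) (use 1 in auto)
  from has_sum_cmult_right[OF this, of C] show ?thesis
    by (simp add: case_prod_unfold power2_eq_square)
qed

lemma norm_psterm_le:
  fixes a :: "nat \<Rightarrow> nat \<Rightarrow> complex"
  assumes "\<And>i j. norm (a i j) \<le> C * K ^ (i + j)" "0 \<le> K" "norm z \<le> \<rho>" "norm w \<le> \<rho>"
  shows "norm (a i j * z ^ i * w ^ j) \<le> C * (K * \<rho>) ^ (i + j)"
proof -
  have "0 \<le> \<rho>" using assms(3) norm_ge_zero order_trans by blast
  have "norm (a i j * z ^ i * w ^ j) = norm (a i j) * (norm z ^ i * norm w ^ j)"
    by (simp add: norm_mult norm_power)
  also have "\<dots> \<le> (C * K ^ (i + j)) * (\<rho> ^ i * \<rho> ^ j)"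
    using assms \<open>0 \<le> \<rho>\<close>
    by (intro mult_mono power_mono) (auto intro: order_trans[OF norm_ge_zero])
  finally show ?thesis by (simp add: power_mult_distrib power_add algebra_simps)
qed

lemma psr_of_bound:
  assumes "\<And>i j. norm (a i j) \<le> C * K ^ (i + j)" "K > 0"
  shows "psr a (\<lambda>(z, w). \<Sum>\<^sub>\<infinity>(i, j). a i j * z ^ i * w ^ j) (1 / K)"
  unfolding psr_def
proof (intro allI impI)
  fix z w :: complex
  assume zw: "norm z < 1 / K" "norm w < 1 / K"
  define \<rho> where "\<rho> = max (norm z) (norm w)"
  have \<rho>: "0 \<le> K * \<rho>" "K * \<rho> < 1"
    using zw assms(2) by (auto simp: \<rho>_def max_def field_simps)
  have "(\<lambda>x. norm (case x of (i, j) \<Rightarrow> a i j * z ^ i * w ^ j)) summable_on UNIV"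
  proof (rule Infinite_Sum.abs_summable_on_comparison_test')
    show "(\<lambda>(i, j). C * (K * \<rho>) ^ (i + j)) summable_on UNIV"
      using has_sum_geometric2[OF \<rho>] by (auto simp: summable_on_def)
    show "norm (case x of (i, j) \<Rightarrow> a i j * z ^ i * w ^ j) \<le> (case x of (i, j) \<Rightarrow> C * (K * \<rho>) ^ (i + j))" for x
      using norm_psterm_le[OF assms(1), of z \<rho> w] assms(2) by (auto simp: \<rho>_def split: prod.split)
  qed
  from has_sum_infsum[OF abs_summable_summable[OF this]]
  show "((\<lambda>(i, j). a i j * z ^ i * w ^ j) has_sum (case (z, w) of (z, w) \<Rightarrow> \<Sum>\<^sub>\<infinity>(i, j). a i j * z ^ i * w ^ j)) UNIV"
    by simp
qed

text \<open>Summability at the single point (\<rho>, \<rho>) suffices: it is absolute, so every term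
  is bounded by the sum of the norms. The point is real, so a series known only at real points also
  gets its convergence on a complex bidisc from here.\<close>

lemma bound_of_summable:
  fixes a :: "nat \<Rightarrow> nat \<Rightarrow> complex"
  assumes "(\<lambda>(i, j). a i j * of_real \<rho> ^ i * of_real \<rho> ^ j) summable_on UNIV" "\<rho> > 0"
  obtains C where "C \<ge> 0" "\<And>i j. norm (a i j) \<le> C * (1 / \<rho>) ^ (i + j)"
proof -
  have "(\<lambda>x. norm (case x of (i, j) \<Rightarrow> a i j * of_real \<rho> ^ i * of_real \<rho> ^ j)) summable_on UNIV"
    using assms(1) summable_on_iff_abs_summable_on_complex by blast
  then have s: "(\<lambda>(i, j). norm (a i j) * \<rho> ^ (i + j)) summable_on UNIV"
    using assms(2) by (simp add: case_prod_unfold norm_mult norm_power power_add mult.assoc)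
  define C where "C = (\<Sum>\<^sub>\<infinity>(i, j). norm (a i j) * \<rho> ^ (i + j))"
  have le: "norm (a i j) * \<rho> ^ (i + j) \<le> C" for i j
  proof -
    have "(\<Sum>\<^sub>\<infinity>(i, j)\<in>{(i, j)}. norm (a i j) * \<rho> ^ (i + j)) \<le> C"
      unfolding C_def
      by (rule infsum_mono_neutral) (use s assms(2) in auto)
    then show ?thesis by simp
  qed
  show ?thesis
  proof
    show "C \<ge> 0" using le[of 0 0] order_trans[OF norm_ge_zero[of "a 0 0"]] by simp
    show "norm (a i j) \<le> C * (1 / \<rho>) ^ (i + j)" for i j
      using le[of i j] assms(2) by (simp add: power_one_over field_simps)
  qed
qed

lemma psr_bound:
  assumes "psr a F r" "r > 0"
  obtains C K where "C \<ge> 0" "K \<ge> 1" "1 / K \<le> r" "\<And>i j. norm (a i j) \<le> C * K ^ (i + j)"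
proof -
  \<comment> \<open>Half the radius places (\<rho>, \<rho>) strictly inside the bidisc, and the cap
    1 ensures \<open>1 / \<rho> \<ge> 1\<close>, the value taken for \<open>K\<close>.\<close>
  define \<rho> where "\<rho> = min (r / 2) 1"
  have \<rho>: "\<rho> > 0" "\<rho> < r" "\<rho> \<le> 1" using assms(2) by (auto simp: \<rho>_def min_def)
  have "(\<lambda>(i, j). a i j * of_real \<rho> ^ i * of_real \<rho> ^ j) summable_on UNIV"
    using assms(1) \<rho> unfolding psr_def summable_on_def
    by (intro exI[of _ "F (of_real \<rho>, of_real \<rho>)"]) auto
  from bound_of_summable[OF this \<open>\<rho> > 0\<close>] obtain C where
    "C \<ge> 0" "\<And>i j. norm (a i j) \<le> C * (1 / \<rho>) ^ (i + j)" by blast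
  then show ?thesis using \<rho> by (intro that[of C "1 / \<rho>"]) (auto simp: field_simps)
qed

lemma psr_mono: "psr a F r \<Longrightarrow> r' \<le> r \<Longrightarrow> psr a F r'"
  unfolding psr_def by (meson order_less_le_trans)

text \<open>Termwise differentiation by the Weierstrass test. The double series is enumerated along
  \<open>prod_decode\<close>, which turns it into an ordinary series of functions; absolute
  convergence makes the order immaterial. The coefficients of both partials are part of the
  conclusion, so that the lemma can be iterated.\<close>

lemma psr_has_derivative:
  assumes ps: "psr a F r" and r: "r > 0"
  shows "\<exists>\<rho>>0. \<exists>P Q. psr (\<lambda>i j. of_nat (Suc i) * a (Suc i) j) P \<rho> \<and>
           psr (\<lambda>i j. of_nat (Suc j) * a i (Suc j)) Q \<rho> \<and>
           (\<forall>z w. norm z < \<rho> \<longrightarrow> norm w < \<rho> \<longrightarrow>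
              (F has_derivative (\<lambda>h. P (z, w) * fst h + Q (z, w) * snd h)) (at (z, w)))"
proof -
  obtain C K where C: "C \<ge> 0" "K \<ge> 1" "1 / K \<le> r" and b: "\<And>i j. norm (a i j) \<le> C * K ^ (i + j)"
    using psr_bound[OF assms] by blast
  \<comment> \<open>The factor \<open>i\<close> of a differentiated term is at most
    \<open>2 ^ i\<close>; a quarter of the radius \<open>1 / K\<close> leaves the majorant
    \<open>(2 * (K * \<rho>)) ^ (i + j) = (1 / 2) ^ (i + j)\<close>, up to the constant
    \<open>C / \<rho>\<close>.\<close>
  define \<rho> where "\<rho> = 1 / (4 * K)"
  have \<rho>: "\<rho> > 0" "K * \<rho> = 1 / 4" "\<rho> \<le> r" "\<rho> \<le> 1 / (2 * K)"
    using C by (auto simp: \<rho>_def field_simps)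
  have two: "real n \<le> 2 ^ n" for n
    using less_imp_le[OF of_nat_less_two_power] .
  define p where "p = (\<lambda>n (q::complex \<times> complex). case prod_decode n of (i, j) \<Rightarrow> of_nat i * a i j * fst q ^ (i - 1) * snd q ^ j)"
  define q' where "q' = (\<lambda>n (q::complex \<times> complex). case prod_decode n of (i, j) \<Rightarrow> of_nat j * a i j * fst q ^ i * snd q ^ (j - 1))"
  define f where "f = (\<lambda>n (q::complex \<times> complex). case prod_decode n of (i, j) \<Rightarrow> a i j * fst q ^ i * snd q ^ j)"
  define M where "M = (\<lambda>n. case prod_decode n of (i, j) \<Rightarrow> (C / \<rho>) * (1 / 2) ^ (i + j))"
  define S where "S = ball (0::complex) \<rho> \<times> ball (0::complex) \<rho>"
  have S: "open S" "convex S" "(0, 0) \<in> S"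
    using \<rho> by (auto simp: S_def open_Times convex_Times)
  have "M summable_on UNIV"
  proof -
    have "(\<lambda>(i, j). (C / \<rho>) * (1 / 2) ^ (i + j)) summable_on (UNIV :: (nat \<times> nat) set)"
      using has_sum_geometric2[of "1 / 2" "C / \<rho>"] by (auto simp: summable_on_def)
    then show ?thesis unfolding M_def
      using summable_on_reindex_bij_betw[OF bij_prod_decode] by fastforce
  qed
  then have Msum: "summable M" using summable_on_imp_summable by blast
  have pow: "(n::real) * x ^ (i - 1) \<le> 2 ^ i * \<rho> ^ i / \<rho>" if "n = real i" "0 \<le> x" "x \<le> \<rho>" for n x i
  proof (cases i)
    case (Suc k)
    have "n * x ^ k \<le> 2 ^ i * \<rho> ^ k"
      using that two[of i] by (intro mult_mono power_mono) auto
    also have "\<dots> = 2 ^ i * \<rho> ^ i / \<rho>" using \<rho> Suc by simp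
    finally show ?thesis using Suc by simp
  qed (use that \<rho> in auto)
  have key: "norm (a i j) * (X * Y) \<le> (C / \<rho>) * (1 / 2) ^ (i + j)"
    if "0 \<le> X" "0 \<le> Y" "X * Y \<le> 2 ^ (i + j) * \<rho> ^ (i + j) / \<rho>" for i j X Y
  proof -
    have "norm (a i j) * (X * Y) \<le> (C * K ^ (i + j)) * (2 ^ (i + j) * \<rho> ^ (i + j) / \<rho>)"
      using that b C by (intro mult_mono) auto
    also have "\<dots> = (C / \<rho>) * (2 * (K * \<rho>)) ^ (i + j)"
      by (simp add: power_mult_distrib)
    finally show ?thesis using \<rho> by simp
  qed
  have pM: "norm (p n q) \<le> M n" if "q \<in> S" for n q
  proof -
    obtain i j where ij: "prod_decode n = (i, j)" by fastforce
    have "(real i * norm (fst q) ^ (i - 1)) * norm (snd q) ^ j \<le> (2 ^ i * \<rho> ^ i / \<rho>) * (2 ^ j * \<rho> ^ j)"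
    proof (rule mult_mono)
      show "norm (snd q) ^ j \<le> 2 ^ j * \<rho> ^ j"
        using that \<rho> unfolding S_def power_mult_distrib[symmetric]
        by (intro power_mono) (auto simp: mem_Times_iff dist_norm)
    qed (use pow[of "real i" i "norm (fst q)"] that \<rho> in \<open>auto simp: S_def mem_Times_iff\<close>)
    then have "(real i * norm (fst q) ^ (i - 1)) * norm (snd q) ^ j \<le> 2 ^ (i + j) * \<rho> ^ (i + j) / \<rho>"
      by (simp add: power_add field_simps)
    from key[OF _ _ this] show ?thesis
      by (simp add: p_def M_def ij norm_mult norm_power mult_ac)
  qed
  have qM: "norm (q' n q) \<le> M n" if "q \<in> S" for n q
  proof -
    obtain i j where ij: "prod_decode n = (i, j)" by fastforce
    have "(real j * norm (snd q) ^ (j - 1)) * norm (fst q) ^ i \<le> (2 ^ j * \<rho> ^ j / \<rho>) * (2 ^ i * \<rho> ^ i)"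
    proof (rule mult_mono)
      show "norm (fst q) ^ i \<le> 2 ^ i * \<rho> ^ i"
        using that \<rho> unfolding S_def power_mult_distrib[symmetric]
        by (intro power_mono) (auto simp: mem_Times_iff dist_norm)
    qed (use pow[of "real j" j "norm (snd q)"] that \<rho> in \<open>auto simp: S_def mem_Times_iff\<close>)
    then have "(real j * norm (snd q) ^ (j - 1)) * norm (fst q) ^ i \<le> 2 ^ (i + j) * \<rho> ^ (i + j) / \<rho>"
      by (simp add: power_add field_simps)
    from key[OF _ _ this] show ?thesis
      by (simp add: q'_def M_def ij norm_mult norm_power mult_ac)
  qed
  have up: "uniform_limit S (\<lambda>n x. \<Sum>i<n. p i x) (\<lambda>x. suminf (\<lambda>i. p i x)) sequentially"
    by (rule Weierstrass_m_test[OF pM Msum])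
  have uq: "uniform_limit S (\<lambda>n x. \<Sum>i<n. q' i x) (\<lambda>x. suminf (\<lambda>i. q' i x)) sequentially"
    by (rule Weierstrass_m_test[OF qM Msum])
  have fF: "(\<lambda>n. f n x) sums F x" if "x \<in> S" for x
  proof -
    have "((\<lambda>(i, j). a i j * fst x ^ i * snd x ^ j) has_sum F x) UNIV"
      using ps that \<rho> unfolding psr_def S_def by (cases x) auto
    then have "((\<lambda>n. (\<lambda>(i, j). a i j * fst x ^ i * snd x ^ j) (prod_decode n)) has_sum F x) UNIV"
      using has_sum_reindex_bij_betw[OF bij_prod_decode] by blast
    then show ?thesis by (intro has_sum_imp_sums) (simp add: f_def)
  qed
  have "\<exists>g. \<forall>x\<in>S. (\<lambda>n. f n x) sums g x \<and>
      (g has_derivative (\<lambda>h. suminf (\<lambda>i. p i x) * fst h + suminf (\<lambda>i. q' i x) * snd h)) (at x within S)"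
  proof (rule has_derivative_series[where f = f and x = "(0, 0)" and S = S])
    show "(f n has_derivative (\<lambda>h. p n x * fst h + q' n x * snd h)) (at x within S)" for n x
      unfolding f_def p_def q'_def
      by (cases "prod_decode n") (auto intro!: derivative_eq_intros simp: algebra_simps)
    show "convex S" "(0, 0) \<in> S" "(\<lambda>n. f n (0, 0)) sums F (0, 0)"
      using S fF by auto
  next
    fix e :: real assume "e > 0"
    have "\<forall>\<^sub>F n in sequentially. \<forall>x\<in>S. dist (\<Sum>i<n. p i x) (suminf (\<lambda>i. p i x)) < e / 2"
      "\<forall>\<^sub>F n in sequentially. \<forall>x\<in>S. dist (\<Sum>i<n. q' i x) (suminf (\<lambda>i. q' i x)) < e / 2"
      using up uq \<open>e > 0\<close> by (auto dest!: uniform_limitD[where e = "e / 2"])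
    then show "\<forall>\<^sub>F n in sequentially. \<forall>x\<in>S. \<forall>h. norm ((\<Sum>i<n. p i x * fst h + q' i x * snd h) -
        (suminf (\<lambda>i. p i x) * fst h + suminf (\<lambda>i. q' i x) * snd h)) \<le> e * norm h"
    proof eventually_elim
      case (elim n)
      show ?case
      proof (intro ballI allI)
        fix x and h :: "complex \<times> complex" assume x: "x \<in> S"
        have "(\<Sum>i<n. p i x * fst h + q' i x * snd h) -
            (suminf (\<lambda>i. p i x) * fst h + suminf (\<lambda>i. q' i x) * snd h) =
            ((\<Sum>i<n. p i x) - suminf (\<lambda>i. p i x)) * fst h + ((\<Sum>i<n. q' i x) - suminf (\<lambda>i. q' i x)) * snd h"
          by (simp add: sum.distrib left_diff_distrib flip: sum_distrib_right)
        also have "norm \<dots> \<le> e / 2 * norm h + e / 2 * norm h"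
        proof (rule norm_triangle_mono)
          show "norm (((\<Sum>i<n. p i x) - suminf (\<lambda>i. p i x)) * fst h) \<le> e / 2 * norm h"
            unfolding norm_mult using elim(1) x \<open>e > 0\<close> norm_fst_le[of "fst h" "snd h"]
            by (intro mult_mono) (auto simp: dist_norm intro: less_imp_le)
          show "norm (((\<Sum>i<n. q' i x) - suminf (\<lambda>i. q' i x)) * snd h) \<le> e / 2 * norm h"
            unfolding norm_mult using elim(2) x \<open>e > 0\<close> norm_snd_le[of "snd h" "fst h"]
            by (intro mult_mono) (auto simp: dist_norm intro: less_imp_le)
        qed
        finally show "norm ((\<Sum>i<n. p i x * fst h + q' i x * snd h) -
            (suminf (\<lambda>i. p i x) * fst h + suminf (\<lambda>i. q' i x) * snd h)) \<le> e * norm h"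
          by simp
      qed
    qed
  qed
  then obtain g where g: "\<And>x. x \<in> S \<Longrightarrow> (\<lambda>n. f n x) sums g x"
    "\<And>x. x \<in> S \<Longrightarrow> (g has_derivative (\<lambda>h. suminf (\<lambda>i. p i x) * fst h + suminf (\<lambda>i. q' i x) * snd h)) (at x within S)"
    by blast
  have gF: "g x = F x" if "x \<in> S" for x
    using g(1)[OF that] fF[OF that] sums_unique2 by blast
  have der: "(F has_derivative (\<lambda>h. suminf (\<lambda>i. p i x) * fst h + suminf (\<lambda>i. q' i x) * snd h)) (at x)" if "x \<in> S" for x
  proof -
    have "(g has_derivative (\<lambda>h. suminf (\<lambda>i. p i x) * fst h + suminf (\<lambda>i. q' i x) * snd h)) (at x)"
      using g(2)[OF that] at_within_open[OF that S(1)] by simp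
    then show ?thesis by (rule has_derivative_transform_within_open[OF _ S(1) that gF])
  qed
  have psum: "((\<lambda>n. p n x) has_sum suminf (\<lambda>i. p i x)) UNIV" "((\<lambda>n. q' n x) has_sum suminf (\<lambda>i. q' i x)) UNIV"
    if "x \<in> S" for x
  proof -
    have 1: "summable (\<lambda>n. norm (p n x))" "summable (\<lambda>n. norm (q' n x))"
      by (rule summable_comparison_test'[OF Msum, of 0], use pM[OF that] qM[OF that] in simp)+
    show "((\<lambda>n. p n x) has_sum suminf (\<lambda>i. p i x)) UNIV"
      by (rule norm_summable_imp_has_sum[OF 1(1) summable_sums[OF summable_norm_cancel[OF 1(1)]]])
    show "((\<lambda>n. q' n x) has_sum suminf (\<lambda>i. q' i x)) UNIV"
      by (rule norm_summable_imp_has_sum[OF 1(2) summable_sums[OF summable_norm_cancel[OF 1(2)]]])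
  qed
  have P: "psr (\<lambda>i j. of_nat (Suc i) * a (Suc i) j) (\<lambda>x. suminf (\<lambda>i. p i x)) \<rho>"
    unfolding psr_def
  proof (intro allI impI)
    fix z w :: complex assume zw: "norm z < \<rho>" "norm w < \<rho>"
    then have x: "(z, w) \<in> S" by (simp add: S_def)
    have "((\<lambda>n. (\<lambda>(i, j). of_nat i * a i j * z ^ (i - 1) * w ^ j) (prod_decode n)) has_sum suminf (\<lambda>i. p i (z, w))) UNIV"
      using psum(1)[OF x] by (simp add: p_def)
    then have "((\<lambda>(i, j). of_nat i * a i j * z ^ (i - 1) * w ^ j) has_sum suminf (\<lambda>i. p i (z, w))) UNIV"
      using has_sum_reindex_bij_betw[OF bij_prod_decode] by blast
    \<comment> \<open>Terms with \<open>i = 0\<close> carry the factor 0, so the sum may be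
      restricted to the indices \<open>(Suc i, j)\<close> and reindexed.\<close>
    then have "((\<lambda>(i, j). of_nat i * a i j * z ^ (i - 1) * w ^ j) has_sum suminf (\<lambda>i. p i (z, w))) ((\<lambda>(i, j). (Suc i, j)) ` UNIV)"
    proof (rule has_sum_cong_neutral[THEN iffD1, rotated -1])
      show "(\<lambda>(i, j). of_nat i * a i j * z ^ (i - 1) * w ^ j) x = 0" if "x \<in> UNIV - (\<lambda>(i, j). (Suc i, j)) ` UNIV" for x
        using that by (cases x; cases "fst x") (auto simp: image_iff)
    qed auto
    then have "((\<lambda>(i, j). of_nat i * a i j * z ^ (i - 1) * w ^ j) \<circ> (\<lambda>(i, j). (Suc i, j)) has_sum suminf (\<lambda>i. p i (z, w))) UNIV"
      by (subst (asm) has_sum_reindex) (auto simp: inj_on_def)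
    then show "((\<lambda>(i, j). of_nat (Suc i) * a (Suc i) j * z ^ i * w ^ j) has_sum suminf (\<lambda>i. p i (z, w))) UNIV"
      by (simp add: o_def case_prod_unfold)
  qed
  have Q: "psr (\<lambda>i j. of_nat (Suc j) * a i (Suc j)) (\<lambda>x. suminf (\<lambda>i. q' i x)) \<rho>"
    unfolding psr_def
  proof (intro allI impI)
    fix z w :: complex assume zw: "norm z < \<rho>" "norm w < \<rho>"
    then have x: "(z, w) \<in> S" by (simp add: S_def)
    have "((\<lambda>n. (\<lambda>(i, j). of_nat j * a i j * z ^ i * w ^ (j - 1)) (prod_decode n)) has_sum suminf (\<lambda>i. q' i (z, w))) UNIV"
      using psum(2)[OF x] by (simp add: q'_def)
    then have "((\<lambda>(i, j). of_nat j * a i j * z ^ i * w ^ (j - 1)) has_sum suminf (\<lambda>i. q' i (z, w))) UNIV"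
      using has_sum_reindex_bij_betw[OF bij_prod_decode] by blast
    then have "((\<lambda>(i, j). of_nat j * a i j * z ^ i * w ^ (j - 1)) has_sum suminf (\<lambda>i. q' i (z, w))) ((\<lambda>(i, j). (i, Suc j)) ` UNIV)"
    proof (rule has_sum_cong_neutral[THEN iffD1, rotated -1])
      show "(\<lambda>(i, j). of_nat j * a i j * z ^ i * w ^ (j - 1)) x = 0" if "x \<in> UNIV - (\<lambda>(i, j). (i, Suc j)) ` UNIV" for x
        using that by (cases x; cases "snd x") (auto simp: image_iff)
    qed auto
    then have "((\<lambda>(i, j). of_nat j * a i j * z ^ i * w ^ (j - 1)) \<circ> (\<lambda>(i, j). (i, Suc j)) has_sum suminf (\<lambda>i. q' i (z, w))) UNIV"
      by (subst (asm) has_sum_reindex) (auto simp: inj_on_def)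
    then show "((\<lambda>(i, j). of_nat (Suc j) * a i (Suc j) * z ^ i * w ^ j) has_sum suminf (\<lambda>i. q' i (z, w))) UNIV"
      by (simp add: o_def case_prod_unfold)
  qed
  have "\<forall>z w. norm z < \<rho> \<longrightarrow> norm w < \<rho> \<longrightarrow> (F has_derivative
      (\<lambda>h. suminf (\<lambda>i. p i (z, w)) * fst h + suminf (\<lambda>i. q' i (z, w)) * snd h)) (at (z, w))"
    using der by (simp add: S_def)
  with \<rho>(1) P Q show ?thesis by blast
qed

section \<open>Calculus of complex partial derivatives\<close>

text \<open>The derivative is named by \<open>dz\<close> and \<open>dw\<close> instead of being
  quantified existentially, so that each calculus rule can deliver differentiability and both
  partials at once.\<close>

definition cdiff :: "(complex \<times> complex \<Rightarrow> complex) \<Rightarrow> complex \<times> complex \<Rightarrow> bool" where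
  "cdiff F q \<longleftrightarrow> (F has_derivative (\<lambda>h. dz F q * fst h + dw F q * snd h)) (at q)"

lemma cdiffI:
  assumes "(F has_derivative (\<lambda>h. a * fst h + b * snd h)) (at q)"
  shows "cdiff F q" "dz F q = a" "dw F q = b"
  using assms dz_dw_eq[OF assms] by (simp_all add: cdiff_def)

lemma cdiffI':
  assumes "(F has_derivative F') (at q)" "\<And>h. F' h = a * fst h + b * snd h"
  shows "cdiff F q \<and> dz F q = a \<and> dw F q = b"
proof -
  have "F' = (\<lambda>h. a * fst h + b * snd h)" using assms(2) by auto
  then show ?thesis using cdiffI[of F a b q] assms(1) by auto
qed

lemma hol2_iff_cdiff: "hol2 F p \<longleftrightarrow> (\<forall>\<^sub>F q in nhds p. cdiff F q)"
proof -
  have "(\<exists>a b. (F has_derivative (\<lambda>h. a * fst h + b * snd h)) (at q)) \<longleftrightarrow> cdiff F q" for q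
    using cdiffI(1)[of F _ _ q] unfolding cdiff_def by blast
  then show ?thesis by (simp add: hol2_def)
qed

lemma hol2_eventually_hol2: "hol2 F p \<Longrightarrow> \<forall>\<^sub>F q in nhds p. hol2 F q"
  unfolding hol2_def by (subst eventually_eventually)

lemma hol2_at: "hol2 F p \<Longrightarrow> cdiff F p"
  unfolding hol2_iff_cdiff by (rule eventually_nhds_x_imp_x)

lemma has_derivative_eventually_cong:
  assumes "\<forall>\<^sub>F q in nhds p. F q = G q"
  shows "(F has_derivative D) (at p) \<longleftrightarrow> (G has_derivative D) (at p)"
proof -
  have *: "(G has_derivative D) (at p)"
    if "(F has_derivative D) (at p)" "\<forall>\<^sub>F q in nhds p. F q = G q" for F G
    using that eventually_nhds_x_imp_x[OF that(2)]
    by (intro has_derivative_transform_eventually[OF that(1)])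
      (auto simp: eventually_at_filter elim: eventually_mono)
  have "\<forall>\<^sub>F q in nhds p. G q = F q" using assms by (auto elim: eventually_mono)
  then show ?thesis using * assms by blast
qed

lemma cdiff_cong:
  assumes "\<forall>\<^sub>F q in nhds p. F q = G q"
  shows "cdiff F p = cdiff G p" "dz F p = dz G p" "dw F p = dw G p"
proof -
  have "(F has_derivative D) (at p) \<longleftrightarrow> (G has_derivative D) (at p)" for D
    by (rule has_derivative_eventually_cong[OF assms])
  then show 1: "dz F p = dz G p" "dw F p = dw G p"
    by (simp_all add: dz_def dw_def frechet_derivative_def)
  show "cdiff F p = cdiff G p"
    using has_derivative_eventually_cong[OF assms] 1 by (simp add: cdiff_def)
qed

text \<open>Agreement near \<open>p\<close> is agreement near every point close to \<open>p\<close>,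
  so the derivatives agree in a neighbourhood and not only at \<open>p\<close>. Differential
  equations between germs are transferred in this way.\<close>

lemma eventually_cong_derivs:
  assumes "\<forall>\<^sub>F q in nhds p. F q = G q"
  shows "\<forall>\<^sub>F q in nhds p. dz F q = dz G q \<and> dw F q = dw G q \<and> cdiff F q = cdiff G q"
proof -
  have "\<forall>\<^sub>F q in nhds p. \<forall>\<^sub>F q' in nhds q. F q' = G q'"
    using assms by (subst eventually_eventually)
  then show ?thesis by eventually_elim (use cdiff_cong in blast)
qed

lemma hol2_cong:
  assumes "\<forall>\<^sub>F q in nhds p. F q = G q"
  shows "hol2 F p \<longleftrightarrow> hol2 G p"
  unfolding hol2_iff_cdiff
  by (rule eventually_subst) (use eventually_cong_derivs[OF assms] in \<open>eventually_elim, simp\<close>)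

lemma cdiff_isCont: "cdiff F q \<Longrightarrow> isCont F q"
  unfolding cdiff_def using has_derivative_continuous by blast

lemma cdiff_const: "cdiff (\<lambda>_. c) q \<and> dz (\<lambda>_. c) q = 0 \<and> dw (\<lambda>_. c) q = 0"
  by (rule cdiffI') (auto intro!: derivative_eq_intros)

lemma cdiff_fst: "cdiff fst q \<and> dz fst q = 1 \<and> dw fst q = 0"
  by (rule cdiffI') (auto intro!: derivative_eq_intros)

lemma cdiff_snd: "cdiff snd q \<and> dz snd q = 0 \<and> dw snd q = 1"
  by (rule cdiffI') (auto intro!: derivative_eq_intros)

lemma cdiff_add:
  assumes "cdiff F q" "cdiff G q"
  shows "cdiff (\<lambda>q. F q + G q) q \<and> dz (\<lambda>q. F q + G q) q = dz F q + dz G q \<and>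
         dw (\<lambda>q. F q + G q) q = dw F q + dw G q"
  by (rule cdiffI'[OF has_derivative_add[OF assms[unfolded cdiff_def]]]) (simp add: algebra_simps)

lemma cdiff_diff:
  assumes "cdiff F q" "cdiff G q"
  shows "cdiff (\<lambda>q. F q - G q) q \<and> dz (\<lambda>q. F q - G q) q = dz F q - dz G q \<and>
         dw (\<lambda>q. F q - G q) q = dw F q - dw G q"
  by (rule cdiffI'[OF has_derivative_diff[OF assms[unfolded cdiff_def]]]) (simp add: algebra_simps)

lemma cdiff_mult:
  assumes "cdiff F q" "cdiff G q"
  shows "cdiff (\<lambda>q. F q * G q) q \<and> dz (\<lambda>q. F q * G q) q = dz F q * G q + F q * dz G q \<and>
         dw (\<lambda>q. F q * G q) q = dw F q * G q + F q * dw G q"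
  by (rule cdiffI'[OF has_derivative_mult[OF assms[unfolded cdiff_def]]]) (simp add: algebra_simps)

lemma cdiff_chain:
  assumes "cdiff F q" "(f has_field_derivative f') (at (F q))"
  shows "cdiff (\<lambda>q. f (F q)) q \<and> dz (\<lambda>q. f (F q)) q = f' * dz F q \<and> dw (\<lambda>q. f (F q)) q = f' * dw F q"
  by (rule cdiffI'[OF has_derivative_compose[OF assms(1)[unfolded cdiff_def]
          assms(2)[unfolded has_field_derivative_def]]]) (simp add: algebra_simps)

lemma cdiff_compose:
  assumes "cdiff F q" "cdiff G q" "cdiff H (F q, G q)"
  shows "cdiff (\<lambda>q. H (F q, G q)) q \<and>
         dz (\<lambda>q. H (F q, G q)) q = dz H (F q, G q) * dz F q + dw H (F q, G q) * dz G q \<and>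
         dw (\<lambda>q. H (F q, G q)) q = dz H (F q, G q) * dw F q + dw H (F q, G q) * dw G q"
  by (rule cdiffI'[OF has_derivative_compose[OF has_derivative_Pair[OF assms(1,2)[unfolded cdiff_def]]
          assms(3)[unfolded cdiff_def]]]) (simp add: algebra_simps)

lemma hol2_const: "hol2 (\<lambda>_. c) p" and hol2_fst: "hol2 fst p" and hol2_snd: "hol2 snd p"
  using cdiff_const cdiff_fst cdiff_snd by (auto simp: hol2_iff_cdiff)

lemma hol2_add:
  assumes "hol2 F p" "hol2 G p"
  shows "hol2 (\<lambda>q. F q + G q) p"
  using assms unfolding hol2_iff_cdiff by eventually_elim (simp add: cdiff_add)

lemma hol2_diff:
  assumes "hol2 F p" "hol2 G p"
  shows "hol2 (\<lambda>q. F q - G q) p"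
  using assms unfolding hol2_iff_cdiff by eventually_elim (simp add: cdiff_diff)

lemma hol2_mult:
  assumes "hol2 F p" "hol2 G p"
  shows "hol2 (\<lambda>q. F q * G q) p"
  using assms unfolding hol2_iff_cdiff by eventually_elim (simp add: cdiff_mult)

lemma hol2_uminus: "hol2 F p \<Longrightarrow> hol2 (\<lambda>q. - F q) p"
  using hol2_diff[OF hol2_const[of 0], of F p] by simp

lemma hol2_power: "hol2 F p \<Longrightarrow> hol2 (\<lambda>q. F q ^ n) p"
  by (induction n) (auto intro: hol2_const hol2_mult)

lemma hol2_isCont: "hol2 F p \<Longrightarrow> isCont F p"
  using cdiff_isCont hol2_at by blast

lemma eventually_nhds_isCont:
  assumes "isCont f p" "\<forall>\<^sub>F y in nhds (f p). P y"
  shows "\<forall>\<^sub>F x in nhds p. P (f x)"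
proof -
  have "filterlim f (nhds (f p)) (nhds p)"
    using assms(1) by (simp add: isCont_def tendsto_at_iff_tendsto_nhds)
  then show ?thesis using assms(2) by (simp add: filterlim_iff)
qed

lemma hol2_chain:
  assumes "hol2 F p" "f holomorphic_on S" "open S" "F p \<in> S"
  shows "hol2 (\<lambda>q. f (F q)) p"
proof -
  have "\<forall>\<^sub>F q in nhds p. F q \<in> S"
    using eventually_nhds_isCont[OF hol2_isCont[OF assms(1)]] assms(3,4) eventually_nhds_in_open by blast
  with assms(1)[unfolded hol2_iff_cdiff] show ?thesis
    unfolding hol2_iff_cdiff
    by eventually_elim (use cdiff_chain holomorphic_derivI[OF assms(2,3)] in blast)
qed

lemma hol2_compose:
  assumes "hol2 F p" "hol2 G p" "hol2 H (F p, G p)"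
  shows "hol2 (\<lambda>q. H (F q, G q)) p"
proof -
  have "isCont (\<lambda>q. (F q, G q)) p" using assms hol2_isCont by (intro continuous_intros) auto
  from eventually_nhds_isCont[OF this] assms(3)
  have "\<forall>\<^sub>F q in nhds p. cdiff H (F q, G q)" by (simp add: hol2_iff_cdiff)
  with assms(1,2)[unfolded hol2_iff_cdiff] show ?thesis
    unfolding hol2_iff_cdiff by eventually_elim (use cdiff_compose in blast)
qed

lemma hol2_divide:
  assumes "hol2 F p" "hol2 G p" "G p \<noteq> 0"
  shows "hol2 (\<lambda>q. F q / G q) p"
proof -
  have "hol2 (\<lambda>q. inverse (G q)) p"
    by (rule hol2_chain[where f = inverse and S = "- {0}", OF assms(2)])
      (use assms(3) in \<open>auto intro!: holomorphic_intros\<close>)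
  from hol2_mult[OF assms(1) this] show ?thesis by (simp add: divide_inverse)
qed

lemma hol2_translate:
  assumes "hol2 F (c + p)"
  shows "hol2 (\<lambda>q. F (c + q)) p"
proof -
  have "hol2 (\<lambda>q. F (fst c + fst q, snd c + snd q)) p"
  proof (rule hol2_compose[where F = "\<lambda>q. fst c + fst q" and G = "\<lambda>q. snd c + snd q" and H = F])
    show "hol2 F (fst c + fst p, snd c + snd p)"
      using assms by (simp add: plus_prod_def)
  qed (intro hol2_add hol2_const hol2_fst hol2_snd)+
  then show ?thesis by (simp add: plus_prod_def)
qed

text \<open>Bridge between neighbourhoods of 0 for the product metric and bidiscs, the natural
  domains of \<open>psr\<close>.\<close>

lemma eventually_nhds_bidisc:
  "(\<forall>\<^sub>F q in nhds (0::complex \<times> complex). P q) \<longleftrightarrow> (\<exists>r>0. \<forall>z w. norm z < r \<longrightarrow> norm w < r \<longrightarrow> P (z, w))"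
proof
  assume "\<forall>\<^sub>F q in nhds (0::complex \<times> complex). P q"
  then obtain d where d: "d > 0" "\<And>q. dist q 0 < d \<Longrightarrow> P q" unfolding eventually_nhds_metric by blast
  have "P (z, w)" if "norm z < d / 2" "norm w < d / 2" for z w
    using d(2)[of "(z, w)"] norm_Pair_le[of z w] that by simp
  then show "\<exists>r>0. \<forall>z w. norm z < r \<longrightarrow> norm w < r \<longrightarrow> P (z, w)"
    using d(1) by (intro exI[of _ "d / 2"]) auto
next
  assume "\<exists>r>0. \<forall>z w. norm z < r \<longrightarrow> norm w < r \<longrightarrow> P (z, w)"
  then obtain r where r: "r > 0" "\<And>z w. norm z < r \<Longrightarrow> norm w < r \<Longrightarrow> P (z, w)" by blast
  show "\<forall>\<^sub>F q in nhds 0. P q"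
    unfolding eventually_nhds_metric
  proof (intro exI[of _ r] conjI allI impI r(1))
    fix q :: "complex \<times> complex" assume "dist q 0 < r"
    then have "norm (fst q) < r" "norm (snd q) < r"
      using norm_fst_le[of "fst q" "snd q"] norm_snd_le[of "snd q" "fst q"] by simp_all
    then show "P q" using r(2)[of "fst q" "snd q"] by simp
  qed
qed

lemma psr_derivs:
  assumes "psr a F r" "r > 0"
  shows "hol2 F 0 \<and> (\<exists>\<rho>>0. psr (\<lambda>i j. of_nat (Suc i) * a (Suc i) j) (dz F) \<rho> \<and>
           psr (\<lambda>i j. of_nat (Suc j) * a i (Suc j)) (dw F) \<rho>)"
proof -
  obtain \<rho> P Q where \<rho>: "\<rho> > 0" and P: "psr (\<lambda>i j. of_nat (Suc i) * a (Suc i) j) P \<rho>"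
    and Q: "psr (\<lambda>i j. of_nat (Suc j) * a i (Suc j)) Q \<rho>"
    and D: "\<And>z w. norm z < \<rho> \<Longrightarrow> norm w < \<rho> \<Longrightarrow>
              (F has_derivative (\<lambda>h. P (z, w) * fst h + Q (z, w) * snd h)) (at (z, w))"
    using psr_has_derivative[OF assms] by blast
  have e: "cdiff F (z, w)" "dz F (z, w) = P (z, w)" "dw F (z, w) = Q (z, w)" if "norm z < \<rho>" "norm w < \<rho>" for z w
    using cdiffI[OF D[OF that]] by auto
  have "hol2 F 0"
    unfolding hol2_iff_cdiff eventually_nhds_bidisc using \<rho> e by blast
  moreover have "psr (\<lambda>i j. of_nat (Suc i) * a (Suc i) j) (dz F) \<rho>"
    "psr (\<lambda>i j. of_nat (Suc j) * a i (Suc j)) (dw F) \<rho>"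
    using P Q e unfolding psr_def by auto
  ultimately show ?thesis using \<rho> by blast
qed

section \<open>Coefficients, and the power series of a holomorphic function\<close>

lemma psr_at_0:
  assumes "psr a F r" "r > 0"
  shows "F 0 = a 0 0"
proof -
  have 1: "((\<lambda>(i, j). a i j * 0 ^ i * 0 ^ j) has_sum F (0, 0)) UNIV"
    by (rule assms(1)[unfolded psr_def, rule_format]) (use assms(2) in auto)
  have 2: "((\<lambda>(i, j). a i j * 0 ^ i * 0 ^ j) has_sum a 0 0) UNIV"
    by (rule has_sum_finite_neutralI[where B = "{(0, 0)}"]) (auto simp: power_0_left split: if_splits)
  show ?thesis using has_sum_unique[OF 1 2] by (simp add: zero_prod_def)
qed

text \<open>Evaluation at 0 reads off the constant coefficient, and differentiation shifts the
  indices; the induction therefore runs over all coefficient families and functions.\<close>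

lemma psr_unique:
  assumes "psr a F r" "psr b F r" "r > 0"
  shows "a i j = b i j"
  using assms
proof (induction i arbitrary: a b F r)
  case 0
  then show ?case
  proof (induction j arbitrary: a b F r)
    case 0
    then show ?case using psr_at_0[of a F r] psr_at_0[of b F r] by simp
  next
    case (Suc j)
    obtain \<rho>1 where 1: "\<rho>1 > 0" "psr (\<lambda>i j. of_nat (Suc j) * a i (Suc j)) (dw F) \<rho>1"
      using psr_derivs[of a F r] Suc.prems by blast
    obtain \<rho>2 where 2: "\<rho>2 > 0" "psr (\<lambda>i j. of_nat (Suc j) * b i (Suc j)) (dw F) \<rho>2"
      using psr_derivs[of b F r] Suc.prems by blast
    have "of_nat (Suc j) * a 0 (Suc j) = of_nat (Suc j) * b 0 (Suc j)"
      using Suc.IH[OF psr_mono[OF 1(2), of "min \<rho>1 \<rho>2"] psr_mono[OF 2(2), of "min \<rho>1 \<rho>2"]] 1(1) 2(1) by simp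
    then show ?case by (simp del: of_nat_Suc)
  qed
next
  case (Suc i)
  obtain \<rho>1 where 1: "\<rho>1 > 0" "psr (\<lambda>i j. of_nat (Suc i) * a (Suc i) j) (dz F) \<rho>1"
    using psr_derivs[of a F r] Suc.prems by blast
  obtain \<rho>2 where 2: "\<rho>2 > 0" "psr (\<lambda>i j. of_nat (Suc i) * b (Suc i) j) (dz F) \<rho>2"
    using psr_derivs[of b F r] Suc.prems by blast
  have "of_nat (Suc i) * a (Suc i) j = of_nat (Suc i) * b (Suc i) j"
    using Suc.IH[OF psr_mono[OF 1(2), of "min \<rho>1 \<rho>2"] psr_mono[OF 2(2), of "min \<rho>1 \<rho>2"]] 1(1) 2(1) by simp
  then show ?case by (simp del: of_nat_Suc)
qed

lemma cdiff_holomorphic: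
  assumes "\<And>z. z \<in> S \<Longrightarrow> cdiff F (z, w)" "open S"
  shows "(\<lambda>z. F (z, w)) holomorphic_on S"
  unfolding holomorphic_on_open[OF assms(2)]
proof (intro ballI exI)
  fix z assume "z \<in> S"
  then have "(F has_derivative (\<lambda>h. dz F (z, w) * fst h + dw F (z, w) * snd h)) (at (z, w))"
    using assms(1) by (simp add: cdiff_def)
  from has_derivative_compose[OF has_derivative_Pair[OF has_derivative_ident has_derivative_const], OF this]
  show "((\<lambda>z. F (z, w)) has_field_derivative dz F (z, w)) (at z)"
    by (simp add: has_field_derivative_def)
qed

lemma cdiff_holomorphic_snd:
  assumes "\<And>w. w \<in> S \<Longrightarrow> cdiff F (z, w)" "open S"
  shows "(\<lambda>w. F (z, w)) holomorphic_on S"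
  unfolding holomorphic_on_open[OF assms(2)]
proof (intro ballI exI)
  fix w assume "w \<in> S"
  then have "(F has_derivative (\<lambda>h. dz F (z, w) * fst h + dw F (z, w) * snd h)) (at (z, w))"
    using assms(1) by (simp add: cdiff_def)
  from has_derivative_compose[OF has_derivative_Pair[OF has_derivative_const has_derivative_ident], OF this]
  show "((\<lambda>w. F (z, w)) has_field_derivative dw F (z, w)) (at w)"
    by (simp add: has_field_derivative_def)
qed

text \<open>Expansion in \<open>z\<close> for fixed \<open>w\<close>, followed by expansion of every
  coefficient in \<open>w\<close>. Cauchy estimates in both variables make the double series
  absolutely convergent, and summing it row by row returns \<open>F\<close>. The essential point is
  that the coefficients \<open>c n\<close> of the first expansion are holomorphic in
  \<open>w\<close>.\<close>

lemma hol2_psr: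
  assumes "hol2 F 0"
  shows "\<exists>a r. r > 0 \<and> psr a F r"
proof -
  obtain r0 where r0: "r0 > 0" and cd: "\<And>z w. norm z < r0 \<Longrightarrow> norm w < r0 \<Longrightarrow> cdiff F (z, w)"
    using assms unfolding hol2_iff_cdiff eventually_nhds_bidisc by blast
  define R where "R = r0 / 2"
  have R: "R > 0" "R < r0" using r0 by (auto simp: R_def)
  have hz: "(\<lambda>z. F (z, w)) holomorphic_on ball 0 r0" if "norm w < r0" for w
    by (rule cdiff_holomorphic) (use cd that in auto)
  have hw: "(\<lambda>w. F (z, w)) holomorphic_on ball 0 r0" if "norm z < r0" for z
    by (rule cdiff_holomorphic_snd) (use cd that in auto)
  have "continuous_on (cball 0 R \<times> cball 0 R) F"
  proof (rule continuous_at_imp_continuous_on, rule ballI)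
    fix q :: "complex \<times> complex" assume "q \<in> cball 0 R \<times> cball 0 R"
    then show "isCont F q" using cd[of "fst q" "snd q"] R by (intro cdiff_isCont) auto
  qed
  then have "bounded (F ` (cball 0 R \<times> cball 0 R))"
    by (intro compact_imp_bounded compact_continuous_image compact_Times) auto
  then obtain M where M: "\<And>q. q \<in> cball 0 R \<times> cball 0 R \<Longrightarrow> norm (F q) \<le> M"
    unfolding bounded_iff by blast
  have M0: "M \<ge> 0" using order_trans[OF norm_ge_zero M[of "(0, 0)"]] R by simp
  define c where "c = (\<lambda>n w. (deriv ^^ n) (\<lambda>z. F (z, w)) 0 / fact n)"
  have cb: "norm (c n w) \<le> M / R ^ n" if "norm w \<le> R" for n w
  proof -
    have "norm ((deriv ^^ n) (\<lambda>z. F (z, w)) 0) \<le> fact n * M / R ^ n"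
    proof (rule Cauchy_inequality)
      show "(\<lambda>z. F (z, w)) holomorphic_on ball 0 R"
        by (rule holomorphic_on_subset[OF hz]) (use that R in auto)
      show "continuous_on (cball 0 R) (\<lambda>z. F (z, w))"
        by (rule continuous_on_subset[OF holomorphic_on_imp_continuous_on[OF hz]]) (use that R in auto)
      show "norm (F (x, w)) \<le> M" if "norm (0 - x) = R" for x
        by (rule M) (use that \<open>norm w \<le> R\<close> in auto)
    qed (rule R)
    then show ?thesis by (simp add: c_def norm_divide field_simps)
  qed
  have cs: "(\<lambda>n. c n w * z ^ n) sums F (z, w)" if "norm z < r0" "norm w < r0" for z w
    using holomorphic_power_series[OF hz[OF that(2)], of z] that(1) by (simp add: c_def)
  \<comment> \<open>\<open>c n\<close> is a uniform limit of \<open>f m\<close>: the Taylor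
    remainder of order \<open>n\<close> in \<open>z\<close>, taken at points
    \<open>\<zeta> m\<close> tending to 0 and divided by \<open>\<zeta> m ^ n\<close>. Each
    \<open>f m\<close> is holomorphic in \<open>w\<close>, because the coefficients subtracted in it
    have index below \<open>n\<close>.\<close>
  have chol: "c n holomorphic_on ball 0 R" for n
  proof (induction n rule: less_induct)
    case (less n)
    define \<zeta> where "\<zeta> = (\<lambda>m::nat. complex_of_real (R / (2 + real m)))"
    have nz: "norm (\<zeta> m) = R / (2 + real m)" for m
      using R unfolding \<zeta>_def norm_of_real by simp
    have \<zeta>: "\<zeta> m \<noteq> 0" "norm (\<zeta> m) \<le> R / 2" "norm (\<zeta> m) < r0" for m
    proof -
      show "\<zeta> m \<noteq> 0" using nz[of m] R by auto
      have "R / (2 + real m) \<le> R / 2" using R by (intro divide_left_mono) auto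
      then show "norm (\<zeta> m) \<le> R / 2" using nz by simp
      then show "norm (\<zeta> m) < r0" using R by simp
    qed
    define f where "f = (\<lambda>m w. (F (\<zeta> m, w) - (\<Sum>i<n. c i w * \<zeta> m ^ i)) / \<zeta> m ^ n)"
    \<comment> \<open>As \<open>norm (\<zeta> m) \<le> R / 2\<close>, the tail beyond
      \<open>c n w\<close> is dominated by a geometric series of ratio 1/2, which produces the
      factor 2.\<close>
    have fb: "norm (f m w - c n w) \<le> 2 * M / R ^ Suc n * norm (\<zeta> m)" if "norm w < R" for m w
    proof -
      have "(\<lambda>k. c (k + n) w * \<zeta> m ^ (k + n)) sums (F (\<zeta> m, w) - (\<Sum>i<n. c i w * \<zeta> m ^ i))"
        using sums_split_initial_segment[OF cs[of "\<zeta> m" w], of n] \<zeta>(3)[of m] that R by auto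
      from sums_divide[OF this, of "\<zeta> m ^ n"]
      have "(\<lambda>k. c (k + n) w * \<zeta> m ^ k) sums f m w"
        using \<zeta>(1) by (simp add: f_def power_add)
      then have s: "(\<lambda>k. c (Suc k + n) w * \<zeta> m ^ Suc k) sums (f m w - c n w)"
        using sums_Suc_iff[of "\<lambda>k. c (k + n) w * \<zeta> m ^ k" "f m w - c n w"] by simp
      have g: "(\<lambda>k. (M / R ^ Suc n * norm (\<zeta> m)) * (1 / 2) ^ k) sums ((M / R ^ Suc n * norm (\<zeta> m)) * 2)"
        using sums_mult[OF geometric_sums[of "1 / 2 :: real"], of "M / R ^ Suc n * norm (\<zeta> m)"] by simp
      have "norm (f m w - c n w) \<le> (M / R ^ Suc n * norm (\<zeta> m)) * 2"
      proof (rule norm_sums_le[OF s g])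
        fix k
        have "norm (c (Suc k + n) w * \<zeta> m ^ Suc k) \<le> (M / R ^ (Suc k + n)) * (norm (\<zeta> m) * (R / 2) ^ k)"
          unfolding norm_mult norm_power power_Suc
          using cb[of w "Suc k + n"] that \<zeta>(2)[of m] R M0
          by (intro mult_mono power_mono) auto
        also have "\<dots> = (M / R ^ Suc n * norm (\<zeta> m)) * (1 / 2) ^ k"
          using R by (simp add: power_add power_divide field_simps)
        finally show "norm (c (Suc k + n) w * \<zeta> m ^ Suc k) \<le> (M / R ^ Suc n * norm (\<zeta> m)) * (1 / 2) ^ k" .
      qed
      then show ?thesis by (simp add: mult_ac)
    qed
    have "(\<lambda>m. R / (2 + real m)) \<longlonglongrightarrow> 0"
      by (rule tendsto_divide_0[OF tendsto_const filterlim_at_top_imp_at_infinity[OF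
            filterlim_tendsto_add_at_top[OF tendsto_const filterlim_real_sequentially]]])
    from tendsto_mult_left[OF this, of "2 * M / R ^ Suc n"]
    have lim: "(\<lambda>m. 2 * M / R ^ Suc n * norm (\<zeta> m)) \<longlonglongrightarrow> 0" by (simp add: nz)
    show ?case
    proof (rule holomorphic_uniform_sequence[where f = f])
      show "f m holomorphic_on ball 0 R" for m
        unfolding f_def using \<zeta> R
        by (intro holomorphic_intros holomorphic_on_subset[OF hw] less) auto
      fix x :: complex assume "x \<in> ball 0 R"
      then obtain d where d: "d > 0" "cball x d \<subseteq> ball 0 R" using open_contains_cball[of "ball 0 R"] by blast
      have "uniform_limit (cball x d) f (c n) sequentially"
      proof (rule uniform_limitI)
        fix e :: real assume "e > 0"
        from order_tendstoD(2)[OF lim this]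
        show "\<forall>\<^sub>F m in sequentially. \<forall>w\<in>cball x d. dist (f m w) (c n w) < e"
        proof eventually_elim
          case (elim m)
          show ?case
          proof
            fix w assume "w \<in> cball x d"
            then have "norm w < R" using d(2) by auto
            from fb[OF this, of m] elim show "dist (f m w) (c n w) < e" by (simp add: dist_norm)
          qed
        qed
      qed
      then show "\<exists>d>0. cball x d \<subseteq> ball 0 R \<and> uniform_limit (cball x d) f (c n) sequentially"
        using d by blast
    qed auto
  qed
  \<comment> \<open>\<open>c i\<close> is known to be holomorphic on the open disc of radius
    \<open>R\<close>, while the Cauchy inequality asks for continuity on a closed disc.\<close>
  define \<rho> where "\<rho> = R / 2"
  have \<rho>: "\<rho> > 0" "\<rho> < R" using R by (auto simp: \<rho>_def)
  define a where "a = (\<lambda>i j. (deriv ^^ j) (c i) 0 / fact j)"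
  have ab: "norm (a i j) \<le> M * (1 / \<rho>) ^ (i + j)" for i j
  proof -
    have "norm ((deriv ^^ j) (c i) 0) \<le> fact j * (M / R ^ i) / \<rho> ^ j"
    proof (rule Cauchy_inequality)
      show "c i holomorphic_on ball 0 \<rho>"
        by (rule holomorphic_on_subset[OF chol]) (use \<rho> in auto)
      show "continuous_on (cball 0 \<rho>) (c i)"
        by (rule continuous_on_subset[OF holomorphic_on_imp_continuous_on[OF chol]]) (use \<rho> in auto)
      show "norm (c i x) \<le> M / R ^ i" if "norm (0 - x) = \<rho>" for x
        by (rule cb) (use that \<rho> in auto)
    qed (rule \<rho>)
    then have "norm (a i j) \<le> (M / R ^ i) / \<rho> ^ j"
      by (simp add: a_def norm_divide field_simps)
    also have "\<dots> \<le> (M / \<rho> ^ i) / \<rho> ^ j"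
      using \<rho> R M0 by (intro divide_right_mono divide_left_mono power_mono mult_pos_pos) auto
    finally show ?thesis by (simp add: power_add power_one_over field_simps)
  qed
  define F' where "F' = (\<lambda>(z, w). \<Sum>\<^sub>\<infinity>(i, j). a i j * z ^ i * w ^ j)"
  have ps: "psr a F' \<rho>"
    using psr_of_bound[OF ab] \<rho> by (simp add: F'_def)
  have "F' (z, w) = F (z, w)" if zw: "norm z < \<rho>" "norm w < \<rho>" for z w
  proof -
    have hs: "((\<lambda>(i, j). a i j * z ^ i * w ^ j) has_sum F' (z, w)) (UNIV \<times> UNIV)"
      using ps zw unfolding psr_def by simp
    have inner: "((\<lambda>j. a i j * z ^ i * w ^ j) has_sum c i w * z ^ i) UNIV" for i
    proof -
      have "(\<lambda>j. a i j * z ^ i * w ^ j) summable_on UNIV"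
        using summable_on_SigmaD1[of "\<lambda>i j. a i j * z ^ i * w ^ j" UNIV "\<lambda>_. UNIV" i] hs
        by (auto simp: summable_on_def)
      then have 1: "((\<lambda>j. a i j * z ^ i * w ^ j) has_sum (\<Sum>\<^sub>\<infinity>j. a i j * z ^ i * w ^ j)) UNIV"
        by (rule has_sum_infsum)
      have "(\<lambda>j. a i j * w ^ j) sums c i w"
        using holomorphic_power_series[OF chol, of w i] zw \<rho> by (simp add: a_def)
      from sums_mult2[OF this, of "z ^ i"] have "(\<lambda>j. a i j * z ^ i * w ^ j) sums (c i w * z ^ i)"
        by (simp add: mult_ac)
      with has_sum_imp_sums[OF 1] have "(\<Sum>\<^sub>\<infinity>j. a i j * z ^ i * w ^ j) = c i w * z ^ i"
        using sums_unique2 by blast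
      with 1 show ?thesis by simp
    qed
    have "((\<lambda>i. c i w * z ^ i) has_sum F' (z, w)) UNIV"
      by (rule has_sum_SigmaD[OF hs]) (use inner in auto)
    then have "(\<lambda>i. c i w * z ^ i) sums F' (z, w)" by (rule has_sum_imp_sums)
    moreover have "(\<lambda>i. c i w * z ^ i) sums F (z, w)" by (rule cs) (use zw \<rho> R in auto)
    ultimately show ?thesis using sums_unique2 by blast
  qed
  with ps have "psr a F \<rho>" unfolding psr_def by simp
  with \<rho> show ?thesis by blast
qed

section \<open>Arithmetic of double power series\<close>

lemma has_sum_product2:
  fixes f g :: "'i \<Rightarrow> complex"
  assumes f: "(f has_sum S) UNIV" and g: "(g has_sum T) UNIV"
  shows "((\<lambda>(x, y). f x * g y) has_sum S * T) UNIV"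
proof -
  have f': "(\<lambda>x. norm (f x)) summable_on UNIV" and g': "(\<lambda>x. norm (g x)) summable_on UNIV"
    using f g summable_on_iff_abs_summable_on_complex unfolding summable_on_def by blast+
  have "(\<lambda>x. case x of (x, y) \<Rightarrow> norm (f x) * norm (g y)) summable_on (UNIV \<times> UNIV)"
  proof (rule summable_on_SigmaI)
    show "((\<lambda>y. case (x, y) of (x, y) \<Rightarrow> norm (f x) * norm (g y)) has_sum norm (f x) * (\<Sum>\<^sub>\<infinity>y. norm (g y))) UNIV" for x
      using has_sum_cmult_right[OF has_sum_infsum[OF g'], of "norm (f x)"] by simp
    show "(\<lambda>x. norm (f x) * (\<Sum>\<^sub>\<infinity>y. norm (g y))) summable_on UNIV"
      by (rule summable_on_cmult_left[OF f'])
  qed auto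
  then have "(\<lambda>x. norm (case x of (x, y) \<Rightarrow> f x * g y)) summable_on (UNIV \<times> UNIV)"
    by (simp add: case_prod_unfold norm_mult)
  then have "(\<lambda>(x, y). f x * g y) summable_on (UNIV \<times> UNIV)"
    by (rule abs_summable_summable)
  then have "((\<lambda>(x, y). f x * g y) has_sum S * T) (UNIV \<times> UNIV)"
  proof (rule has_sum_SigmaI[rotated 2])
    show "((\<lambda>y. case (x, y) of (x, y) \<Rightarrow> f x * g y) has_sum f x * T) UNIV" for x
      using has_sum_cmult_right[OF g, of "f x"] by simp
    show "((\<lambda>x. f x * T) has_sum S * T) UNIV" by (rule has_sum_cmult_left[OF f])
  qed
  then show ?thesis by simp
qed

text \<open>The product family, indexed by pairs of index pairs, is regrouped by the sum of the
  indices; the bijection keeps the index of the first factor as second component, so that each group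
  is finite.\<close>

lemma psr_mult:
  assumes "psr a F r" "psr b G r"
  shows "psr (\<lambda>k l. \<Sum>i\<le>k. \<Sum>j\<le>l. a i j * b (k - i) (l - j)) (\<lambda>q. F q * G q) r"
  unfolding psr_def
proof (intro allI impI)
  fix z w :: complex assume zw: "norm z < r" "norm w < r"
  define \<alpha> where "\<alpha> = (\<lambda>(i, j). a i j * z ^ i * w ^ j)"
  define \<beta> where "\<beta> = (\<lambda>(i, j). b i j * z ^ i * w ^ j)"
  have "(\<alpha> has_sum F (z, w)) UNIV" "(\<beta> has_sum G (z, w)) UNIV"
    using assms zw unfolding psr_def \<alpha>_def \<beta>_def by blast+
  from has_sum_product2[OF this]
  have p: "((\<lambda>(x, y). \<alpha> x * \<beta> y) has_sum F (z, w) * G (z, w)) UNIV" .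
  define B where "B = (\<lambda>(k::nat, l::nat). {..k} \<times> {..l})"
  define h where "h = (\<lambda>x::(nat \<times> nat) \<times> (nat \<times> nat).
     \<alpha> (fst (snd x), snd (snd x)) * \<beta> (fst (fst x) - fst (snd x), snd (fst x) - snd (snd x)))"
  have "(h has_sum F (z, w) * G (z, w)) (Sigma UNIV B)"
  proof -
    have "((\<lambda>(x, y). \<alpha> x * \<beta> y) has_sum F (z, w) * G (z, w)) UNIV \<longleftrightarrow>
        (h has_sum F (z, w) * G (z, w)) (Sigma UNIV B)"
      by (rule has_sum_reindex_bij_witness[where
          j = "\<lambda>((i, j), (m, n)). ((i + m, j + n), (i, j))" and
          i = "\<lambda>((k, l), (i, j)). ((i, j), (k - i, l - j))"])
        (auto simp: B_def h_def)
    with p show ?thesis by simp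
  qed
  then have "((\<lambda>x. \<Sum>y\<in>B x. h (x, y)) has_sum F (z, w) * G (z, w)) UNIV"
    by (rule has_sum_SigmaD) (auto simp: B_def intro!: has_sum_finite)
  moreover have "(\<Sum>y\<in>B x. h (x, y)) =
      (case x of (k, l) \<Rightarrow> (\<Sum>i\<le>k. \<Sum>j\<le>l. a i j * b (k - i) (l - j)) * z ^ k * w ^ l)" for x
  proof -
    obtain k l where x: "x = (k, l)" by fastforce
    have "h (x, (i, j)) = a i j * b (k - i) (l - j) * z ^ k * w ^ l" if "i \<le> k" "j \<le> l" for i j
    proof -
      have "z ^ k = z ^ i * z ^ (k - i)" "w ^ l = w ^ j * w ^ (l - j)"
        using that by (simp_all flip: power_add)
      then show ?thesis by (simp add: h_def x \<alpha>_def \<beta>_def mult_ac)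
    qed
    then have "(\<Sum>y\<in>B x. h (x, y)) = (\<Sum>i\<le>k. \<Sum>j\<le>l. a i j * b (k - i) (l - j) * z ^ k * w ^ l)"
      unfolding B_def x by (simp add: sum.cartesian_product case_prod_unfold) (auto intro!: sum.cong)
    then show ?thesis by (simp add: x sum_distrib_right)
  qed
  ultimately show "((\<lambda>(k, l). (\<Sum>i\<le>k. \<Sum>j\<le>l. a i j * b (k - i) (l - j)) * z ^ k * w ^ l) has_sum F (z, w) * G (z, w)) UNIV"
    by simp
qed

lemma psr_add:
  assumes "psr a F r" "psr b G r"
  shows "psr (\<lambda>i j. a i j + b i j) (\<lambda>q. F q + G q) r"
  unfolding psr_def
proof (intro allI impI)
  fix z w :: complex assume zw: "norm z < r" "norm w < r"
  have "((\<lambda>(i, j). a i j * z ^ i * w ^ j) has_sum F (z, w)) UNIV" "((\<lambda>(i, j). b i j * z ^ i * w ^ j) has_sum G (z, w)) UNIV"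
    using assms zw unfolding psr_def by blast+
  from has_sum_add[OF this]
  show "((\<lambda>(i, j). (a i j + b i j) * z ^ i * w ^ j) has_sum F (z, w) + G (z, w)) UNIV"
    by (simp add: case_prod_unfold algebra_simps)
qed

lemma psr_same_coeffs:
  assumes "psr a F r" "psr a G r" "norm z < r" "norm w < r"
  shows "F (z, w) = G (z, w)"
  by (rule has_sum_unique[OF assms(1)[unfolded psr_def, rule_format, OF assms(3,4)]
        assms(2)[unfolded psr_def, rule_format, OF assms(3,4)]])

lemma hol2_derivs_0:
  assumes "hol2 F 0"
  shows "hol2 (dz F) 0" "hol2 (dw F) 0"
proof -
  obtain a r where "r > 0" "psr a F r" using hol2_psr[OF assms] by blast
  from psr_derivs[OF this(2,1)] show "hol2 (dz F) 0" "hol2 (dw F) 0" using psr_derivs by blast+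
qed

section \<open>The Cauchy--Kovalevskaya theorem\<close>

text \<open>Taylor coefficients of the solution of \<open>dz F = A * dw F + B\<close> with
  \<open>F = 0\<close> on \<open>fst q = 0\<close>. Comparing the coefficients at
  \<open>(i, j)\<close> expresses row \<open>Suc i\<close> through the rows up to \<open>i\<close>;
  the initial condition is the zero row.\<close>

fun ck_coeff :: "(nat \<Rightarrow> nat \<Rightarrow> complex) \<Rightarrow> (nat \<Rightarrow> nat \<Rightarrow> complex) \<Rightarrow> nat \<Rightarrow> nat \<Rightarrow> complex" where
  "ck_coeff a b 0 j = 0"
| "ck_coeff a b (Suc i) j =
     ((\<Sum>m\<le>i. \<Sum>n\<le>j. a m n * (of_nat (Suc (j - n)) * ck_coeff a b (i - m) (Suc (j - n)))) + b i j) / of_nat (Suc i)"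

lemma choose_mono2:
  assumes "i' \<le> i" "j' \<le> j"
  shows "(i' + j') choose i' \<le> (i + j) choose i"
proof -
  have "(i' + j') choose i' \<le> (i + j') choose i"
    using assms(1)
  proof (induction i rule: dec_induct)
    case (step n)
    have "(n + j') choose n \<le> (Suc n + j') choose Suc n" by simp
    with step show ?case by simp
  qed simp
  also have "\<dots> \<le> (i + j) choose i"
    by (rule binomial_right_mono) (use assms in auto)
  finally show ?thesis .
qed

text \<open>Both sides equal (i + j + 1)! / (i! j!). This is the exchange of the factor
  \<open>Suc j\<close> for the factor \<open>Suc i\<close> on which the majorant rests.\<close>

lemma choose_times_Suc: "Suc j * ((i + Suc j) choose i) = Suc i * ((Suc i + j) choose Suc i)"
proof -
  have "Suc i * ((Suc i + j) choose Suc i) = Suc (i + j) * ((i + j) choose i)"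
    using Suc_times_binomial[of i "i + j"] by simp
  also have "\<dots> = Suc (i + j) * ((j + i) choose j)"
    using binomial_symmetric[of i "i + j"] by (simp add: add.commute)
  also have "\<dots> = Suc j * (Suc (j + i) choose Suc j)"
    using Suc_times_binomial[of j "j + i"] by (simp add: add.commute)
  also have "\<dots> = Suc j * ((i + Suc j) choose i)"
    using binomial_symmetric[of "Suc j" "Suc (j + i)"] by (simp add: add.commute)
  finally show ?thesis by simp
qed

lemma sum_geometric_half: "(\<Sum>m\<le>(i::nat). (1 / 2 :: real) ^ m) \<le> 2"
proof -
  have "(\<Sum>m\<le>i. (1 / 2 :: real) ^ m) = 2 - (1 / 2) ^ i" by (induction i) auto
  then show ?thesis by simp
qed

text \<open>The derivative in \<open>y\<close> costs a factor \<open>j + 1\<close>, and the integration in \<open>x\<close> gains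
  \<open>1 / (i + 1)\<close>; the binomial coefficient absorbs both exactly.\<close>

lemma ck_coeff_bound:
  fixes a b :: "nat \<Rightarrow> nat \<Rightarrow> complex"
  assumes a: "\<And>i j. norm (a i j) \<le> C * K0 ^ (i + j)" and b: "\<And>i j. norm (b i j) \<le> C * K0 ^ (i + j)"
    and C: "C \<ge> 0" and K0: "K0 \<ge> 1" and R: "R = 2 * K0" and K: "K \<ge> 2 * K0" "K \<ge> 8 * C * K0 + C"
  shows "norm (ck_coeff a b i j) \<le> real ((i + j) choose i) * (K ^ i * R ^ j)"
proof (induction i arbitrary: j rule: less_induct)
  case (less i0)
  show ?case
  proof (cases i0)
    case 0
    then show ?thesis using K K0 R by simp
  next
    case (Suc i)
    define N where "N = real ((Suc i + j) choose Suc i)"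
    have N: "N \<ge> 1" unfolding N_def using zero_less_binomial[of "Suc i" "Suc i + j"] by linarith
    have pos: "K > 0" "R > 0" "K \<ge> 1" "R \<ge> 1" using K K0 R by auto
    have tm: "norm (a m n * (of_nat (Suc (j - n)) * ck_coeff a b (i - m) (Suc (j - n))))
        \<le> real (Suc i) * N * C * (K ^ i * R ^ Suc j) * ((1 / 2) ^ m * (1 / 2) ^ n)"
      if mn: "m \<le> i" "n \<le> j" for m n
    proof -
      have "norm (ck_coeff a b (i - m) (Suc (j - n))) \<le>
          real ((i - m + Suc (j - n)) choose (i - m)) * (K ^ (i - m) * R ^ Suc (j - n))"
        by (rule less) (use Suc in simp)
      then have "real (Suc (j - n)) * norm (ck_coeff a b (i - m) (Suc (j - n))) \<le>
          real (Suc (j - n)) * (real ((i - m + Suc (j - n)) choose (i - m)) * (K ^ (i - m) * R ^ Suc (j - n)))"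
        by (rule mult_left_mono) simp
      also have "\<dots> = real (Suc (j - n) * ((i - m + Suc (j - n)) choose (i - m))) * (K ^ (i - m) * R ^ Suc (j - n))"
        by (simp only: of_nat_mult mult.assoc)
      also have "\<dots> = real (Suc (i - m) * ((Suc (i - m) + (j - n)) choose Suc (i - m))) * (K ^ (i - m) * R ^ Suc (j - n))"
        by (simp only: choose_times_Suc)
      also have "\<dots> \<le> (real (Suc i) * N) * (K ^ (i - m) * R ^ Suc (j - n))"
      proof (rule mult_right_mono)
        have "Suc (i - m) * ((Suc (i - m) + (j - n)) choose Suc (i - m)) \<le> Suc i * ((Suc i + j) choose Suc i)"
          by (intro mult_le_mono choose_mono2) auto
        then show "real (Suc (i - m) * ((Suc (i - m) + (j - n)) choose Suc (i - m))) \<le> real (Suc i) * N"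
          unfolding N_def of_nat_mult[symmetric] of_nat_le_iff .
      qed (use pos in simp)
      finally have 1: "real (Suc (j - n)) * norm (ck_coeff a b (i - m) (Suc (j - n))) \<le>
          (real (Suc i) * N) * (K ^ (i - m) * R ^ Suc (j - n))" .
      \<comment> \<open>Both \<open>K\<close> and \<open>R\<close> are at least
        \<open>2 * K0\<close>, so every index spent on the coefficient \<open>a m n\<close> gains a
        factor 1/2, and the convolution sums become geometric.\<close>
      have "K0 ^ m * K ^ (i - m) \<le> (K / 2) ^ m * K ^ (i - m)"
        using K K0 by (intro mult_right_mono power_mono) auto
      also have "\<dots> = K ^ i * (1 / 2) ^ m"
        using mn(1) by (simp add: power_divide flip: power_add)
      finally have 2: "K0 ^ m * K ^ (i - m) \<le> K ^ i * (1 / 2) ^ m" .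
      have "K0 ^ n * R ^ Suc (j - n) = (R / 2) ^ n * R ^ Suc (j - n)"
        by (simp add: R)
      also have "\<dots> = R ^ Suc j * (1 / 2) ^ n"
        using mn(2) by (simp add: power_divide Suc_diff_le flip: power_add power_Suc)
      finally have 3: "K0 ^ n * R ^ Suc (j - n) = R ^ Suc j * (1 / 2) ^ n" .
      have "norm (a m n * (of_nat (Suc (j - n)) * ck_coeff a b (i - m) (Suc (j - n)))) =
          norm (a m n) * (real (Suc (j - n)) * norm (ck_coeff a b (i - m) (Suc (j - n))))"
        unfolding norm_mult norm_of_nat ..
      also have "\<dots> \<le> (C * K0 ^ (m + n)) * ((real (Suc i) * N) * (K ^ (i - m) * R ^ Suc (j - n)))"
        by (rule mult_mono[OF a 1]) (use C K0 in auto)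
      also have "\<dots> = real (Suc i) * N * C * ((K0 ^ m * K ^ (i - m)) * (K0 ^ n * R ^ Suc (j - n)))"
        by (simp only: power_add mult_ac)
      also have "\<dots> \<le> real (Suc i) * N * C * ((K ^ i * (1 / 2) ^ m) * (R ^ Suc j * (1 / 2) ^ n))"
        unfolding 3 using 2 N C pos by (intro mult_left_mono mult_right_mono) auto
      also have "\<dots> = real (Suc i) * N * C * (K ^ i * R ^ Suc j) * ((1 / 2) ^ m * (1 / 2) ^ n)"
        by (simp only: mult_ac)
      finally show ?thesis .
    qed
    have "norm (\<Sum>m\<le>i. \<Sum>n\<le>j. a m n * (of_nat (Suc (j - n)) * ck_coeff a b (i - m) (Suc (j - n))))
        \<le> (\<Sum>m\<le>i. \<Sum>n\<le>j. real (Suc i) * N * C * (K ^ i * R ^ Suc j) * ((1 / 2) ^ m * (1 / 2) ^ n))"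
      by (intro sum_norm_le order_trans[OF norm_sum] sum_mono tm) auto
    also have "\<dots> = real (Suc i) * N * C * (K ^ i * R ^ Suc j) * ((\<Sum>m\<le>i. (1 / 2) ^ m) * (\<Sum>n\<le>j. (1 / 2) ^ n))"
      unfolding sum_product by (simp only: sum_distrib_left)
    also have "\<dots> \<le> real (Suc i) * N * C * (K ^ i * R ^ Suc j) * (2 * 2)"
      using N C pos by (intro mult_left_mono mult_mono sum_geometric_half sum_nonneg) auto
    \<comment> \<open>The two geometric sums contribute 4, and the surplus factor in
      \<open>R ^ Suc j\<close> contributes \<open>R = 2 * K0\<close>; this is the origin of
      \<open>8 * C * K0\<close>.\<close>
    finally have S: "norm (\<Sum>m\<le>i. \<Sum>n\<le>j. a m n * (of_nat (Suc (j - n)) * ck_coeff a b (i - m) (Suc (j - n))))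
        \<le> real (Suc i) * N * (K ^ i * R ^ j) * (8 * C * K0)"
      by (simp add: R mult_ac)
    have "norm (b i j) \<le> 1 * (C * (K0 ^ i * K0 ^ j))" using b[of i j] by (simp add: power_add)
    also have "\<dots> \<le> (real (Suc i) * N) * (C * (K ^ i * R ^ j))"
    proof (intro mult_mono power_mono)
      have "1 * 1 \<le> real (Suc i) * N" by (rule mult_mono) (use N in auto)
      then show "1 \<le> real (Suc i) * N" by simp
    qed (use N C K0 K R pos in auto)
    finally have Bb: "norm (b i j) \<le> real (Suc i) * N * (K ^ i * R ^ j) * C"
      by (simp only: mult_ac)
    have "norm (ck_coeff a b (Suc i) j) * real (Suc i) =
        norm ((\<Sum>m\<le>i. \<Sum>n\<le>j. a m n * (of_nat (Suc (j - n)) * ck_coeff a b (i - m) (Suc (j - n)))) + b i j)"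
      unfolding ck_coeff.simps norm_divide norm_of_nat by simp
    also have "\<dots> \<le> real (Suc i) * N * (K ^ i * R ^ j) * (8 * C * K0) + real (Suc i) * N * (K ^ i * R ^ j) * C"
      using S Bb by (rule norm_triangle_mono)
    also have "\<dots> = real (Suc i) * N * (K ^ i * R ^ j) * (8 * C * K0 + C)"
      by (simp only: distrib_left)
    also have "\<dots> \<le> real (Suc i) * N * (K ^ i * R ^ j) * K"
      using K N pos by (intro mult_left_mono) auto
    also have "\<dots> = N * (K ^ Suc i * R ^ j) * real (Suc i)" by (simp only: power_Suc mult_ac)
    finally show ?thesis unfolding Suc N_def by simp
  qed
qed

text \<open>The formal solution \<open>ck_coeff\<close> converges by its majorant, and its recursion
  says that both sides of the equation have the same coefficients on a common bidisc.\<close>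

lemma ck_exists:
  assumes "hol2 A 0" "hol2 B 0"
  shows "\<exists>F. hol2 F 0 \<and> (\<forall>\<^sub>F q in nhds 0. dz F q = A q * dw F q + B q) \<and>
           (\<forall>\<^sub>F q in nhds 0. fst q = 0 \<longrightarrow> F q = 0)"
proof -
  obtain a ra where ra: "ra > 0" "psr a A ra" using hol2_psr[OF assms(1)] by blast
  obtain b rb where rb: "rb > 0" "psr b B rb" using hol2_psr[OF assms(2)] by blast
  obtain Ca Ka where a: "Ca \<ge> 0" "Ka \<ge> 1" "1 / Ka \<le> ra" "\<And>i j. norm (a i j) \<le> Ca * Ka ^ (i + j)"
    by (rule psr_bound[OF ra(2,1)]) (rule that)
  obtain Cb Kb where b: "Cb \<ge> 0" "Kb \<ge> 1" "1 / Kb \<le> rb" "\<And>i j. norm (b i j) \<le> Cb * Kb ^ (i + j)"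
    by (rule psr_bound[OF rb(2,1)]) (rule that)
  define C where "C = max Ca Cb"
  define K0 where "K0 = max Ka Kb"
  have C: "C \<ge> 0" and K0: "K0 \<ge> 1" using a b by (auto simp: C_def K0_def)
  have a': "norm (a i j) \<le> C * K0 ^ (i + j)" for i j
    by (rule order_trans[OF a(4)], intro mult_mono power_mono) (use a b in \<open>auto simp: C_def K0_def\<close>)
  have b': "norm (b i j) \<le> C * K0 ^ (i + j)" for i j
    by (rule order_trans[OF b(4)], intro mult_mono power_mono) (use a b in \<open>auto simp: C_def K0_def\<close>)
  define K where "K = 2 * K0 + 8 * C * K0 + C"
  have K: "K \<ge> 2 * K0" "K \<ge> 8 * C * K0 + C" "K \<ge> 1"
  proof -
    have "0 \<le> 8 * C * K0" using C K0 by simp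
    then show "K \<ge> 2 * K0" "K \<ge> 8 * C * K0 + C" "K \<ge> 1" using C K0 unfolding K_def by linarith+
  qed
  define f where "f = ck_coeff a b"
  have fb: "norm (f i j) \<le> 1 * (2 * K) ^ (i + j)" for i j
  proof -
    have "norm (f i j) \<le> real ((i + j) choose i) * (K ^ i * (2 * K0) ^ j)"
      unfolding f_def by (rule ck_coeff_bound[OF a' b' C K0 refl K(1,2)])
    \<comment> \<open>The binomial coefficient is at most \<open>2 ^ (i + j)\<close>, which merely
      halves the radius to \<open>1 / (2 * K)\<close>.\<close>
    also have "\<dots> \<le> 2 ^ (i + j) * (K ^ i * K ^ j)"
    proof (intro mult_mono power_mono)
      have "(i + j) choose i \<le> 2 ^ (i + j)" by (rule binomial_le_pow2)
      then show "real ((i + j) choose i) \<le> 2 ^ (i + j)" by (metis of_nat_le_iff of_nat_numeral of_nat_power)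
    qed (use K K0 in auto)
    also have "\<dots> = 1 * (2 * K) ^ (i + j)" by (simp add: power_mult_distrib power_add)
    finally show ?thesis .
  qed
  define F where "F = (\<lambda>(z, w). \<Sum>\<^sub>\<infinity>(i, j). f i j * z ^ i * w ^ j)"
  define r where "r = 1 / (2 * K)"
  have r: "r > 0" using K by (simp add: r_def)
  have psF: "psr f F r"
    unfolding F_def r_def by (rule psr_of_bound[OF fb]) (use K in auto)
  obtain \<rho> where \<rho>: "\<rho> > 0" "psr (\<lambda>i j. of_nat (Suc i) * f (Suc i) j) (dz F) \<rho>"
    "psr (\<lambda>i j. of_nat (Suc j) * f i (Suc j)) (dw F) \<rho>" and hF: "hol2 F 0"
    using psr_derivs[OF psF r] by blast
  define s where "s = min \<rho> (min ra rb)"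
  have s: "s > 0" "s \<le> \<rho>" "s \<le> ra" "s \<le> rb" using \<rho> ra rb by (auto simp: s_def)
  have "psr (\<lambda>k l. (\<Sum>i\<le>k. \<Sum>j\<le>l. a i j * (of_nat (Suc (l - j)) * f (k - i) (Suc (l - j)))) + b k l)
      (\<lambda>q. A q * dw F q + B q) s"
    by (rule psr_add[OF psr_mult[OF psr_mono[OF ra(2) s(3)] psr_mono[OF \<rho>(3) s(2)]] psr_mono[OF rb(2) s(4)]])
  moreover have "(\<lambda>k l. (\<Sum>i\<le>k. \<Sum>j\<le>l. a i j * (of_nat (Suc (l - j)) * f (k - i) (Suc (l - j)))) + b k l)
      = (\<lambda>i j. of_nat (Suc i) * f (Suc i) j)"
    unfolding f_def by (intro ext) (simp del: of_nat_Suc)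
  ultimately have "psr (\<lambda>i j. of_nat (Suc i) * f (Suc i) j) (\<lambda>q. A q * dw F q + B q) s" by simp
  from psr_same_coeffs[OF psr_mono[OF \<rho>(2) s(2)] this]
  have "\<forall>\<^sub>F q in nhds 0. dz F q = A q * dw F q + B q"
    unfolding eventually_nhds_bidisc using s by blast
  moreover have "\<forall>\<^sub>F q in nhds 0. fst q = 0 \<longrightarrow> F q = 0"
    unfolding eventually_nhds_bidisc
  proof (intro exI[of _ r] conjI r allI impI)
    fix z w :: complex assume zw: "norm z < r" "norm w < r" "fst (z, w) = 0"
    have "((\<lambda>(i, j). f i j * z ^ i * w ^ j) has_sum F (z, w)) UNIV"
      by (rule psF[unfolded psr_def, rule_format, OF zw(1,2)])
    moreover have "(\<lambda>(i, j). f i j * z ^ i * w ^ j) = (\<lambda>_. 0)"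
    proof
      fix x show "(case x of (i, j) \<Rightarrow> f i j * z ^ i * w ^ j) = 0"
        using zw(3) by (cases x; cases "fst x") (auto simp: f_def)
    qed
    ultimately have "((\<lambda>_::nat \<times> nat. 0) has_sum F (z, w)) UNIV" by simp
    then show "F (z, w) = 0" by (rule has_sum_unique) simp
  qed
  ultimately show ?thesis using hF by blast
qed

text \<open>The initial condition kills the row of index 0, and the homogeneous recursion then kills
  all later rows.\<close>

lemma ck_unique:
  assumes "hol2 A 0" "hol2 F 0" "\<forall>\<^sub>F q in nhds 0. dz F q = A q * dw F q"
    "\<forall>\<^sub>F q in nhds 0. fst q = 0 \<longrightarrow> F q = 0"
  shows "\<forall>\<^sub>F q in nhds 0. F q = 0"
proof -
  obtain a ra where ra: "ra > 0" "psr a A ra" using hol2_psr[OF assms(1)] by blast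
  obtain f r where r: "r > 0" "psr f F r" using hol2_psr[OF assms(2)] by blast
  obtain \<rho> where \<rho>: "\<rho> > 0" "psr (\<lambda>i j. of_nat (Suc i) * f (Suc i) j) (dz F) \<rho>"
    "psr (\<lambda>i j. of_nat (Suc j) * f i (Suc j)) (dw F) \<rho>"
    using psr_derivs[OF r(2,1)] by blast
  obtain r1 where r1: "r1 > 0" "\<And>z w. norm z < r1 \<Longrightarrow> norm w < r1 \<Longrightarrow> dz F (z, w) = A (z, w) * dw F (z, w)"
    using assms(3) unfolding eventually_nhds_bidisc by blast
  obtain r2 where r2: "r2 > 0" "\<And>w. norm w < r2 \<Longrightarrow> F (0, w) = 0"
    using assms(4) unfolding eventually_nhds_bidisc by (metis fst_conv norm_zero)
  define s where "s = min (min \<rho> ra) (min (min r r1) r2)"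
  have s: "s > 0" "s \<le> \<rho>" "s \<le> ra" "s \<le> r" "s \<le> r1" "s \<le> r2"
    using \<rho>(1) ra(1) r(1) r1(1) r2(1) by (auto simp: s_def)
  have "psr (\<lambda>k l. \<Sum>i\<le>k. \<Sum>j\<le>l. a i j * (of_nat (Suc (l - j)) * f (k - i) (Suc (l - j)))) (\<lambda>q. A q * dw F q) s"
    by (rule psr_mult[OF psr_mono[OF ra(2) s(3)] psr_mono[OF \<rho>(3) s(2)]])
  then have p: "psr (\<lambda>k l. \<Sum>i\<le>k. \<Sum>j\<le>l. a i j * (of_nat (Suc (l - j)) * f (k - i) (Suc (l - j)))) (dz F) s"
    using r1(2) s(5) unfolding psr_def by simp
  have rec: "of_nat (Suc k) * f (Suc k) l = (\<Sum>i\<le>k. \<Sum>j\<le>l. a i j * (of_nat (Suc (l - j)) * f (k - i) (Suc (l - j))))" for k l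
    by (rule psr_unique[OF psr_mono[OF \<rho>(2) s(2)] p s(1)])
  have f0: "f 0 j = 0" for j
  proof -
    \<comment> \<open>The restriction to \<open>z = 0\<close> is read as a series in both variables
      with only row 0 present, so that \<open>psr_unique\<close> applies to it.\<close>
    have "psr (\<lambda>i j. if i = 0 then f 0 j else 0) (\<lambda>_. 0) s"
      unfolding psr_def
    proof (intro allI impI)
      fix z w :: complex assume zw: "norm z < s" "norm w < s"
      have "((\<lambda>(i, j). f i j * 0 ^ i * w ^ j) has_sum F (0, w)) UNIV"
        by (rule r(2)[unfolded psr_def, rule_format]) (use zw s in auto)
      moreover have "F (0, w) = 0" by (rule r2(2)) (use zw s in auto)
      moreover have "(\<lambda>(i, j). f i j * 0 ^ i * w ^ j) = (\<lambda>(i, j). (if i = 0 then f 0 j else 0) * z ^ i * w ^ j)"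
        by (intro ext) (auto simp: power_0_left split: prod.split)
      ultimately show "((\<lambda>(i, j). (if i = 0 then f 0 j else 0) * z ^ i * w ^ j) has_sum 0) UNIV" by simp
    qed
    moreover have "psr (\<lambda>_ _. 0) (\<lambda>_. 0) s"
      unfolding psr_def by (simp add: case_prod_unfold)
    ultimately show ?thesis using psr_unique[of "\<lambda>i j. if i = 0 then f 0 j else 0" "\<lambda>_. 0" s "\<lambda>_ _. 0" 0 j] s(1) by simp
  qed
  have f: "f i j = 0" for i j
  proof (induction i arbitrary: j rule: less_induct)
    case (less i)
    show ?case
    proof (cases i)
      case (Suc k)
      have "f (k - m) l = 0" for m l by (rule less) (use Suc in simp)
      then have "of_nat (Suc k) * f (Suc k) j = 0" unfolding rec by simp
      then show ?thesis using Suc by (simp del: of_nat_Suc)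
    qed (simp add: f0)
  qed
  show ?thesis
    unfolding eventually_nhds_bidisc
  proof (intro exI[of _ r] conjI r(1) allI impI)
    fix z w :: complex assume zw: "norm z < r" "norm w < r"
    have "((\<lambda>(i, j). f i j * z ^ i * w ^ j) has_sum F (z, w)) UNIV"
      by (rule r(2)[unfolded psr_def, rule_format, OF zw])
    then have "((\<lambda>_::nat \<times> nat. 0) has_sum F (z, w)) UNIV" by (simp add: f case_prod_unfold)
    then show "F (z, w) = 0" by (rule has_sum_unique) simp
  qed
qed

section \<open>Real analytic functions as restrictions of holomorphic ones\<close>

definition cp :: "real^2 \<Rightarrow> complex \<times> complex" where
  "cp x = (of_real (x $ 1), of_real (x $ 2))"

lemma cp_add: "cp (x + y) = cp x + cp y" by (simp add: cp_def)

lemma cp_0 [simp]: "cp 0 = 0" by (simp add: cp_def zero_prod_def)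

lemma bounded_linear_cp: "bounded_linear cp"
proof (rule linear_conv_bounded_linear[THEN iffD1], rule linearI)
  show "cp (r *\<^sub>R x) = r *\<^sub>R cp x" for r x by (simp add: cp_def of_real_def)
qed (rule cp_add)

lemma isCont_cp: "isCont cp x"
  by (rule bounded_linear.isCont[OF bounded_linear_cp, OF continuous_ident])

lemma eventually_cp: "(\<forall>\<^sub>F q in nhds (cp p). P q) \<Longrightarrow> \<forall>\<^sub>F x in nhds p. P (cp x)"
  by (rule eventually_nhds_isCont[OF isCont_cp])

section \<open>Identity theorem and zero divisors for holomorphic germs\<close>

text \<open>One variable at a time: for each \<open>w\<close> in \<open>W\<close> the slice vanishes
  on a set with a limit point, hence identically; the same argument then runs in the other variable.
  Sets with limit points, rather than open sets, admit real intervals.\<close>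

lemma bidisc_identity:
  assumes cd: "\<And>z w. norm z < r \<Longrightarrow> norm w < r \<Longrightarrow> cdiff F (z, w)"
    and z0: "norm z0 < r" "z0 islimpt U" "U \<subseteq> ball 0 r"
    and w0: "norm w0 < r" "w0 islimpt W" "W \<subseteq> ball 0 r"
    and zero: "\<And>z w. z \<in> U \<Longrightarrow> w \<in> W \<Longrightarrow> F (z, w) = 0"
    and zw: "norm z < r" "norm w < r"
  shows "F (z, w) = 0"
proof -
  have 1: "F (z, w) = 0" if "w \<in> W" for w
  proof (rule analytic_continuation[where f = "\<lambda>z. F (z, w)" and S = "ball 0 r" and U = U and \<xi> = z0])
    show "(\<lambda>z. F (z, w)) holomorphic_on ball 0 r"
      by (rule cdiff_holomorphic) (use cd w0(3) that in auto)
  qed (use z0 zw zero that in auto)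
  show ?thesis
  proof (rule analytic_continuation[where f = "\<lambda>w. F (z, w)" and S = "ball 0 r" and U = W and \<xi> = w0])
    show "(\<lambda>w. F (z, w)) holomorphic_on ball 0 r"
      by (rule cdiff_holomorphic_snd) (use cd zw in auto)
  qed (use w0 zw 1 in auto)
qed

lemma bidisc_identity_nhds:
  assumes cd: "\<And>z w. norm z < r \<Longrightarrow> norm w < r \<Longrightarrow> cdiff F (z, w)"
    and 0: "norm z0 < r" "norm w0 < r" "\<forall>\<^sub>F q in nhds (z0, w0). F q = 0"
    and zw: "norm z < r" "norm w < r"
  shows "F (z, w) = 0"
proof -
  obtain S where S: "open S" "(z0, w0) \<in> S" "\<And>q. q \<in> S \<Longrightarrow> F q = 0"
    using 0(3) unfolding eventually_nhds by blast
  obtain U W where UW: "open U" "open W" "(z0, w0) \<in> U \<times> W" "U \<times> W \<subseteq> S"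
    using open_prod_elim[OF S(1,2)] by blast
  have l: "z0 islimpt (U \<inter> ball 0 r)" "w0 islimpt (W \<inter> ball 0 r)"
    using UW 0(1,2) by (intro interior_limit_point, simp add: interior_open open_Int)+
  show ?thesis
    by (rule bidisc_identity[OF cd 0(1) l(1) _ 0(2) l(2) _ _ zw]) (use UW S in auto)
qed

lemma hol2_bidisc:
  assumes "hol2 F 0"
  obtains r where "r > 0" "\<And>z w. norm z < r \<Longrightarrow> norm w < r \<Longrightarrow> cdiff F (z, w)"
  using assms unfolding hol2_iff_cdiff eventually_nhds_bidisc by blast

text \<open>The device by which identities between real analytic functions pass to their holomorphic
  extensions.\<close>

lemma hol2_zero_on_reals:
  assumes "hol2 F 0" "r0 > 0"
    "\<And>x y :: real. \<bar>x\<bar> < r0 \<Longrightarrow> \<bar>y\<bar> < r0 \<Longrightarrow> F (of_real x, of_real y) = 0"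
  shows "\<forall>\<^sub>F q in nhds 0. F q = 0"
proof -
  obtain r1 where r1: "r1 > 0" "\<And>z w. norm z < r1 \<Longrightarrow> norm w < r1 \<Longrightarrow> cdiff F (z, w)"
    by (rule hol2_bidisc[OF assms(1)]) (rule that)
  define r where "r = min r0 r1"
  have r: "r > 0" "r \<le> r0" "r \<le> r1" using assms(2) r1 by (auto simp: r_def)
  define U where "U = complex_of_real ` {-r<..<r}"
  have lim: "(0::complex) islimpt U"
    unfolding islimpt_approachable
  proof (intro allI impI)
    fix e :: real assume "e > 0"
    then show "\<exists>x'\<in>U. x' \<noteq> 0 \<and> dist x' 0 < e"
      using r by (intro bexI[of _ "of_real (min e r / 2)"])
        (auto simp: U_def norm_of_real simp del: of_real_divide)
  qed
  have sub: "U \<subseteq> ball 0 r" by (auto simp: U_def)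
  have "F (z, w) = 0" if "norm z < r" "norm w < r" for z w
  proof (rule bidisc_identity[of r F 0 U 0 U z w])
    show "F (z, w) = 0" if "z \<in> U" "w \<in> U" for z w
      using that assms(3) r by (auto simp: U_def)
  qed (use r r1(2) that lim sub in auto)
  then show ?thesis unfolding eventually_nhds_bidisc using r by blast
qed

lemma hol2_zero_on_cp:
  assumes "hol2 F 0" "\<forall>\<^sub>F x in nhds 0. F (cp x) = 0"
  shows "\<forall>\<^sub>F q in nhds 0. F q = 0"
proof -
  obtain d where d: "d > 0" "\<And>x. norm x < d \<Longrightarrow> F (cp x) = 0"
    using assms(2) unfolding eventually_nhds_metric dist_norm by auto
  show ?thesis
  proof (rule hol2_zero_on_reals[OF assms(1)])
    show "0 < d / 2" using d by simp
    fix x y :: real assume xy: "\<bar>x\<bar> < d / 2" "\<bar>y\<bar> < d / 2"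
    have "norm (vector [x, y] :: real^2) \<le> \<bar>x\<bar> + \<bar>y\<bar>"
      using norm_le_l1_cart[of "vector [x, y] :: real^2"] by (simp add: sum_2)
    with d(2)[of "vector [x, y]"] xy show "F (of_real x, of_real y) = 0" by (simp add: cp_def)
  qed
qed

text \<open>If \<open>F\<close> is nonzero at some point of a bidisc, it is so nearby, hence
  \<open>G\<close> vanishes near that point and therefore on the whole bidisc.\<close>

lemma hol2_mult_eq_0:
  assumes "hol2 F 0" "hol2 G 0" "\<forall>\<^sub>F q in nhds 0. F q * G q = 0"
  shows "(\<forall>\<^sub>F q in nhds 0. F q = 0) \<or> (\<forall>\<^sub>F q in nhds 0. G q = 0)"
proof -
  obtain r1 where r1: "r1 > 0" "\<And>z w. norm z < r1 \<Longrightarrow> norm w < r1 \<Longrightarrow> cdiff F (z, w)"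
    by (rule hol2_bidisc[OF assms(1)]) (rule that)
  obtain r2 where r2: "r2 > 0" "\<And>z w. norm z < r2 \<Longrightarrow> norm w < r2 \<Longrightarrow> cdiff G (z, w)"
    by (rule hol2_bidisc[OF assms(2)]) (rule that)
  obtain r3 where r3: "r3 > 0" "\<And>z w. norm z < r3 \<Longrightarrow> norm w < r3 \<Longrightarrow> F (z, w) * G (z, w) = 0"
    using assms(3) unfolding eventually_nhds_bidisc by blast
  define r where "r = min r1 (min r2 r3)"
  have r: "r > 0" "r \<le> r1" "r \<le> r2" "r \<le> r3" using r1(1) r2(1) r3(1) by (auto simp: r_def)
  show ?thesis
  proof (cases "\<forall>z w. norm z < r \<longrightarrow> norm w < r \<longrightarrow> F (z, w) = 0")
    case True
    then show ?thesis unfolding eventually_nhds_bidisc using r(1) by blast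
  next
    case False
    then obtain z0 w0 where 0: "norm z0 < r" "norm w0 < r" "F (z0, w0) \<noteq> 0" by blast
    have "isCont F (z0, w0)" by (rule cdiff_isCont[OF r1(2)]) (use 0 r in auto)
    then have "\<forall>\<^sub>F q in nhds (z0, w0). F q \<in> - {0}"
      by (rule eventually_nhds_isCont) (intro eventually_nhds_in_open; use 0 in auto)
    moreover have "\<forall>\<^sub>F q in nhds (z0, w0). q \<in> ball 0 r \<times> ball 0 r"
      by (rule eventually_nhds_in_open) (use 0 in \<open>auto intro: open_Times\<close>)
    ultimately have "\<forall>\<^sub>F q in nhds (z0, w0). G q = 0"
    proof eventually_elim
      case (elim q)
      then show ?case using r3(2)[of "fst q" "snd q"] r by (auto simp: mem_Times_iff)
    qed
    then have "G (z, w) = 0" if "norm z < r" "norm w < r" for z w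
      using bidisc_identity_nhds[of r G z0 w0 z w] r2(2) 0 that r by auto
    then show ?thesis unfolding eventually_nhds_bidisc using r(1) by blast
  qed
qed

section \<open>Characteristic coordinates of a transport equation\<close>

lemma eventually_nhds_0_snd:
  assumes "\<forall>\<^sub>F q in nhds (0::complex \<times> complex). fst q = 0 \<longrightarrow> P (snd q)"
  shows "\<forall>\<^sub>F w in nhds 0. P w"
proof -
  obtain r where "r > 0" "\<And>w. norm w < r \<Longrightarrow> P w"
    using assms unfolding eventually_nhds_bidisc by (metis fst_conv snd_conv norm_zero)
  then show ?thesis unfolding eventually_nhds_metric by (auto intro!: exI[of _ r])
qed

lemma cdiff_snd_field_derivative:
  assumes "cdiff F (z, w)"
  shows "((\<lambda>w. F (z, w)) has_field_derivative dw F (z, w)) (at w)"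
proof -
  have "(F has_derivative (\<lambda>h. dz F (z, w) * fst h + dw F (z, w) * snd h)) (at (z, w))"
    using assms(1) by (simp add: cdiff_def)
  from has_derivative_compose[OF has_derivative_Pair[OF has_derivative_const has_derivative_ident], OF this]
  show ?thesis by (simp add: has_field_derivative_def)
qed

text \<open>\<open>G\<close> is the solution of the homogeneous equation with initial values
  \<open>w\<close> on the slice \<open>fst q = 0\<close>. It plays the role of a coordinate constant
  along the characteristics: homogeneous solutions are functions of \<open>G\<close> alone, and a
  term of order zero only adds a nowhere zero exponential factor. One-variable theory on the slice
  thus governs solutions in two variables.\<close>

lemma transport:
  assumes A: "hol2 A 0"
  shows "\<exists>G. hol2 G 0 \<and> G 0 = 0 \<and> dw G 0 = 1 \<and> (\<forall>\<^sub>F q in nhds 0. dz G q = A q * dw G q) \<and>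
    (\<forall>\<^sub>F q in nhds 0. fst q = 0 \<longrightarrow> G q = snd q) \<and>
    (\<forall>F. hol2 F 0 \<longrightarrow> (\<forall>\<^sub>F q in nhds 0. dz F q = A q * dw F q) \<longrightarrow> (\<forall>\<^sub>F q in nhds 0. F q = F (0, G q))) \<and>
    (\<forall>F B. hol2 F 0 \<longrightarrow> hol2 B 0 \<longrightarrow> (\<forall>\<^sub>F q in nhds 0. dz F q = A q * dw F q + B q * F q) \<longrightarrow>
       (\<exists>H. hol2 H 0 \<and> (\<forall>\<^sub>F q in nhds 0. F q = F (0, G q) * exp (H q))))"
proof -
  obtain f where f: "hol2 f 0" "\<forall>\<^sub>F q in nhds 0. dz f q = A q * dw f q + A q"
    "\<forall>\<^sub>F q in nhds 0. fst q = 0 \<longrightarrow> f q = 0"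
    using ck_exists[OF A A] by blast
  \<comment> \<open>Subtracting \<open>snd q\<close> reduces to zero initial values; the
    inhomogeneous term \<open>A\<close> for \<open>f\<close> arises from
    \<open>dw snd = 1\<close>.\<close>
  define G where "G = (\<lambda>q. snd q + f q)"
  have hG: "hol2 G 0" unfolding G_def by (intro hol2_add hol2_snd f)
  have G0: "\<forall>\<^sub>F q in nhds 0. fst q = 0 \<longrightarrow> G q = snd q"
    using f(3) by eventually_elim (simp add: G_def)
  then have G00: "G 0 = 0" using eventually_nhds_x_imp_x by fastforce
  have "\<forall>\<^sub>F w in nhds 0. G (0, w) = w"
    by (rule eventually_nhds_0_snd) (use G0 in \<open>eventually_elim, metis prod.collapse\<close>)
  moreover have "((\<lambda>w. G (0, w)) has_field_derivative dw G (0, 0)) (at 0)"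
    by (rule cdiff_snd_field_derivative) (use hol2_at[OF hG] in \<open>simp add: zero_prod_def\<close>)
  ultimately have "((\<lambda>w. w) has_field_derivative dw G (0, 0)) (at (0::complex))"
    using DERIV_cong_ev[of 0 0 "\<lambda>w. G (0, w)" "\<lambda>w. w" "dw G (0, 0)" "dw G (0, 0)"] by simp
  then have dw1: "dw G 0 = 1" using DERIV_unique[OF _ DERIV_ident] by (simp add: zero_prod_def)
  have pde: "\<forall>\<^sub>F q in nhds 0. dz G q = A q * dw G q"
    using f(1)[unfolded hol2_iff_cdiff] f(2)
  proof eventually_elim
    case (elim q)
    then show ?case
      using cdiff_add[of snd q f] cdiff_snd[of q] by (simp add: G_def algebra_simps)
  qed
  have G_at: "isCont (\<lambda>q. (0::complex, G q)) 0" by (intro continuous_intros hol2_isCont[OF hG])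
  \<comment> \<open>\<open>F (0, G q)\<close> solves the same equation, since composition with
    \<open>G\<close> multiplies both partials of \<open>G\<close> by the same factor, and it agrees
    with \<open>F\<close> where \<open>fst q = 0\<close>, as \<open>G q = snd q\<close>
    there.\<close>
  have hom: "\<forall>\<^sub>F q in nhds 0. F q = F (0, G q)"
    if F: "hol2 F 0" and eq: "\<forall>\<^sub>F q in nhds 0. dz F q = A q * dw F q" for F
  proof -
    define K where "K = (\<lambda>q. F (0, G q))"
    have F0: "hol2 F (0, G 0)" using F G00 by (simp add: zero_prod_def)
    have hK: "hol2 K 0"
      unfolding K_def by (rule hol2_compose[OF hol2_const hG F0])
    from eventually_nhds_isCont[OF G_at F0[unfolded hol2_iff_cdiff]]
    have cF: "\<forall>\<^sub>F q in nhds 0. cdiff F (0, G q)" .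
    have Kpde: "\<forall>\<^sub>F q in nhds 0. dz K q = A q * dw K q"
      using cF pde hG[unfolded hol2_iff_cdiff]
    proof eventually_elim
      case (elim q)
      then show ?case
        using cdiff_compose[of "\<lambda>_. 0" q G F] cdiff_const[of 0 q] by (simp add: K_def mult_ac)
    qed
    have "\<forall>\<^sub>F q in nhds 0. F q - K q = 0"
    proof (rule ck_unique[OF A hol2_diff[OF F hK]])
      show "\<forall>\<^sub>F q in nhds 0. dz (\<lambda>q. F q - K q) q = A q * dw (\<lambda>q. F q - K q) q"
        using F[unfolded hol2_iff_cdiff] hK[unfolded hol2_iff_cdiff] eq Kpde
        by eventually_elim (simp add: cdiff_diff algebra_simps)
      show "\<forall>\<^sub>F q in nhds 0. fst q = 0 \<longrightarrow> F q - K q = 0"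
        using G0
      proof eventually_elim
        case (elim q)
        then show ?case by (cases q) (auto simp: K_def)
      qed
    qed
    then show ?thesis by eventually_elim (simp add: K_def)
  qed
  have inh: "\<exists>H. hol2 H 0 \<and> (\<forall>\<^sub>F q in nhds 0. F q = F (0, G q) * exp (H q))"
    if F: "hol2 F 0" and B: "hol2 B 0" and eq: "\<forall>\<^sub>F q in nhds 0. dz F q = A q * dw F q + B q * F q" for F B
  proof -
    obtain H where H: "hol2 H 0" "\<forall>\<^sub>F q in nhds 0. dz H q = A q * dw H q + B q"
      "\<forall>\<^sub>F q in nhds 0. fst q = 0 \<longrightarrow> H q = 0"
      using ck_exists[OF A B] by blast
    \<comment> \<open>Integrating factor: \<open>K\<close> solves the homogeneous equation, and as
      \<open>H\<close> vanishes on the slice, \<open>K\<close> and \<open>F\<close> coincide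
      there.\<close>
    define K where "K = (\<lambda>q. F q * exp (- H q))"
    have hK: "hol2 K 0"
      unfolding K_def by (intro hol2_mult F hol2_chain[where f = exp and S = UNIV] hol2_uminus H)
        (auto intro: holomorphic_intros)
    have Kpde: "\<forall>\<^sub>F q in nhds 0. dz K q = A q * dw K q"
      using F[unfolded hol2_iff_cdiff] H(1)[unfolded hol2_iff_cdiff] eq H(2)
    proof eventually_elim
      case (elim q)
      have 1: "((\<lambda>t. exp (- t)) has_field_derivative - exp (- H q)) (at (H q))"
        by (auto intro!: derivative_eq_intros)
      note 2 = cdiff_chain[OF elim(2) 1]
      note 3 = cdiff_mult[OF elim(1) conjunct1[OF 2]]
      show ?case using 2 3 elim(3,4) by (simp add: K_def) (simp add: algebra_simps)
    qed
    have H0: "\<forall>\<^sub>F q in nhds 0. H (0, G q) = 0"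
      using eventually_nhds_isCont[OF G_at, of "\<lambda>q. fst q = 0 \<longrightarrow> H q = 0"] H(3) G00
      by (simp add: zero_prod_def)
    have "\<forall>\<^sub>F q in nhds 0. F q = F (0, G q) * exp (H q)"
      using hom[OF hK Kpde] H0
    proof eventually_elim
      case (elim q)
      then have "F q * exp (- H q) * exp (H q) = F (0, G q) * exp (H q)" by (simp add: K_def)
      then show ?case by (simp add: mult.assoc flip: exp_add)
    qed
    with H(1) show ?thesis by blast
  qed
  show ?thesis
    by (rule exI[of _ G], intro conjI allI impI)
      (rule hG G00 dw1 pde G0 | erule (1) hom | erule (2) inh)+
qed

lemma hol2_derivs:
  assumes "hol2 F p"
  shows "hol2 (dz F) p" "hol2 (dw F) p"
proof -
  define G where "G = (\<lambda>q. F (p + q))"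
  have G: "hol2 G 0" unfolding G_def by (rule hol2_translate) (use assms in simp)
  have *: "dz G q = dz F (p + q) \<and> dw G q = dw F (p + q)" if "cdiff F (p + q)" for q
  proof -
    have d: "((\<lambda>q. p + q) has_derivative (\<lambda>h. h)) (at q)" by (auto intro!: derivative_eq_intros)
    have "(G has_derivative (\<lambda>h. dz F (p + q) * fst h + dw F (p + q) * snd h)) (at q)"
      unfolding G_def using has_derivative_compose[OF d that[unfolded cdiff_def]] by simp
    from cdiffI[OF this] show ?thesis by simp
  qed
  have "isCont (\<lambda>q. p + q) 0" by (intro continuous_intros)
  from eventually_nhds_isCont[OF this] assms
  have "\<forall>\<^sub>F q in nhds 0. cdiff F (p + q)" by (simp add: hol2_iff_cdiff)
  then have e: "\<forall>\<^sub>F q in nhds 0. dz G q = dz F (p + q)" "\<forall>\<^sub>F q in nhds 0. dw G q = dw F (p + q)"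
    by (eventually_elim, use * in blast)+
  have "hol2 (\<lambda>q. dz F (p + q)) (- p + p)" "hol2 (\<lambda>q. dw F (p + q)) (- p + p)"
    using hol2_derivs_0[OF G] e hol2_cong by auto
  from this[THEN hol2_translate] show "hol2 (dz F) p" "hol2 (dw F) p" by simp_all
qed

section \<open>Real analyticity through holomorphic extension\<close>

text \<open>Convergence at one real point off both axes through \<open>p\<close>, with equal offsets
  \<rho> = r / 3, already bounds the coefficients geometrically, so the same series converges on a
  complex bidisc. Conversely the Taylor series of the extension is restricted to real points.
  Closure properties of real analytic functions are then inherited from \<open>hol2\<close>.\<close>

lemma real_analytic_at_iff_hol2:
  fixes f :: "real^2 \<Rightarrow> complex"
  shows "real_analytic_at f p \<longleftrightarrow> (\<exists>F. hol2 F (cp p) \<and> (\<forall>\<^sub>F x in nhds p. f x = F (cp x)))"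
proof
  assume "real_analytic_at f p"
  then obtain r a where r: "r > 0" and hs: "\<And>x. x \<in> ball p r \<Longrightarrow>
      ((\<lambda>(i, j). ((x$1 - p$1) ^ i * (x$2 - p$2) ^ j) *\<^sub>R a i j) has_sum f x) UNIV"
    unfolding real_analytic_at_def by blast
  have hs': "((\<lambda>(i, j). a i j * of_real (x$1 - p$1) ^ i * of_real (x$2 - p$2) ^ j) has_sum f x) UNIV"
    if "x \<in> ball p r" for x
    using hs[OF that] by (simp add: case_prod_unfold scaleR_conv_of_real mult_ac)
  define \<rho> where "\<rho> = r / 3"
  have \<rho>: "\<rho> > 0" using r by (simp add: \<rho>_def)
  define x0 :: "real^2" where "x0 = p + (\<chi> i. \<rho>)"
  have "norm (x0 - p) \<le> 2 * \<rho>"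
    using norm_le_l1_cart[of "x0 - p"] \<rho> by (simp add: x0_def UNIV_2)
  then have "x0 \<in> ball p r" using r by (simp add: dist_norm norm_minus_commute \<rho>_def)
  from hs'[OF this] have "(\<lambda>(i, j). a i j * of_real \<rho> ^ i * of_real \<rho> ^ j) summable_on UNIV"
    by (auto simp: summable_on_def x0_def)
  then obtain C where C: "C \<ge> 0" "\<And>i j. norm (a i j) \<le> C * (1 / \<rho>) ^ (i + j)"
    by (rule bound_of_summable[OF _ \<rho>]) (rule that)
  define F where "F = (\<lambda>(z, w). \<Sum>\<^sub>\<infinity>(i, j). a i j * z ^ i * w ^ j)"
  have ps: "psr a F \<rho>"
    using psr_of_bound[OF C(2)] \<rho> by (simp add: F_def)
  have "hol2 F (- cp p + cp p)" using psr_derivs[OF ps \<rho>] by simp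
  then have "hol2 (\<lambda>q. F (- cp p + q)) (cp p)" by (rule hol2_translate)
  moreover have "\<forall>\<^sub>F x in nhds p. f x = F (- cp p + cp x)"
    unfolding eventually_nhds_metric
  proof (intro exI[of _ \<rho>] conjI \<rho> allI impI)
    fix x assume x: "dist x p < \<rho>"
    have c: "\<bar>(x - p) $ i\<bar> < \<rho>" for i
      using component_le_norm_cart[of "x - p" i] x by (simp add: dist_norm)
    have e: "- cp p + cp x = (of_real (x$1 - p$1), of_real (x$2 - p$2))" by (simp add: cp_def)
    have "((\<lambda>(i, j). a i j * of_real (x$1 - p$1) ^ i * of_real (x$2 - p$2) ^ j) has_sum F (- cp p + cp x)) UNIV"
      unfolding e by (rule ps[unfolded psr_def, rule_format]) (use c[of 1] c[of 2] in \<open>simp_all only: norm_of_real vector_minus_component\<close>)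
    moreover have "x \<in> ball p r" using x \<rho> by (simp add: dist_commute \<rho>_def)
    from hs'[OF this] have "((\<lambda>(i, j). a i j * of_real (x$1 - p$1) ^ i * of_real (x$2 - p$2) ^ j) has_sum f x) UNIV" .
    ultimately show "f x = F (- cp p + cp x)" by (rule has_sum_unique[rotated])
  qed
  ultimately show "\<exists>F. hol2 F (cp p) \<and> (\<forall>\<^sub>F x in nhds p. f x = F (cp x))" by blast
next
  assume "\<exists>F. hol2 F (cp p) \<and> (\<forall>\<^sub>F x in nhds p. f x = F (cp x))"
  then obtain F where F: "hol2 F (cp p)" "\<forall>\<^sub>F x in nhds p. f x = F (cp x)" by blast
  have "hol2 (\<lambda>q. F (cp p + q)) 0" by (rule hol2_translate) (use F in simp)
  then obtain a r where r: "r > 0" "psr a (\<lambda>q. F (cp p + q)) r" using hol2_psr by blast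
  obtain d where d: "d > 0" "\<And>x. dist x p < d \<Longrightarrow> f x = F (cp x)"
    using F(2) unfolding eventually_nhds_metric by blast
  show "real_analytic_at f p"
    unfolding real_analytic_at_def
  proof (intro exI[of _ "min r d"] conjI exI[of _ a] ballI)
    show "0 < min r d" using r d by simp
    fix x assume x: "x \<in> ball p (min r d)"
    have c: "\<bar>(x - p) $ i\<bar> < r" for i
      using component_le_norm_cart[of "x - p" i] x by (simp add: dist_norm norm_minus_commute)
    have e: "cp p + (of_real (x$1 - p$1), of_real (x$2 - p$2)) = cp x" by (simp add: cp_def)
    have "((\<lambda>(i, j). a i j * of_real (x$1 - p$1) ^ i * of_real (x$2 - p$2) ^ j) has_sum
        F (cp p + (of_real (x$1 - p$1), of_real (x$2 - p$2)))) UNIV"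
      by (rule r(2)[unfolded psr_def, rule_format]) (use c[of 1] c[of 2] in \<open>simp_all only: norm_of_real vector_minus_component\<close>)
    then have "((\<lambda>(i, j). a i j * of_real (x$1 - p$1) ^ i * of_real (x$2 - p$2) ^ j) has_sum f x) UNIV"
      unfolding e using d(2)[of x] x by (simp add: dist_commute)
    then show "((\<lambda>(i, j). ((x$1 - p$1) ^ i * (x$2 - p$2) ^ j) *\<^sub>R a i j) has_sum f x) UNIV"
      by (simp add: case_prod_unfold scaleR_conv_of_real mult_ac)
  qed
qed

lemma real_analytic_at_bounded_linear:
  assumes "bounded_linear h" "real_analytic_at f p"
  shows "real_analytic_at (\<lambda>x. h (f x)) p"
proof -
  interpret bounded_linear h by fact
  obtain r a where r: "r > 0" and hs: "\<And>x. x \<in> ball p r \<Longrightarrow>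
      ((\<lambda>(i, j). ((x$1 - p$1) ^ i * (x$2 - p$2) ^ j) *\<^sub>R a i j) has_sum f x) UNIV"
    using assms(2) unfolding real_analytic_at_def by blast
  have "((\<lambda>(i, j). ((x$1 - p$1) ^ i * (x$2 - p$2) ^ j) *\<^sub>R h (a i j)) has_sum h (f x)) UNIV"
    if "x \<in> ball p r" for x
    using has_sum_bounded_linear[OF assms(1) hs[OF that]] by (simp add: case_prod_unfold scaleR)
  then show ?thesis unfolding real_analytic_at_def using r
    by (intro exI[of _ r] conjI exI[of _ "\<lambda>i j. h (a i j)"]) auto
qed

lemma real_analytic_at_add:
  assumes "real_analytic_at f p" "real_analytic_at g p"
  shows "real_analytic_at (\<lambda>x. f x + g x) p"
proof -
  obtain r a where r: "r > 0" and hs: "\<And>x. x \<in> ball p r \<Longrightarrow>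
      ((\<lambda>(i, j). ((x$1 - p$1) ^ i * (x$2 - p$2) ^ j) *\<^sub>R a i j) has_sum f x) UNIV"
    using assms(1) unfolding real_analytic_at_def by blast
  obtain s b where s: "s > 0" and hs': "\<And>x. x \<in> ball p s \<Longrightarrow>
      ((\<lambda>(i, j). ((x$1 - p$1) ^ i * (x$2 - p$2) ^ j) *\<^sub>R b i j) has_sum g x) UNIV"
    using assms(2) unfolding real_analytic_at_def by blast
  have "((\<lambda>(i, j). ((x$1 - p$1) ^ i * (x$2 - p$2) ^ j) *\<^sub>R (a i j + b i j)) has_sum f x + g x) UNIV"
    if "x \<in> ball p (min r s)" for x
    using has_sum_add[OF hs[of x] hs'[of x]] that by (simp add: case_prod_unfold scaleR_add_right)
  then show ?thesis unfolding real_analytic_at_def using r s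
    by (intro exI[of _ "min r s"] conjI exI[of _ "\<lambda>i j. a i j + b i j"]) auto
qed

lemma real_analytic_at_const: "real_analytic_at (\<lambda>_. c) p"
proof -
  have "((\<lambda>(i, j). ((x$1 - p$1) ^ i * (x$2 - p$2) ^ j) *\<^sub>R (if i = 0 \<and> j = 0 then c else 0)) has_sum c) UNIV" for x
    by (rule has_sum_finite_neutralI[where B = "{(0, 0)}"]) (auto split: if_splits)
  then show ?thesis unfolding real_analytic_at_def
    by (intro exI[of _ 1] conjI exI[of _ "\<lambda>i j. if i = 0 \<and> j = 0 then c else 0"]) auto
qed

lemma real_analytic_at_sum:
  assumes "finite I" "\<And>i. i \<in> I \<Longrightarrow> real_analytic_at (f i) p"
  shows "real_analytic_at (\<lambda>x. \<Sum>i\<in>I. f i x) p"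
  using assms by (induction I rule: finite_induct) (auto intro: real_analytic_at_const real_analytic_at_add)

text \<open>Reduces values in a Euclidean space to complex ones, the only values for which the
  extension criterion is available.\<close>

lemma real_analytic_at_componentwise:
  "real_analytic_at f p \<longleftrightarrow> (\<forall>b\<in>Basis. real_analytic_at (\<lambda>x. complex_of_real (f x \<bullet> b)) p)"
proof
  assume f: "real_analytic_at f p"
  show "\<forall>b\<in>Basis. real_analytic_at (\<lambda>x. complex_of_real (f x \<bullet> b)) p"
  proof
    fix b :: 'a
    have "bounded_linear (\<lambda>y::'a. complex_of_real (y \<bullet> b))"
      by (rule bounded_linear_compose[OF bounded_linear_of_real bounded_linear_inner_left])
    from real_analytic_at_bounded_linear[OF this f]
    show "real_analytic_at (\<lambda>x. complex_of_real (f x \<bullet> b)) p" .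
  qed
next
  assume *: "\<forall>b\<in>Basis. real_analytic_at (\<lambda>x. complex_of_real (f x \<bullet> b)) p"
  have "real_analytic_at (\<lambda>x. \<Sum>b\<in>Basis. Re (complex_of_real (f x \<bullet> b)) *\<^sub>R b) p"
  proof (rule real_analytic_at_sum)
    fix b :: 'a assume b: "b \<in> Basis"
    have "bounded_linear (\<lambda>c. Re c *\<^sub>R b)"
      by (rule bounded_linear_compose[OF bounded_linear_scaleR_left bounded_linear_Re])
    from real_analytic_at_bounded_linear[OF this bspec[OF * b]]
    show "real_analytic_at (\<lambda>x. Re (complex_of_real (f x \<bullet> b)) *\<^sub>R b) p" .
  qed simp
  then show "real_analytic_at f p" by (simp add: euclidean_representation)
qed

lemma real_analytic_at_innerE:
  assumes "real_analytic_at f p"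
  obtains F where "hol2 F (cp p)" "\<forall>\<^sub>F x in nhds p. complex_of_real (f x \<bullet> b) = F (cp x)"
proof -
  have "bounded_linear (\<lambda>y. complex_of_real (y \<bullet> b))"
    by (rule bounded_linear_compose[OF bounded_linear_of_real bounded_linear_inner_left])
  from real_analytic_at_bounded_linear[OF this assms] obtain F
    where "hol2 F (cp p)" "\<forall>\<^sub>F x in nhds p. complex_of_real (f x \<bullet> b) = F (cp x)"
    unfolding real_analytic_at_iff_hol2 by (elim exE conjE)
  then show thesis by (rule that)
qed

lemma real_analytic_at_innerI:
  assumes "hol2 F (cp p)" "\<forall>\<^sub>F x in nhds p. complex_of_real (f x \<bullet> b) = F (cp x)"
  shows "real_analytic_at (\<lambda>x. complex_of_real (f x \<bullet> b)) p"
  unfolding real_analytic_at_iff_hol2 by (intro exI[of _ F] conjI assms)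

lemma real_analytic_at_of_real_iff:
  fixes f :: "real^2 \<Rightarrow> real"
  shows "real_analytic_at f p \<longleftrightarrow> real_analytic_at (\<lambda>x. complex_of_real (f x)) p"
  by (simp add: real_analytic_at_componentwise[of f])

lemma real_analytic_at_vec2_iff:
  fixes f :: "real^2 \<Rightarrow> real^2"
  shows "real_analytic_at f p \<longleftrightarrow> (\<forall>i. real_analytic_at (\<lambda>x. f x $ i) p)"
  unfolding real_analytic_at_componentwise[of f] real_analytic_at_of_real_iff
  by (auto simp: Basis_vec_def inner_axis)

lemma real_analytic_at_mat2_iff:
  fixes f :: "real^2 \<Rightarrow> real^2^2"
  shows "real_analytic_at f p \<longleftrightarrow> (\<forall>i j. real_analytic_at (\<lambda>x. f x $ i $ j) p)"
  unfolding real_analytic_at_componentwise[of f] real_analytic_at_of_real_iff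
  by (auto simp: Basis_vec_def inner_axis)

lemma real_analytic_at_hol2E:
  fixes f :: "real^2 \<Rightarrow> real"
  assumes "real_analytic_at f p"
  obtains F where "hol2 F (cp p)" "\<forall>\<^sub>F x in nhds p. of_real (f x) = F (cp x)"
  using assms unfolding real_analytic_at_of_real_iff real_analytic_at_iff_hol2 by blast

lemma real_analytic_at_hol2I:
  fixes f :: "real^2 \<Rightarrow> real"
  assumes "hol2 F (cp p)" "\<forall>\<^sub>F x in nhds p. of_real (f x) = F (cp x)"
  shows "real_analytic_at f p"
  using assms unfolding real_analytic_at_of_real_iff real_analytic_at_iff_hol2 by blast

lemma real_analytic_at_Re:
  assumes "hol2 F (cp p)"
  shows "real_analytic_at (\<lambda>x. Re (F (cp x))) p"
  by (rule real_analytic_at_bounded_linear[OF bounded_linear_Re])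
    (use assms in \<open>auto simp: real_analytic_at_iff_hol2\<close>)

lemma real_analytic_at_cong:
  assumes "\<forall>\<^sub>F x in nhds p. f x = g x" "real_analytic_at f p"
  shows "real_analytic_at g p"
proof (rule real_analytic_at_componentwise[THEN iffD2], rule ballI)
  fix b :: 'a
  obtain F where F: "hol2 F (cp p)" "\<forall>\<^sub>F x in nhds p. complex_of_real (f x \<bullet> b) = F (cp x)"
    by (rule real_analytic_at_innerE[OF assms(2)])
  have "\<forall>\<^sub>F x in nhds p. complex_of_real (g x \<bullet> b) = F (cp x)"
    using F(2) assms(1) by eventually_elim auto
  with F(1) show "real_analytic_at (\<lambda>x. complex_of_real (g x \<bullet> b)) p"
    by (rule real_analytic_at_innerI)
qed

lemma real_analytic_at_mult:
  fixes f g :: "real^2 \<Rightarrow> real"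
  assumes "real_analytic_at f p" "real_analytic_at g p"
  shows "real_analytic_at (\<lambda>x. f x * g x) p"
proof -
  obtain F where F: "hol2 F (cp p)" "\<forall>\<^sub>F x in nhds p. of_real (f x) = F (cp x)"
    by (rule real_analytic_at_hol2E[OF assms(1)])
  obtain G where G: "hol2 G (cp p)" "\<forall>\<^sub>F x in nhds p. of_real (g x) = G (cp x)"
    by (rule real_analytic_at_hol2E[OF assms(2)])
  show ?thesis
    by (rule real_analytic_at_hol2I[OF hol2_mult[OF F(1) G(1)]])
      (use F(2) G(2) in \<open>eventually_elim, simp\<close>)
qed

lemma real_analytic_at_minus:
  fixes f :: "real^2 \<Rightarrow> 'b::euclidean_space"
  assumes "real_analytic_at f p"
  shows "real_analytic_at (\<lambda>x. - f x) p"
  by (rule real_analytic_at_bounded_linear[OF bounded_linear_minus[OF bounded_linear_ident] assms])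

lemma real_analytic_at_diff:
  fixes f :: "real^2 \<Rightarrow> 'b::euclidean_space"
  assumes "real_analytic_at f p" "real_analytic_at g p"
  shows "real_analytic_at (\<lambda>x. f x - g x) p"
  using real_analytic_at_add[OF assms(1) real_analytic_at_minus[OF assms(2)]] by simp

lemma real_analytic_at_component: "real_analytic_at (\<lambda>x. x $ i) p"
proof (rule real_analytic_at_hol2I)
  show "hol2 (if i = 1 then fst else snd) (cp p)" by (simp add: hol2_fst hol2_snd)
  have "i = 1 \<or> i = 2" using exhaust_2[of i] .
  then show "\<forall>\<^sub>F x in nhds p. of_real (x $ i) = (if i = 1 then fst else snd) (cp x)"
    by (auto simp: cp_def)
qed

lemma real_analytic_at_ident: "real_analytic_at (\<lambda>x. x) p"
  unfolding real_analytic_at_vec2_iff by (simp add: real_analytic_at_component)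

lemma real_analytic_at_isCont:
  assumes "real_analytic_at f p"
  shows "isCont f p"
proof -
  have "isCont (\<lambda>x. f x \<bullet> b) p" for b
  proof -
    obtain F where F: "hol2 F (cp p)" "\<forall>\<^sub>F x in nhds p. complex_of_real (f x \<bullet> b) = F (cp x)"
      by (rule real_analytic_at_innerE[OF assms])
    have "isCont (\<lambda>x. Re (F (cp x))) p"
      by (intro isCont_Re isCont_o2[OF isCont_cp] hol2_isCont[OF F(1)])
    moreover have "\<forall>\<^sub>F x in nhds p. Re (F (cp x)) = f x \<bullet> b"
      using F(2) by eventually_elim (metis Re_complex_of_real)
    ultimately show ?thesis by (simp add: isCont_cong)
  qed
  then have "isCont (\<lambda>x. \<Sum>b\<in>Basis. (f x \<bullet> b) *\<^sub>R b) p"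
    by (intro continuous_sum continuous_scaleR continuous_const)
  then show ?thesis by (simp add: euclidean_representation)
qed

lemma real_analytic_at_compose:
  fixes f :: "real^2 \<Rightarrow> real^2"
  assumes "real_analytic_at f p" "real_analytic_at g (f p)"
  shows "real_analytic_at (\<lambda>x. g (f x)) p"
proof (rule real_analytic_at_componentwise[THEN iffD2], rule ballI)
  fix b :: 'a
  obtain G where G: "hol2 G (cp (f p))" "\<forall>\<^sub>F y in nhds (f p). complex_of_real (g y \<bullet> b) = G (cp y)"
    by (rule real_analytic_at_innerE[OF assms(2)])
  obtain F1 where F1: "hol2 F1 (cp p)" "\<forall>\<^sub>F x in nhds p. of_real (f x $ 1) = F1 (cp x)"
    using assms(1)[unfolded real_analytic_at_vec2_iff, rule_format, of 1] by (rule real_analytic_at_hol2E)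
  obtain F2 where F2: "hol2 F2 (cp p)" "\<forall>\<^sub>F x in nhds p. of_real (f x $ 2) = F2 (cp x)"
    using assms(1)[unfolded real_analytic_at_vec2_iff, rule_format, of 2] by (rule real_analytic_at_hol2E)
  have e: "\<forall>\<^sub>F x in nhds p. cp (f x) = (F1 (cp x), F2 (cp x))"
    using F1(2) F2(2) by eventually_elim (simp add: cp_def)
  then have p: "cp (f p) = (F1 (cp p), F2 (cp p))" by (rule eventually_nhds_x_imp_x)
  have H: "hol2 (\<lambda>q. G (F1 q, F2 q)) (cp p)"
    by (rule hol2_compose[OF F1(1) F2(1)]) (use G(1) p in simp)
  have "isCont f p"
    by (rule real_analytic_at_isCont[OF assms(1)])
  from eventually_nhds_isCont[OF this G(2)] e
  have "\<forall>\<^sub>F x in nhds p. complex_of_real (g (f x) \<bullet> b) = G (F1 (cp x), F2 (cp x))"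
    by eventually_elim simp
  with H show "real_analytic_at (\<lambda>x. complex_of_real (g (f x) \<bullet> b)) p"
    by (rule real_analytic_at_innerI[where f = "\<lambda>x. g (f x)"])
qed

text \<open>No re-expansion of the series at a new centre is required: \<open>hol2\<close> is an
  open condition on the extension.\<close>

lemma real_analytic_at_eventually:
  assumes "real_analytic_at f p"
  shows "\<forall>\<^sub>F x in nhds p. real_analytic_at f x"
proof -
  have "\<forall>\<^sub>F x in nhds p. real_analytic_at (\<lambda>x. complex_of_real (f x \<bullet> b)) x" if "b \<in> Basis" for b
  proof -
    obtain F where F: "hol2 F (cp p)" "\<forall>\<^sub>F x in nhds p. complex_of_real (f x \<bullet> b) = F (cp x)"
      by (rule real_analytic_at_innerE[OF assms])
    have "\<forall>\<^sub>F x in nhds p. hol2 F (cp x)" by (rule eventually_cp[OF hol2_eventually_hol2[OF F(1)]])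
    moreover have "\<forall>\<^sub>F x in nhds p. \<forall>\<^sub>F y in nhds x. complex_of_real (f y \<bullet> b) = F (cp y)"
      using F(2) by (subst eventually_eventually)
    ultimately show ?thesis
      by eventually_elim (rule real_analytic_at_innerI)
  qed
  then have "\<forall>\<^sub>F x in nhds p. \<forall>b\<in>Basis. real_analytic_at (\<lambda>x. complex_of_real (f x \<bullet> b)) x"
    by (intro eventually_ball_finite) auto
  then show ?thesis by eventually_elim (simp add: real_analytic_at_componentwise[of f])
qed

section \<open>Partial derivatives of real analytic functions\<close>

lemma hol2_cp_has_derivative:
  assumes "cdiff F (cp x)"
  shows "((\<lambda>x. F (cp x)) has_derivative (\<lambda>h. dz F (cp x) * of_real (h$1) + dw F (cp x) * of_real (h$2))) (at x)"
  using has_derivative_compose[OF bounded_linear.has_derivative[OF bounded_linear_cp has_derivative_ident]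
      assms[unfolded cdiff_def]]
  by (simp add: cp_def)

definition pdiff :: "2 \<Rightarrow> (real^2 \<Rightarrow> real) \<Rightarrow> real^2 \<Rightarrow> real" where
  "pdiff i g x = frechet_derivative g (at x) (axis i 1)"

lemma has_derivative_pdiff:
  assumes "(g has_derivative D) (at x)"
  shows "pdiff i g x = D (axis i 1)"
  using assms frechet_derivative_at[OF assms] by (simp add: pdiff_def)

lemma differentiable_pdiff:
  assumes "g differentiable (at x)"
  shows "(g has_derivative (\<lambda>h. pdiff 1 g x * h$1 + pdiff 2 g x * h$2)) (at x)"
proof -
  have D: "(g has_derivative frechet_derivative g (at x)) (at x)"
    using assms frechet_derivative_works by blast
  interpret bounded_linear "frechet_derivative g (at x)"
    using D by (rule has_derivative_bounded_linear)
  have "frechet_derivative g (at x) h = pdiff 1 g x * h$1 + pdiff 2 g x * h$2" for h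
  proof -
    have "h = h$1 *\<^sub>R axis 1 1 + h$2 *\<^sub>R axis 2 1"
      by (simp add: vec_eq_iff forall_2 axis_def)
    then have "frechet_derivative g (at x) h = frechet_derivative g (at x) (h$1 *\<^sub>R axis 1 1 + h$2 *\<^sub>R axis 2 1)"
      by simp
    then show ?thesis by (simp add: add scaleR pdiff_def mult.commute)
  qed
  then have "frechet_derivative g (at x) = (\<lambda>h. pdiff 1 g x * h$1 + pdiff 2 g x * h$2)" by auto
  with D show ?thesis by simp
qed

text \<open>Since \<open>f\<close> is real, the derivative of its extension along real directions
  has zero imaginary part; so \<open>dz\<close> and \<open>dw\<close> restrict to the real partials.
  Real differential equations thereby translate into complex ones.\<close>

lemma hol2_extension_derivs:
  fixes f :: "real^2 \<Rightarrow> real"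
  assumes "hol2 F (cp p)" "\<forall>\<^sub>F x in nhds p. of_real (f x) = F (cp x)"
  shows "\<forall>\<^sub>F x in nhds p. f differentiable (at x) \<and> dz F (cp x) = of_real (pdiff 1 f x) \<and>
           dw F (cp x) = of_real (pdiff 2 f x)"
proof -
  have "\<forall>\<^sub>F x in nhds p. \<forall>\<^sub>F y in nhds x. of_real (f y) = F (cp y)"
    using assms(2) by (subst eventually_eventually)
  with eventually_cp[OF assms(1)[unfolded hol2_iff_cdiff]] show ?thesis
  proof eventually_elim
    case (elim x)
    define D where "D = (\<lambda>h::real^2. dz F (cp x) * of_real (h$1) + dw F (cp x) * of_real (h$2))"
    have D: "((\<lambda>x. complex_of_real (f x)) has_derivative D) (at x)"
      unfolding D_def
      using elim(2) eventually_nhds_x_imp_x[OF elim(2)]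
      by (intro has_derivative_transform_eventually[OF hol2_cp_has_derivative[OF elim(1)]])
        (auto simp: eventually_at_filter elim: eventually_mono)
    have Re: "(f has_derivative (\<lambda>h. Re (D h))) (at x)"
      using bounded_linear.has_derivative[OF bounded_linear_Re D] by simp
    have Im: "((\<lambda>x. 0) has_derivative (\<lambda>h. Im (D h))) (at x)"
      using bounded_linear.has_derivative[OF bounded_linear_Im D] by simp
    have "(\<lambda>h. Im (D h)) = (\<lambda>h. 0)"
      by (rule has_derivative_unique[OF Im]) (rule has_derivative_const)
    then have im: "Im (D h) = 0" for h by metis
    have "D (axis 1 1) = dz F (cp x)" "D (axis 2 1) = dw F (cp x)"
      by (simp_all add: D_def axis_def)
    moreover have "D (axis i 1) = of_real (pdiff i f x)" for i
      using has_derivative_pdiff[OF Re, of i] im[of "axis i 1"] by (simp add: complex_eq_iff)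
    ultimately show ?case using Re by (metis differentiableI)
  qed
qed

lemma real_analytic_at_differentiable:
  fixes f :: "real^2 \<Rightarrow> real"
  assumes "real_analytic_at f p"
  shows "f differentiable (at p)" "real_analytic_at (pdiff i f) p"
proof -
  obtain F where F: "hol2 F (cp p)" "\<forall>\<^sub>F x in nhds p. of_real (f x) = F (cp x)"
    by (rule real_analytic_at_hol2E[OF assms(1)])
  note d = hol2_extension_derivs[OF F]
  show "f differentiable (at p)" using eventually_nhds_x_imp_x[OF d] by blast
  have "i = 1 \<or> i = 2" using exhaust_2[of i] .
  then show "real_analytic_at (pdiff i f) p"
  proof
    assume "i = 1"
    then show ?thesis
      by (intro real_analytic_at_hol2I[OF hol2_derivs(1)[OF F(1)]]) (use d in \<open>eventually_elim, simp\<close>)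
  next
    assume "i = 2"
    then show ?thesis
      by (intro real_analytic_at_hol2I[OF hol2_derivs(2)[OF F(1)]]) (use d in \<open>eventually_elim, simp\<close>)
  qed
qed

section \<open>The analytic inverse function theorem\<close>

text \<open>The inverse function theorem is used over the reals. Cramer's formula \<open>N\<close>
  inverts the complex-linear derivative by a complex-linear map, so the differentiable inverse is
  holomorphic.\<close>

lemma hol2_local_inverse:
  assumes F: "hol2 F1 p" "hol2 F2 p" and nz: "dz F1 p * dw F2 p - dw F1 p * dz F2 p \<noteq> 0"
  shows "\<exists>G1 G2. hol2 G1 (F1 p, F2 p) \<and> hol2 G2 (F1 p, F2 p) \<and>
           (\<forall>\<^sub>F q in nhds p. G1 (F1 q, F2 q) = fst q \<and> G2 (F1 q, F2 q) = snd q)"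
proof -
  define \<Delta> where "\<Delta> = (\<lambda>q. dz F1 q * dw F2 q - dw F1 q * dz F2 q)"
  have h\<Delta>: "hol2 \<Delta> p" unfolding \<Delta>_def by (intro hol2_diff hol2_mult hol2_derivs F)
  have "\<forall>\<^sub>F q in nhds p. \<Delta> q \<in> - {0}"
    by (rule eventually_nhds_isCont[OF hol2_isCont[OF h\<Delta>]])
      (intro eventually_nhds_in_open; use nz in \<open>auto simp: \<Delta>_def\<close>)
  with hol2_eventually_hol2[OF F(1)] hol2_eventually_hol2[OF F(2)]
  have "\<forall>\<^sub>F q in nhds p. hol2 F1 q \<and> hol2 F2 q \<and> \<Delta> q \<noteq> 0" by eventually_elim simp
  then obtain U where U: "open U" "p \<in> U" "\<And>q. q \<in> U \<Longrightarrow> hol2 F1 q \<and> hol2 F2 q \<and> \<Delta> q \<noteq> 0"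
    unfolding eventually_nhds by blast
  define f where "f = (\<lambda>q. (F1 q, F2 q))"
  define M where "M = (\<lambda>q h. (dz F1 q * fst h + dw F1 q * snd h, dz F2 q * fst h + dw F2 q * snd h) :: complex \<times> complex)"
  define N where "N = (\<lambda>q k. ((dw F2 q * fst k - dw F1 q * snd k) / \<Delta> q, (dz F1 q * snd k - dz F2 q * fst k) / \<Delta> q) :: complex \<times> complex)"
  have blM: "bounded_linear (M q)" for q
    unfolding M_def by (intro bounded_linear_Pair bounded_linear_add bounded_linear_mult_right
        bounded_linear_compose[OF bounded_linear_mult_right] bounded_linear_fst bounded_linear_snd)
  have blN: "bounded_linear (N q)" for q
    unfolding N_def divide_inverse
    by (intro bounded_linear_Pair bounded_linear_sub bounded_linear_compose[OF bounded_linear_mult_left]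
        bounded_linear_compose[OF bounded_linear_mult_right] bounded_linear_fst bounded_linear_snd)
  have NM: "N q (M q h) = h" "M q (N q h) = h" if "q \<in> U" for q h
  proof -
    have d: "\<Delta> q \<noteq> 0" using U(3)[OF that] by blast
    then show "N q (M q h) = h" "M q (N q h) = h"
      by (cases h, simp add: M_def N_def field_simps, simp add: \<Delta>_def algebra_simps)+
  qed
  define f' where "f' = (\<lambda>q. Blinfun (M q))"
  have f': "blinfun_apply (f' q) = M q" for q
    unfolding f'_def by (rule bounded_linear_Blinfun_apply[OF blM])
  define invf where "invf = Blinfun (N p)"
  have invf: "blinfun_apply invf = N p"
    unfolding invf_def by (rule bounded_linear_Blinfun_apply[OF blN])
  have der: "(f has_derivative blinfun_apply (f' q)) (at q)" if "q \<in> U" for q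
    unfolding f' M_def f_def
    using hol2_at U(3)[OF that] by (intro has_derivative_Pair) (auto simp: cdiff_def)
  have cont: "continuous_on U f'"
  proof (rule continuous_on_blinfun_componentwise)
    fix i :: "complex \<times> complex"
    show "continuous_on U (\<lambda>q. blinfun_apply (f' q) i)"
      unfolding f' M_def
    proof (rule continuous_at_imp_continuous_on, rule ballI)
      fix q assume "q \<in> U"
      then have "isCont (dz F1) q" "isCont (dw F1) q" "isCont (dz F2) q" "isCont (dw F2) q"
        using U(3) hol2_derivs hol2_isCont by blast+
      then show "isCont (\<lambda>q. (dz F1 q * fst i + dw F1 q * snd i, dz F2 q * fst i + dw F2 q * snd i)) q"
        by (intro continuous_intros)
    qed
  qed
  have inv: "invf o\<^sub>L f' p = id_blinfun"
    by (rule blinfun_eqI) (simp add: f' invf NM U(2))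
  obtain U' V g g' where g: "open U'" "U' \<subseteq> U" "p \<in> U'" "open V" "f p \<in> V" "homeomorphism U' V f g"
    "\<And>y. y \<in> V \<Longrightarrow> (g has_derivative (g' y)) (at y)"
    "\<And>y. y \<in> V \<Longrightarrow> g' y = inv (blinfun_apply (f' (g y)))"
    "\<And>y. y \<in> V \<Longrightarrow> bij (blinfun_apply (f' (g y)))"
    by (rule inverse_function_theorem[OF U(1) der cont U(2) inv]) (assumption, rule that)
  have g'': "(g has_derivative N (g y)) (at y)" if "y \<in> V" for y
  proof -
    have "g y \<in> U" using g(2) homeomorphism_image2[OF g(6)] that by blast
    then have "inv (M (g y)) = N (g y)"
      using NM by (intro inv_equality) auto
    then show ?thesis using g(7,8)[OF that] f' by simp
  qed
  have G: "cdiff (\<lambda>y. fst (g y)) y" "cdiff (\<lambda>y. snd (g y)) y" if "y \<in> V" for y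
    using cdiffI'[OF has_derivative_fst[OF g''[OF that]], of "dw F2 (g y) / \<Delta> (g y)" "- dw F1 (g y) / \<Delta> (g y)"]
      cdiffI'[OF has_derivative_snd[OF g''[OF that]], of "- dz F2 (g y) / \<Delta> (g y)" "dz F1 (g y) / \<Delta> (g y)"]
    by (auto simp: N_def diff_divide_distrib)
  have ev: "\<forall>\<^sub>F y in nhds (f p). y \<in> V" using g(4,5) by (rule eventually_nhds_in_open)
  have "hol2 (\<lambda>y. fst (g y)) (f p)" "hol2 (\<lambda>y. snd (g y)) (f p)"
    unfolding hol2_iff_cdiff using ev by (eventually_elim, use G in blast)+
  moreover have "\<forall>\<^sub>F q in nhds p. q \<in> U'" using g(1,3) by (rule eventually_nhds_in_open)
  then have "\<forall>\<^sub>F q in nhds p. fst (g (F1 q, F2 q)) = fst q \<and> snd (g (F1 q, F2 q)) = snd q"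
  proof eventually_elim
    case (elim q)
    then have "g (f q) = q" by (rule homeomorphism_apply1[OF g(6)])
    then show ?case by (simp add: f_def)
  qed
  ultimately show ?thesis unfolding f_def by blast
qed

definition jdet :: "(real^2 \<Rightarrow> real^2) \<Rightarrow> real^2 \<Rightarrow> real" where
  "jdet f x = pdiff 1 (\<lambda>x. f x $ 1) x * pdiff 2 (\<lambda>x. f x $ 2) x -
              pdiff 2 (\<lambda>x. f x $ 1) x * pdiff 1 (\<lambda>x. f x $ 2) x"

text \<open>The holomorphic inverse of the extension of \<open>f\<close> agrees with
  \<open>g\<close> at real points, because \<open>f (g y) = y\<close> and \<open>g\<close> is
  continuous at \<open>f x\<close> with value \<open>x\<close>. It is thus a holomorphic extension
  of \<open>g\<close>.\<close>

lemma real_analytic_at_inverse: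
  fixes f g :: "real^2 \<Rightarrow> real^2"
  assumes f: "real_analytic_at f x" and nz: "jdet f x \<noteq> 0"
    and inv: "\<forall>\<^sub>F y in nhds (f x). f (g y) = y" "isCont g (f x)" "g (f x) = x"
  shows "real_analytic_at g (f x)"
proof -
  obtain F1 where F1: "hol2 F1 (cp x)" "\<forall>\<^sub>F x in nhds x. of_real (f x $ 1) = F1 (cp x)"
    using f[unfolded real_analytic_at_vec2_iff, rule_format, of 1] by (rule real_analytic_at_hol2E)
  obtain F2 where F2: "hol2 F2 (cp x)" "\<forall>\<^sub>F x in nhds x. of_real (f x $ 2) = F2 (cp x)"
    using f[unfolded real_analytic_at_vec2_iff, rule_format, of 2] by (rule real_analytic_at_hol2E)
  have "dz F1 (cp x) * dw F2 (cp x) - dw F1 (cp x) * dz F2 (cp x) = of_real (jdet f x)"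
    using eventually_nhds_x_imp_x[OF hol2_extension_derivs[OF F1]]
      eventually_nhds_x_imp_x[OF hol2_extension_derivs[OF F2]] by (simp add: jdet_def)
  then have "dz F1 (cp x) * dw F2 (cp x) - dw F1 (cp x) * dz F2 (cp x) \<noteq> 0" using nz by simp
  from hol2_local_inverse[OF F1(1) F2(1) this] obtain G1 G2 where
    G: "hol2 G1 (F1 (cp x), F2 (cp x))" "hol2 G2 (F1 (cp x), F2 (cp x))"
    and Gi: "\<forall>\<^sub>F q in nhds (cp x). G1 (F1 q, F2 q) = fst q \<and> G2 (F1 q, F2 q) = snd q" by blast
  have e: "\<forall>\<^sub>F y in nhds x. cp (f y) = (F1 (cp y), F2 (cp y))"
    using F1(2) F2(2) by eventually_elim (simp add: cp_def)
  then have fx: "(F1 (cp x), F2 (cp x)) = cp (f x)" using eventually_nhds_x_imp_x by fastforce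
  have "\<forall>\<^sub>F y in nhds x. G1 (cp (f y)) = of_real (y $ 1) \<and> G2 (cp (f y)) = of_real (y $ 2)"
    using e eventually_cp[OF Gi] by eventually_elim (simp add: cp_def)
  then have "\<forall>\<^sub>F y in nhds (g (f x)). G1 (cp (f y)) = of_real (y $ 1) \<and> G2 (cp (f y)) = of_real (y $ 2)"
    by (simp add: inv(3))
  from eventually_nhds_isCont[OF inv(2) this] inv(1)
  have *: "\<forall>\<^sub>F y in nhds (f x). of_real (g y $ 1) = G1 (cp y) \<and> of_real (g y $ 2) = G2 (cp y)"
    by eventually_elim simp
  have "real_analytic_at (\<lambda>y. g y $ 1) (f x)"
    by (rule real_analytic_at_hol2I[OF G(1)[unfolded fx]]) (use * in \<open>eventually_elim, simp\<close>)
  moreover have "real_analytic_at (\<lambda>y. g y $ 2) (f x)"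
    by (rule real_analytic_at_hol2I[OF G(2)[unfolded fx]]) (use * in \<open>eventually_elim, simp\<close>)
  ultimately show ?thesis unfolding real_analytic_at_vec2_iff by (simp add: forall_2)
qed

text \<open>The real inverse function theorem supplies the homeomorphism on an open set where
  \<open>jdet f\<close> has no zeros; analyticity of the inverse is then checked separately at every
  point of the image.\<close>

lemma real_analytic_local_diffeo:
  fixes f :: "real^2 \<Rightarrow> real^2"
  assumes f: "real_analytic_at f p" and nz: "jdet f p \<noteq> 0" and W: "open W" "p \<in> W"
  obtains U V g where "open U" "p \<in> U" "U \<subseteq> W" "open V" "homeomorphism U V f g"
    "\<And>x. x \<in> U \<Longrightarrow> real_analytic_at f x" "\<And>y. y \<in> V \<Longrightarrow> real_analytic_at g y"
proof -
  have fi: "real_analytic_at (\<lambda>x. f x $ i) x" if "real_analytic_at f x" for i x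
    using that by (simp add: real_analytic_at_vec2_iff)
  have "real_analytic_at (jdet f) p"
    unfolding jdet_def by (intro real_analytic_at_diff real_analytic_at_mult real_analytic_at_differentiable fi f)
  from real_analytic_at_isCont[OF this] have "\<forall>\<^sub>F x in nhds p. jdet f x \<in> - {0}"
    by (rule eventually_nhds_isCont) (intro eventually_nhds_in_open; use nz in auto)
  with real_analytic_at_eventually[OF f] eventually_nhds_in_open[OF W]
  have "\<forall>\<^sub>F x in nhds p. real_analytic_at f x \<and> jdet f x \<noteq> 0 \<and> x \<in> W" by eventually_elim simp
  then obtain U where U: "open U" "p \<in> U" "\<And>x. x \<in> U \<Longrightarrow> real_analytic_at f x \<and> jdet f x \<noteq> 0 \<and> x \<in> W"
    unfolding eventually_nhds by blast
  define P where "P = (\<lambda>i j. pdiff j (\<lambda>x. f x $ i))"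
  define M where "M = (\<lambda>x (h::real^2). vector [P 1 1 x * h$1 + P 1 2 x * h$2, P 2 1 x * h$1 + P 2 2 x * h$2] :: real^2)"
  define N where "N = (\<lambda>x (h::real^2). vector [(P 2 2 x * h$1 - P 1 2 x * h$2) / jdet f x, (P 1 1 x * h$2 - P 2 1 x * h$1) / jdet f x] :: real^2)"
  have blM: "bounded_linear (M x)" and blN: "bounded_linear (N x)" for x
    unfolding linear_conv_bounded_linear[symmetric] M_def N_def
    by (rule linearI; simp add: vec_eq_iff forall_2 algebra_simps add_divide_distrib diff_divide_distrib)+
  have NM: "N x (M x h) = h" if "x \<in> U" for x h
  proof -
    have "jdet f x \<noteq> 0" using U(3)[OF that] by blast
    then show ?thesis
      by (simp add: M_def N_def vec_eq_iff forall_2 field_simps) (simp add: jdet_def P_def algebra_simps)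
  qed
  define f' where "f' = (\<lambda>x. Blinfun (M x))"
  have f': "blinfun_apply (f' q) = M q" for q
    unfolding f'_def by (rule bounded_linear_Blinfun_apply[OF blM])
  define invf where "invf = Blinfun (N p)"
  have invf: "blinfun_apply invf = N p"
    unfolding invf_def by (rule bounded_linear_Blinfun_apply[OF blN])
  have der: "(f has_derivative blinfun_apply (f' x)) (at x)" if "x \<in> U" for x
  proof (rule has_derivative_componentwise_within[THEN iffD2], rule ballI)
    fix b :: "real^2" assume "b \<in> Basis"
    then obtain i where b: "b = axis i 1" by (auto simp: Basis_vec_def)
    have "((\<lambda>x. f x $ i) has_derivative (\<lambda>h. P i 1 x * h$1 + P i 2 x * h$2)) (at x)"
      unfolding P_def by (intro differentiable_pdiff real_analytic_at_differentiable fi) (use U(3)[OF that] in blast)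
    moreover have "P i 1 x * h$1 + P i 2 x * h$2 = M x h $ i" for h
      using exhaust_2[of i] by (auto simp: M_def)
    ultimately show "((\<lambda>x. f x \<bullet> b) has_derivative (\<lambda>h. blinfun_apply (f' x) h \<bullet> b)) (at x)"
      by (simp add: b inner_axis f')
  qed
  have cont: "continuous_on U f'"
  proof (rule continuous_on_blinfun_componentwise)
    fix h :: "real^2"
    show "continuous_on U (\<lambda>q. blinfun_apply (f' q) h)"
      unfolding f'
    proof (rule continuous_at_imp_continuous_on, rule ballI)
      fix x assume "x \<in> U"
      then have c: "isCont (P i j) x" for i j
        unfolding P_def using U(3) by (intro real_analytic_at_isCont real_analytic_at_differentiable fi) blast
      have "isCont (\<lambda>x. M x h $ i) x" for i
        using exhaust_2[of i] c by (auto simp: M_def)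
      then have "isCont (\<lambda>x. \<chi> i. M x h $ i) x" unfolding isCont_def by (rule tendsto_vec_lambda)
      then show "isCont (\<lambda>x. M x h) x" by simp
    qed
  qed
  have inv: "invf o\<^sub>L f' p = id_blinfun"
    by (rule blinfun_eqI) (simp add: f' invf NM U(2))
  obtain U' V g g' where g: "open U'" "U' \<subseteq> U" "p \<in> U'" "open V" "f p \<in> V" "homeomorphism U' V f g"
    "\<And>y. y \<in> V \<Longrightarrow> (g has_derivative (g' y)) (at y)"
    "\<And>y. y \<in> V \<Longrightarrow> g' y = inv (blinfun_apply (f' (g y)))"
    "\<And>y. y \<in> V \<Longrightarrow> bij (blinfun_apply (f' (g y)))"
    by (rule inverse_function_theorem[OF U(1) der cont U(2) inv]) (assumption, rule that)
  show ?thesis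
  proof (rule that[OF g(1,3) _ g(4,6)])
    show "U' \<subseteq> W" using g(2) U(3) by blast
    show "real_analytic_at f x" if "x \<in> U'" for x using that g(2) U(3) by blast
    fix y assume y: "y \<in> V"
    define x where "x = g y"
    have x: "x \<in> U'" "f x = y" unfolding x_def
      using homeomorphism_image2[OF g(6)] homeomorphism_apply2[OF g(6)] y by auto
    have "real_analytic_at g (f x)"
    proof (rule real_analytic_at_inverse[where f = f and g = g and x = x])
      show "real_analytic_at f x" "jdet f x \<noteq> 0" using x g(2) U(3) by blast+
      show "\<forall>\<^sub>F y in nhds (f x). f (g y) = y"
        using eventually_nhds_in_open[OF g(4) y] unfolding x(2)
        by eventually_elim (rule homeomorphism_apply2[OF g(6)])
      show "isCont g (f x)" unfolding x(2) using g(7)[OF y] has_derivative_continuous by blast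
      show "g (f x) = x" unfolding x(2) by (simp only: x_def)
    qed
    then show "real_analytic_at g y" by (simp add: x(2))
  qed
qed

section \<open>Jacobian matrices\<close>

lemma jacobianI:
  fixes f :: "real^'n \<Rightarrow> real^'m"
  assumes "(f has_derivative (\<lambda>h. M *v h)) (at x)"
  shows "jacobian f (at x) = M"
  unfolding jacobian_def using frechet_derivative_at[OF assms] by (metis matrix_of_matrix_vector_mul)

lemma jacobian_compose:
  fixes f :: "real^'n \<Rightarrow> real^'m" and g :: "real^'k \<Rightarrow> real^'n"
  assumes "g differentiable (at x)" "f differentiable (at (g x))"
  shows "jacobian (\<lambda>x. f (g x)) (at x) = jacobian f (at (g x)) ** jacobian g (at x)"
proof (rule jacobianI)
  show "((\<lambda>x. f (g x)) has_derivative (\<lambda>h. (jacobian f (at (g x)) ** jacobian g (at x)) *v h)) (at x)"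
    using has_derivative_compose[OF assms[unfolded jacobian_works]]
    by (simp add: matrix_vector_mul_assoc)
qed

lemma jacobian_cong:
  fixes f g :: "real^'n \<Rightarrow> real^'m"
  assumes "\<forall>\<^sub>F y in nhds x. f y = g y"
  shows "jacobian f (at x) = jacobian g (at x)"
proof -
  have *: "(g has_derivative D) (at x)"
    if "(f has_derivative D) (at x)" "\<forall>\<^sub>F y in nhds x. f y = g y" for f g :: "real^'n \<Rightarrow> real^'m" and D
    using that eventually_nhds_x_imp_x[OF that(2)]
    by (intro has_derivative_transform_eventually[OF that(1)])
      (auto simp: eventually_at_filter elim: eventually_mono)
  have "\<forall>\<^sub>F y in nhds x. g y = f y" using assms by (auto elim: eventually_mono)
  then have "(f has_derivative D) (at x) \<longleftrightarrow> (g has_derivative D) (at x)" for D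
    using * assms by blast
  then show ?thesis by (simp add: jacobian_def frechet_derivative_def)
qed

lemma jacobian_const: "jacobian (\<lambda>_. c :: real^'m) (at (x :: real^'n)) = 0"
  by (rule jacobianI) (simp add: matrix_vector_mult_0)

lemma jacobian_ident: "jacobian (\<lambda>x. x) (at (x :: real^'n)) = mat 1"
  by (rule jacobianI) simp

lemma real_analytic_at_vec2_differentiable:
  fixes f :: "real^2 \<Rightarrow> real^2"
  assumes "real_analytic_at f x"
  shows "f differentiable (at x)"
proof -
  have "(\<lambda>x. f x $ i) differentiable (at x)" for i
    using assms real_analytic_at_differentiable(1) by (simp add: real_analytic_at_vec2_iff)
  then have "(\<lambda>x. f x \<bullet> b) differentiable (at x)" if "b \<in> Basis" for b :: "real^2"
    using that by (auto simp: Basis_vec_def inner_axis)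
  then show ?thesis by (simp add: differentiable_componentwise_within[of f])
qed

lemma jacobian_nth:
  fixes f :: "real^2 \<Rightarrow> real^2"
  assumes "f differentiable (at x)"
  shows "jacobian f (at x) $ i $ j = pdiff j (\<lambda>x. f x $ i) x"
proof -
  have "((\<lambda>x. f x $ i) has_derivative (\<lambda>h. (jacobian f (at x) *v h) $ i)) (at x)"
    using bounded_linear.has_derivative[OF bounded_linear_vec_nth assms[unfolded jacobian_works]] .
  from has_derivative_pdiff[OF this, of j] show ?thesis
    by (simp add: matrix_vector_mult_basis column_def)
qed

lemma pdiff_add:
  assumes "f differentiable (at x)" "g differentiable (at x)"
  shows "pdiff i (\<lambda>x. f x + g x) x = pdiff i f x + pdiff i g x"
  using has_derivative_pdiff[OF has_derivative_add[OF assms[THEN differentiable_pdiff]], of i]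
    exhaust_2[of i] by (auto simp: axis_def)

lemma pdiff_diff:
  assumes "f differentiable (at x)" "g differentiable (at x)"
  shows "pdiff i (\<lambda>x. f x - g x) x = pdiff i f x - pdiff i g x"
  using has_derivative_pdiff[OF has_derivative_diff[OF assms[THEN differentiable_pdiff]], of i]
    exhaust_2[of i] by (auto simp: axis_def)

lemma pdiff_mult:
  assumes "f differentiable (at x)" "g differentiable (at x)"
  shows "pdiff i (\<lambda>x. f x * g x) x = f x * pdiff i g x + pdiff i f x * g x"
  using has_derivative_pdiff[OF has_derivative_mult[OF assms[THEN differentiable_pdiff]], of i]
    exhaust_2[of i] by (auto simp: axis_def)

section \<open>Charts and tensor fields\<close>

definition cinv :: "'a chart \<Rightarrow> real^2 \<Rightarrow> 'a" where
  "cinv c = inv_into (fst c) (snd c)"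

lemma transition_eq: "transition c d x = snd d (cinv c x)"
  by (simp add: transition_def cinv_def)

lemma is_chart_homeomorphism:
  assumes "is_chart c"
  shows "homeomorphism (fst c) (coord_image c) (snd c) (cinv c)"
proof -
  obtain g where g: "homeomorphism (fst c) (coord_image c) (snd c) g"
    using assms unfolding is_chart_def by blast
  then have inj: "inj_on (snd c) (fst c)"
    using homeomorphism_apply1[OF g] by (intro inj_on_inverseI)
  have "cinv c y = g y" if "y \<in> coord_image c" for y
  proof -
    have "y = snd c (g y)" "g y \<in> fst c"
      using homeomorphism_apply2[OF g that] homeomorphism_image2[OF g] that by auto
    moreover have "cinv c (snd c (g y)) = g y"
      unfolding cinv_def by (rule inv_into_f_f[OF inj \<open>g y \<in> fst c\<close>])
    ultimately show ?thesis by simp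
  qed
  then show ?thesis by (intro homeomorphism_cong[OF g]) auto
qed

lemma chart_facts:
  fixes c :: "'a::t2_space chart"
  assumes "is_chart c"
  shows "open (fst c)" "open (coord_image c)"
    and "\<And>q. q \<in> fst c \<Longrightarrow> snd c q \<in> coord_image c"
    and "\<And>q. q \<in> fst c \<Longrightarrow> cinv c (snd c q) = q"
    and "\<And>x. x \<in> coord_image c \<Longrightarrow> cinv c x \<in> fst c"
    and "\<And>x. x \<in> coord_image c \<Longrightarrow> snd c (cinv c x) = x"
    and "\<And>q. q \<in> fst c \<Longrightarrow> isCont (snd c) q"
    and "\<And>x. x \<in> coord_image c \<Longrightarrow> isCont (cinv c) x"
proof -
  note h = is_chart_homeomorphism[OF assms]
  show o: "open (fst c)" "open (coord_image c)" using assms by (auto simp: is_chart_def)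
  show "\<And>q. q \<in> fst c \<Longrightarrow> snd c q \<in> coord_image c" by (simp add: coord_image_def)
  show "\<And>q. q \<in> fst c \<Longrightarrow> cinv c (snd c q) = q" by (rule homeomorphism_apply1[OF h])
  show "\<And>x. x \<in> coord_image c \<Longrightarrow> cinv c x \<in> fst c" using homeomorphism_image2[OF h] by blast
  show "\<And>x. x \<in> coord_image c \<Longrightarrow> snd c (cinv c x) = x" by (rule homeomorphism_apply2[OF h])
  show "\<And>q. q \<in> fst c \<Longrightarrow> isCont (snd c) q"
    using homeomorphism_cont1[OF h] continuous_on_eq_continuous_at[OF o(1)] by blast
  show "\<And>x. x \<in> coord_image c \<Longrightarrow> isCont (cinv c) x"
    using homeomorphism_cont2[OF h] continuous_on_eq_continuous_at[OF o(2)] by blast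
qed

lemma eventually_chart:
  fixes c :: "'a::t2_space chart"
  assumes "is_chart c" "q \<in> fst c"
  shows "(\<forall>\<^sub>F x in nhds (snd c q). P x) \<Longrightarrow> \<forall>\<^sub>F q' in nhds q. P (snd c q')"
    and "(\<forall>\<^sub>F q' in nhds q. R q') \<Longrightarrow> \<forall>\<^sub>F x in nhds (snd c q). R (cinv c x)"
proof -
  show "(\<forall>\<^sub>F x in nhds (snd c q). P x) \<Longrightarrow> \<forall>\<^sub>F q' in nhds q. P (snd c q')"
    by (rule eventually_nhds_isCont[OF chart_facts(7)[OF assms]])
  assume "\<forall>\<^sub>F q' in nhds q. R q'"
  then have "\<forall>\<^sub>F q' in nhds (cinv c (snd c q)). R q'" by (simp add: chart_facts(4)[OF assms])
  then show "\<forall>\<^sub>F x in nhds (snd c q). R (cinv c x)"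
    by (rule eventually_nhds_isCont[OF chart_facts(8)[OF assms(1) chart_facts(3)[OF assms]]])
qed

lemma chartsD: "c \<in> charts A \<Longrightarrow> is_chart c"
  by (simp add: charts_def)

lemma openI_nhds:
  assumes "\<And>x. x \<in> S \<Longrightarrow> \<forall>\<^sub>F y in nhds x. y \<in> S"
  shows "open S"
proof (rule open_subopen[THEN iffD2], rule ballI)
  fix x assume "x \<in> S"
  from assms[OF this] show "\<exists>T. open T \<and> x \<in> T \<and> T \<subseteq> S"
    unfolding eventually_nhds by (auto simp: subset_iff)
qed

section \<open>Changing charts inside the maximal atlas\<close>

context
  fixes A :: "'a::t2_space chart set"
  assumes atlas: "analytic_atlas A"
begin

lemma chart_exists: "\<exists>c\<in>A. q \<in> fst c"
  using atlas unfolding analytic_atlas_def by blast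

lemma atlas_charts: "c \<in> A \<Longrightarrow> c \<in> charts A"
  using atlas unfolding analytic_atlas_def by blast

text \<open>Membership in \<open>charts A\<close> gives compatibility with the members of
  \<open>A\<close> only, so two arbitrary charts are compared through a member of \<open>A\<close>
  around \<open>q\<close>.\<close>

lemma transition_analytic:
  assumes c: "c \<in> charts A" and d: "d \<in> charts A" and q: "q \<in> fst c" "q \<in> fst d"
  shows "real_analytic_at (transition c d) (snd c q)"
proof -
  obtain e where e: "e \<in> A" "q \<in> fst e" using chart_exists by blast
  have "compatible c e" "compatible d e" using c d e unfolding charts_def by blast+
  then have 1: "real_analytic_at (transition c e) (snd c q)" and 2: "real_analytic_at (transition e d) (snd e q)"
    using q e unfolding compatible_def real_analytic_on_def by blast+
  have "transition c e (snd c q) = snd e q"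
    by (simp add: transition_eq chart_facts(4)[OF chartsD[OF c] q(1)])
  with 2 have "real_analytic_at (\<lambda>y. transition e d (transition c e y)) (snd c q)"
    by (intro real_analytic_at_compose[OF 1]) simp
  moreover have "\<forall>\<^sub>F y in nhds (snd c q). cinv c y \<in> fst e"
    by (rule eventually_chart(2)[OF chartsD[OF c] q(1)])
      (rule eventually_nhds_in_open[OF chart_facts(1)[OF chartsD[OF atlas_charts[OF e(1)]]] e(2)])
  then have "\<forall>\<^sub>F y in nhds (snd c q). transition e d (transition c e y) = transition c d y"
    by eventually_elim (simp add: transition_eq chart_facts(4)[OF chartsD[OF atlas_charts[OF e(1)]]])
  ultimately show ?thesis by (rule real_analytic_at_cong[rotated])
qed

lemma transition_snd:
  assumes "c \<in> charts A" "q \<in> fst c"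
  shows "transition c d (snd c q) = snd d q"
  by (simp add: transition_eq chart_facts(4)[OF chartsD[OF assms(1)] assms(2)])

lemma jacobian_transition:
  assumes c: "c \<in> charts A" and d: "d \<in> charts A" and e: "e \<in> charts A"
    and q: "q \<in> fst c" "q \<in> fst d" "q \<in> fst e"
  shows "jacobian (transition c e) (at (snd c q)) =
    jacobian (transition d e) (at (snd d q)) ** jacobian (transition c d) (at (snd c q))"
proof -
  have "\<forall>\<^sub>F y in nhds (snd c q). cinv c y \<in> fst d"
    by (rule eventually_chart(2)[OF chartsD[OF c] q(1)])
      (rule eventually_nhds_in_open[OF chart_facts(1)[OF chartsD[OF d]] q(2)])
  then have "\<forall>\<^sub>F y in nhds (snd c q). transition c e y = transition d e (transition c d y)"
    by eventually_elim (simp add: transition_eq chart_facts(4)[OF chartsD[OF d]])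
  then have "jacobian (transition c e) (at (snd c q)) = jacobian (\<lambda>y. transition d e (transition c d y)) (at (snd c q))"
    by (rule jacobian_cong)
  also have "\<dots> = jacobian (transition d e) (at (transition c d (snd c q))) ** jacobian (transition c d) (at (snd c q))"
  proof (rule jacobian_compose)
    show "transition c d differentiable at (snd c q)"
      by (rule real_analytic_at_vec2_differentiable[OF transition_analytic[OF c d q(1,2)]])
    show "transition d e differentiable at (transition c d (snd c q))"
      unfolding transition_snd[OF c q(1)]
      by (rule real_analytic_at_vec2_differentiable[OF transition_analytic[OF d e q(2,3)]])
  qed
  finally show ?thesis by (simp add: transition_snd[OF c q(1)])
qed

lemma jacobian_transition_self:
  assumes "c \<in> charts A" "q \<in> fst c"
  shows "jacobian (transition c c) (at (snd c q)) = mat 1"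
proof -
  have "\<forall>\<^sub>F y in nhds (snd c q). y \<in> coord_image c"
    by (rule eventually_nhds_in_open) (use chart_facts[OF chartsD[OF assms(1)]] assms in auto)
  then have "\<forall>\<^sub>F y in nhds (snd c q). transition c c y = y"
    by eventually_elim (simp add: transition_eq chart_facts(6)[OF chartsD[OF assms(1)]])
  from jacobian_cong[OF this] show ?thesis by (simp add: jacobian_ident)
qed

text \<open>The cocycle rule for \<open>c\<close>, \<open>d\<close>, \<open>c\<close> exhibits a
  left inverse.\<close>

lemma invertible_jacobian_transition:
  assumes "c \<in> charts A" "d \<in> charts A" "q \<in> fst c" "q \<in> fst d"
  shows "invertible (jacobian (transition c d) (at (snd c q)))"
  using jacobian_transition[OF assms(1,2,1,3,4,3)] jacobian_transition_self[OF assms(1,3)]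
  unfolding invertible_left_inverse by metis

text \<open>The source of all new charts: a chart is restricted to an open part of its image and
  followed by an analytic diffeomorphism. Both the centred charts and the normal form charts arise
  in this way.\<close>

lemma chart_compose:
  assumes c: "c \<in> charts A" and U: "U \<subseteq> coord_image c" "open U" and V: "open V"
    and h: "homeomorphism U V \<phi> \<psi>"
    and an: "\<And>x. x \<in> U \<Longrightarrow> real_analytic_at \<phi> x" "\<And>y. y \<in> V \<Longrightarrow> real_analytic_at \<psi> y"
  defines "c' \<equiv> ({q \<in> fst c. snd c q \<in> U}, \<lambda>q. \<phi> (snd c q))"
  shows "c' \<in> charts A" "coord_image c' = V"
proof -
  note cf = chart_facts[OF chartsD[OF c]]
  have op: "open (fst c')"
  proof (rule openI_nhds)
    fix q assume "q \<in> fst c'"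
    then have q: "q \<in> fst c" "snd c q \<in> U" by (auto simp: c'_def)
    have "\<forall>\<^sub>F q' in nhds q. snd c q' \<in> U"
      by (rule eventually_chart(1)[OF chartsD[OF c] q(1)]) (rule eventually_nhds_in_open[OF U(2) q(2)])
    with eventually_nhds_in_open[OF cf(1) q(1)] show "\<forall>\<^sub>F q' in nhds q. q' \<in> fst c'"
      by eventually_elim (simp add: c'_def)
  qed
  have img: "snd c ` fst c' = U"
  proof
    show "snd c ` fst c' \<subseteq> U" by (auto simp: c'_def)
    show "U \<subseteq> snd c ` fst c'"
    proof
      fix x assume x: "x \<in> U"
      then have "x \<in> coord_image c" using U by blast
      then have "cinv c x \<in> fst c'" "snd c (cinv c x) = x" using x cf(5,6) by (auto simp: c'_def)
      then show "x \<in> snd c ` fst c'" by (metis imageI)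
    qed
  qed
  have h1: "homeomorphism (fst c') U (snd c) (cinv c)"
    by (rule homeomorphism_of_subsets[OF is_chart_homeomorphism[OF chartsD[OF c]]])
      (use U img in \<open>auto simp: c'_def\<close>)
  have h2: "homeomorphism (fst c') V (snd c') (\<lambda>y. cinv c (\<psi> y))"
    using homeomorphism_compose[OF h1 h] by (simp add: c'_def o_def)
  show coord: "coord_image c' = V" unfolding coord_image_def by (rule homeomorphism_image1[OF h2])
  have ch: "is_chart c'" unfolding is_chart_def coord using op V h2 by blast
  have inv: "cinv c' y = cinv c (\<psi> y)" if "y \<in> V" for y
  proof -
    have "cinv c (\<psi> y) \<in> fst c'" "snd c' (cinv c (\<psi> y)) = y"
      using homeomorphism_image2[OF h2] homeomorphism_apply2[OF h2 that] that by auto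
    then show ?thesis using chart_facts(4)[OF ch] by metis
  qed
  have "compatible c' d" if d: "d \<in> A" for d
    unfolding compatible_def real_analytic_on_def
  proof (intro conjI ballI)
    note dc = atlas_charts[OF d]
    fix x assume "x \<in> snd c' ` (fst c' \<inter> fst d)"
    then obtain q where q: "q \<in> fst c'" "q \<in> fst d" "x = snd c' q" by blast
    then have qc: "q \<in> fst c" "snd c q \<in> U" by (auto simp: c'_def)
    have x: "x \<in> V" "\<psi> x = snd c q"
      using q(3) homeomorphism_image1[OF h] homeomorphism_apply1[OF h qc(2)] qc(2) by (auto simp: c'_def)
    have "real_analytic_at (\<lambda>y. transition c d (\<psi> y)) x"
      by (rule real_analytic_at_compose[OF an(2)[OF x(1)]])
        (use transition_analytic[OF c dc qc(1) q(2)] x in simp)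
    moreover have "\<forall>\<^sub>F y in nhds x. transition c d (\<psi> y) = transition c' d y"
      using eventually_nhds_in_open[OF V x(1)] by eventually_elim (simp add: transition_eq inv)
    ultimately show "real_analytic_at (transition c' d) x" by (rule real_analytic_at_cong[rotated])
  next
    note dc = atlas_charts[OF d]
    fix x assume "x \<in> snd d ` (fst c' \<inter> fst d)"
    then obtain q where q: "q \<in> fst c'" "q \<in> fst d" "x = snd d q" by blast
    then have qc: "q \<in> fst c" "snd c q \<in> U" by (auto simp: c'_def)
    have "real_analytic_at (\<lambda>y. \<phi> (transition d c y)) x"
      unfolding q(3)
      by (rule real_analytic_at_compose[OF transition_analytic[OF dc c q(2) qc(1)]])
        (use an(1)[OF qc(2)] transition_snd[OF dc q(2)] in simp)
    moreover have "(\<lambda>y. \<phi> (transition d c y)) = transition d c'"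
      by (simp add: transition_eq c'_def fun_eq_iff)
    ultimately show "real_analytic_at (transition d c') x" by simp
  qed
  with ch show "c' \<in> charts A" unfolding charts_def by blast
qed

end

lemma matrix_inv_mult:
  assumes "invertible J"
  shows "J ** matrix_inv J = mat 1" "matrix_inv J ** J = mat 1"
  using someI_ex[OF assms[unfolded invertible_def]] unfolding matrix_inv_def by auto

lemma trace_2: "trace (M :: real^2^2) = M$1$1 + M$2$2"
  by (simp add: trace_def sum_2)

section \<open>Analytic continuation on a connected surface\<close>

text \<open>The quantifiers are ordered for a connectedness argument: one neighbourhood of
  \<open>p\<close> serves all \<open>y\<close> in it. It lies in a bidisc on which the extension of
  \<open>f\<close> is holomorphic, and vanishing near \<open>y\<close> provides real intervals of
  zeros inside that bidisc.\<close>

lemma real_analytic_at_identity: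
  fixes f :: "real^2 \<Rightarrow> real"
  assumes "real_analytic_at f p"
  shows "\<forall>\<^sub>F y in nhds p. (\<forall>\<^sub>F z in nhds y. f z = 0) \<longrightarrow> (\<forall>\<^sub>F z in nhds p. f z = 0)"
proof -
  obtain F where F: "hol2 F (cp p)" "\<forall>\<^sub>F x in nhds p. of_real (f x) = F (cp x)"
    by (rule real_analytic_at_hol2E[OF assms])
  define G where "G = (\<lambda>q. F (cp p + q))"
  have "hol2 G 0" unfolding G_def by (rule hol2_translate) (use F in simp)
  then obtain r where r: "r > 0" "\<And>z w. norm z < r \<Longrightarrow> norm w < r \<Longrightarrow> cdiff G (z, w)"
    by (rule hol2_bidisc) (rule that)
  obtain d where d: "d > 0" "\<And>x. dist x p < d \<Longrightarrow> of_real (f x) = F (cp x)"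
    using F(2) unfolding eventually_nhds_metric by blast
  define s where "s = min r (d / 2)"
  have s: "s > 0" "s \<le> r" "s \<le> d / 2" using r d by (auto simp: s_def)
  have fG: "of_real (f x) = G (of_real (x$1 - p$1), of_real (x$2 - p$2))"
    if "\<bar>x$1 - p$1\<bar> < s" "\<bar>x$2 - p$2\<bar> < s" for x
  proof -
    have "norm (x - p) \<le> \<bar>x$1 - p$1\<bar> + \<bar>x$2 - p$2\<bar>"
      using norm_le_l1_cart[of "x - p"] by (simp add: sum_2)
    then have "dist x p < d" using that s by (simp add: dist_norm)
    moreover have "cp p + (of_real (x$1 - p$1), of_real (x$2 - p$2)) = cp x" by (simp add: cp_def)
    ultimately show ?thesis using d(2) by (simp add: G_def)
  qed
  have near: "\<bar>x$1 - p$1\<bar> < s \<and> \<bar>x$2 - p$2\<bar> < s" if "dist x p < s" for x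
    using component_le_norm_cart[of "x - p" 1] component_le_norm_cart[of "x - p" 2] that
    by (simp add: dist_norm)
  show ?thesis
  proof (rule eventually_nhds_metric[THEN iffD2], intro exI[of _ s] conjI s(1) allI impI)
    fix y assume y: "dist y p < s" and "\<forall>\<^sub>F z in nhds y. f z = 0"
    then obtain e where e: "e > 0" "\<And>z. dist z y < e \<Longrightarrow> f z = 0" unfolding eventually_nhds_metric by blast
    define y1 where "y1 = y$1 - p$1"
    define y2 where "y2 = y$2 - p$2"
    have ys: "\<bar>y1\<bar> < s" "\<bar>y2\<bar> < s" using near[OF y] by (auto simp: y1_def y2_def)
    define T where "T = (\<lambda>c. complex_of_real ` {t. \<bar>t - c\<bar> < e / 2 \<and> \<bar>t\<bar> < s})"
    have lim: "of_real c islimpt T c" if "\<bar>c\<bar> < s" for c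
      unfolding islimpt_approachable
    proof (intro allI impI)
      fix \<epsilon> :: real assume "\<epsilon> > 0"
      define \<delta> where "\<delta> = min (min \<epsilon> (e / 2)) (s - \<bar>c\<bar>) / 2"
      have \<delta>: "\<delta> > 0" "\<delta> < \<epsilon>" "\<delta> < e / 2" "\<bar>c\<bar> + \<delta> < s"
        using \<open>\<epsilon> > 0\<close> e(1) that by (auto simp: \<delta>_def min_def field_simps)
      then have "of_real (c + \<delta>) \<in> T c" unfolding T_def by (intro imageI) auto
      moreover have "complex_of_real (c + \<delta>) \<noteq> of_real c" using \<delta>(1) by (simp only: of_real_eq_iff)
      moreover have "dist (complex_of_real (c + \<delta>)) (of_real c) < \<epsilon>"
        unfolding dist_norm of_real_diff[symmetric] norm_of_real using \<delta> by simp
      ultimately show "\<exists>x'\<in>T c. x' \<noteq> of_real c \<and> dist x' (of_real c) < \<epsilon>" by blast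
    qed
    have zero: "G (z, w) = 0" if z: "z \<in> T y1" and w: "w \<in> T y2" for z w
    proof -
      obtain a where a: "z = of_real a" "\<bar>a - y1\<bar> < e / 2" "\<bar>a\<bar> < s"
        using z unfolding T_def by auto
      obtain b where b: "w = of_real b" "\<bar>b - y2\<bar> < e / 2" "\<bar>b\<bar> < s"
        using w unfolding T_def by auto
      note ab = a b
      define x :: "real^2" where "x = vector [p$1 + a, p$2 + b]"
      have "norm (x - y) \<le> \<bar>a - y1\<bar> + \<bar>b - y2\<bar>"
        using norm_le_l1_cart[of "x - y"] by (simp add: sum_2 x_def y1_def y2_def algebra_simps)
      then have "f x = 0" using ab by (intro e(2)) (simp add: dist_norm)
      then show ?thesis using fG[of x] ab by (simp add: x_def)
    qed
    have G0: "G (z, w) = 0" if "norm z < r" "norm w < r" for z w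
      by (rule bidisc_identity[OF r(2) _ lim[OF ys(1)] _ _ lim[OF ys(2)] _ zero that])
        (use ys s in \<open>auto simp: T_def\<close>)
    show "\<forall>\<^sub>F z in nhds p. f z = 0"
      unfolding eventually_nhds_metric
    proof (intro exI[of _ s] conjI s(1) allI impI)
      fix x assume "dist x p < s"
      note n = near[OF this]
      have "G (of_real (x$1 - p$1), of_real (x$2 - p$2)) = 0"
        using n s by (intro G0) (simp_all only: norm_of_real, linarith+)
      with fG[of x] n have "complex_of_real (f x) = 0" by metis
      then show "f x = 0" by simp
    qed
  qed
qed

context
  fixes A :: "'a::t2_space chart set"
  assumes atlas: "analytic_atlas A"
begin

lemma charts_cover: "\<exists>c\<in>charts A. q \<in> fst c"
  using chart_exists[OF atlas] atlas_charts[OF atlas] by blast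

text \<open>The set of points near which the function vanishes is open by construction and closed by
  \<open>real_analytic_at_identity\<close>.\<close>

lemma analytic_zero_everywhere:
  fixes \<Psi> :: "'a \<Rightarrow> real"
  assumes conn: "connected (UNIV :: 'a set)"
    and an: "\<And>c q. c \<in> charts A \<Longrightarrow> q \<in> fst c \<Longrightarrow> real_analytic_at (\<lambda>x. \<Psi> (cinv c x)) (snd c q)"
    and 0: "\<forall>\<^sub>F q in nhds q0. \<Psi> q = 0"
  shows "\<Psi> q = 0"
proof -
  define S where "S = {q. \<forall>\<^sub>F q' in nhds q. \<Psi> q' = 0}"
  have "\<forall>\<^sub>F q' in nhds q. q' \<in> S" if "q \<in> S" for q
    using that unfolding S_def mem_Collect_eq by (subst eventually_eventually)
  then have "open S" by (rule openI_nhds)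
  have *: "\<forall>\<^sub>F q' in nhds q. q' \<in> S \<longrightarrow> q \<in> S" for q
  proof -
    obtain c where c: "c \<in> charts A" "q \<in> fst c" using charts_cover by blast
    note ch = chartsD[OF c(1)]
    have "\<forall>\<^sub>F q' in nhds q. (\<forall>\<^sub>F z in nhds (snd c q'). \<Psi> (cinv c z) = 0) \<longrightarrow> (\<forall>\<^sub>F z in nhds (snd c q). \<Psi> (cinv c z) = 0)"
      by (rule eventually_chart(1)[OF ch c(2) real_analytic_at_identity[OF an[OF c]]])
    with eventually_nhds_in_open[OF chart_facts(1)[OF ch] c(2)] show ?thesis
    proof eventually_elim
      case (elim q')
      show ?case
      proof
        assume "q' \<in> S"
        then have "\<forall>\<^sub>F z in nhds (snd c q'). \<Psi> (cinv c z) = 0"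
          unfolding S_def using eventually_chart(2)[OF ch elim(1)] by blast
        with elim(2) have "\<forall>\<^sub>F z in nhds (snd c q). \<Psi> (cinv c z) = 0" by blast
        from eventually_chart(1)[OF ch c(2) this] eventually_nhds_in_open[OF chart_facts(1)[OF ch] c(2)]
        have "\<forall>\<^sub>F q' in nhds q. \<Psi> q' = 0"
          by eventually_elim (simp add: chart_facts(4)[OF ch])
        then show "q \<in> S" by (simp add: S_def)
      qed
    qed
  qed
  have "\<forall>\<^sub>F q' in nhds q. q' \<in> - S" if "q \<in> - S" for q
    using *[of q] by eventually_elim (use that in auto)
  then have "open (- S)" by (rule openI_nhds)
  then have "S = {} \<or> S = UNIV"
    using conn \<open>open S\<close> unfolding connected_clopen by (simp add: closed_open closedin_closed_eq)
  moreover have "q0 \<in> S" using 0 by (simp add: S_def)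
  ultimately have "q \<in> S" by auto
  then show ?thesis unfolding S_def using eventually_nhds_x_imp_x by blast
qed

lemma isCont_via_chart:
  fixes \<Psi> :: "'a \<Rightarrow> real"
  assumes c: "c \<in> charts A" "q \<in> fst c" and an: "real_analytic_at (\<lambda>x. \<Psi> (cinv c x)) (snd c q)"
  shows "isCont \<Psi> q"
proof -
  note ch = chartsD[OF c(1)]
  have "isCont (\<lambda>q. \<Psi> (cinv c (snd c q))) q"
    by (rule isCont_o2[OF chart_facts(7)[OF ch c(2)] real_analytic_at_isCont[OF an]])
  moreover have "\<forall>\<^sub>F q' in nhds q. \<Psi> (cinv c (snd c q')) = \<Psi> q'"
    using eventually_nhds_in_open[OF chart_facts(1)[OF ch] c(2)]
    by eventually_elim (simp add: chart_facts(4)[OF ch])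
  ultimately show ?thesis by (simp add: isCont_cong)
qed

section \<open>Tensor fields in charts and the Nijenhuis equations\<close>

context
  fixes L :: "'a tfield"
  assumes tf: "tensor_field A L"
begin

lemma tensor_transform:
  assumes c: "c \<in> charts A" and d: "d \<in> charts A" and q: "q \<in> fst c" "q \<in> fst d"
  defines "J \<equiv> jacobian (transition c d) (at (snd c q))"
  shows "L d (snd d q) ** J = J ** L c (snd c q)" "invertible J"
proof -
  show inv: "invertible J"
    unfolding J_def by (rule invertible_jacobian_transition[OF atlas c d q])
  have "snd c q \<in> snd c ` (fst c \<inter> fst d)" using q by blast
  then have "L d (transition c d (snd c q)) = J ** L c (snd c q) ** matrix_inv J"
    using tf c d unfolding tensor_field_def J_def by blast
  then have "L d (snd d q) = J ** L c (snd c q) ** matrix_inv J"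
    by (simp add: transition_snd[OF atlas c q(1)])
  then have "L d (snd d q) ** J = J ** L c (snd c q) ** (matrix_inv J ** J)"
    by (simp add: matrix_mul_assoc)
  then show "L d (snd d q) ** J = J ** L c (snd c q)"
    by (simp add: matrix_inv_mult[OF inv])
qed

text \<open>The two matrices are conjugate by the Jacobian; this makes the definite descriptions in
  \<open>tr_at\<close> and \<open>det_at\<close> meaningful.\<close>

lemma trace_det_invariant:
  assumes c: "c \<in> charts A" and d: "d \<in> charts A" and q: "q \<in> fst c" "q \<in> fst d"
  shows "trace (L d (snd d q)) = trace (L c (snd c q))" "det (L d (snd d q)) = det (L c (snd c q))"
proof -
  define J where "J = jacobian (transition c d) (at (snd c q))"
  have e: "L d (snd d q) ** J = J ** L c (snd c q)" and inv: "invertible J"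
    using tensor_transform[OF c d q] unfolding J_def by auto
  have "L d (snd d q) = L d (snd d q) ** (J ** matrix_inv J)" by (simp add: matrix_inv_mult[OF inv])
  also have "\<dots> = (J ** L c (snd c q)) ** matrix_inv J" unfolding matrix_mul_assoc e ..
  finally have "trace (L d (snd d q)) = trace (matrix_inv J ** (J ** L c (snd c q)))"
    by (metis trace_mul_sym)
  also have "\<dots> = trace (L c (snd c q))"
    unfolding matrix_mul_assoc matrix_inv_mult[OF inv] by simp
  finally show "trace (L d (snd d q)) = trace (L c (snd c q))" .
  have "det (L d (snd d q)) * det J = det J * det (L c (snd c q))"
    using arg_cong[OF e, of det] unfolding det_mul .
  moreover have "det J \<noteq> 0" using inv by (simp add: invertible_det_nz)
  ultimately show "det (L d (snd d q)) = det (L c (snd c q))" by simp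
qed

lemma tr_at_eq:
  assumes "c \<in> charts A" "q \<in> fst c"
  shows "tr_at A L q = trace (L c (snd c q))"
  unfolding tr_at_def by (rule the_equality) (use assms trace_det_invariant in blast)+

lemma det_at_eq:
  assumes "c \<in> charts A" "q \<in> fst c"
  shows "det_at A L q = det (L c (snd c q))"
  unfolding det_at_def by (rule the_equality) (use assms trace_det_invariant in blast)+

lemma tensor_analytic:
  assumes "c \<in> charts A" "q \<in> fst c"
  shows "real_analytic_at (\<lambda>x. L c x $ i $ j) (snd c q)"
proof -
  have "snd c q \<in> coord_image c" using assms(2) by (simp add: coord_image_def)
  then have "real_analytic_at (L c) (snd c q)"
    using tf assms(1) unfolding tensor_field_def real_analytic_on_def by blast
  then show ?thesis by (simp add: real_analytic_at_mat2_iff)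
qed

lemma tr_det_analytic:
  assumes c: "c \<in> charts A" and q: "q \<in> fst c"
  shows "real_analytic_at (\<lambda>x. tr_at A L (cinv c x)) (snd c q)"
    "real_analytic_at (\<lambda>x. det_at A L (cinv c x)) (snd c q)"
proof -
  note ch = chartsD[OF c]
  have ev: "\<forall>\<^sub>F x in nhds (snd c q). x \<in> coord_image c"
    by (rule eventually_nhds_in_open[OF chart_facts(2,3)[OF ch]]) (rule q)
  have 1: "tr_at A L (cinv c x) = L c x $ 1 $ 1 + L c x $ 2 $ 2"
    "det_at A L (cinv c x) = L c x $ 1 $ 1 * L c x $ 2 $ 2 - L c x $ 1 $ 2 * L c x $ 2 $ 1"
    if "x \<in> coord_image c" for x
    using tr_at_eq[OF c chart_facts(5)[OF ch that]] det_at_eq[OF c chart_facts(5)[OF ch that]]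
    by (simp_all add: trace_2 det_2 chart_facts(6)[OF ch that])
  note an = tensor_analytic[OF c q]
  show "real_analytic_at (\<lambda>x. tr_at A L (cinv c x)) (snd c q)"
    by (rule real_analytic_at_cong[OF _ real_analytic_at_add[OF an[of 1 1] an[of 2 2]]])
      (use ev in \<open>eventually_elim, simp add: 1\<close>)
  show "real_analytic_at (\<lambda>x. det_at A L (cinv c x)) (snd c q)"
    by (rule real_analytic_at_cong[OF _ real_analytic_at_diff[OF real_analytic_at_mult[OF an[of 1 1] an[of 2 2]]
            real_analytic_at_mult[OF an[of 1 2] an[of 2 1]]]])
      (use ev in \<open>eventually_elim, simp add: 1\<close>)
qed

text \<open>Near \<open>x\<close> the transition map from \<open>c\<close> to \<open>c'\<close> is
  \<phi>. The transformation law is kept in the inverse-free form L' J = J L, in which a normal form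
  can be checked entry by entry.\<close>

lemma tensor_chart_compose:
  assumes c: "c \<in> charts A" and U: "U \<subseteq> coord_image c" "open U" and V: "open V"
    and h: "homeomorphism U V \<phi> \<psi>"
    and an: "\<And>x. x \<in> U \<Longrightarrow> real_analytic_at \<phi> x" "\<And>y. y \<in> V \<Longrightarrow> real_analytic_at \<psi> y"
    and x: "x \<in> U"
  defines "c' \<equiv> ({q \<in> fst c. snd c q \<in> U}, \<lambda>q. \<phi> (snd c q))"
  shows "L c' (\<phi> x) ** jacobian \<phi> (at x) = jacobian \<phi> (at x) ** L c x" "invertible (jacobian \<phi> (at x))"
proof -
  note ch = chartsD[OF c]
  have c': "c' \<in> charts A" unfolding c'_def by (rule chart_compose[OF atlas c U V h an])
  define q where "q = cinv c x"
  have xc: "x \<in> coord_image c" using x U by blast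
  have q: "q \<in> fst c" "snd c q = x" "q \<in> fst c'" "snd c' q = \<phi> x"
    using chart_facts(5,6)[OF ch xc] x by (auto simp: q_def c'_def)
  have "\<forall>\<^sub>F y in nhds x. transition c c' y = \<phi> y"
    using eventually_nhds_in_open[OF chart_facts(2)[OF ch] xc]
    by eventually_elim (simp add: transition_eq c'_def chart_facts(6)[OF ch])
  from jacobian_cong[OF this] tensor_transform[OF c c' q(1,3)]
  show "L c' (\<phi> x) ** jacobian \<phi> (at x) = jacobian \<phi> (at x) ** L c x" "invertible (jacobian \<phi> (at x))"
    by (simp_all add: q)
qed

text \<open>The coordinate vector field of \<open>c\<close> in direction \<open>i\<close>, expressed
  in every chart \<open>d\<close>. It lives on \<open>fst c\<close>, the open set with which the
  Nijenhuis condition is then tested.\<close>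

definition coord_field :: "'a chart \<Rightarrow> 2 \<Rightarrow> 'a vfield" where
  "coord_field c i = (\<lambda>d y. jacobian (transition c d) (at (transition d c y)) *v axis i 1)"

lemma vector_field_coord_field:
  assumes c: "c \<in> charts A"
  shows "vector_field_on A (fst c) (coord_field c i)"
  unfolding vector_field_on_def
proof (intro conjI ballI)
  fix d assume d: "d \<in> charts A"
  show "real_analytic_on (snd d ` (fst d \<inter> fst c)) (coord_field c i d)"
    unfolding real_analytic_on_def
  proof
    fix x assume "x \<in> snd d ` (fst d \<inter> fst c)"
    then obtain q where q: "q \<in> fst d" "q \<in> fst c" "x = snd d q" by blast
    have td: "transition d c x = snd c q" unfolding q(3) by (rule transition_snd[OF atlas d q(1)])
    have an: "real_analytic_at (\<lambda>y. pdiff i (\<lambda>z. transition c d z $ k) (transition d c y)) x" for k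
    proof (rule real_analytic_at_compose)
      show "real_analytic_at (transition d c) x"
        unfolding q(3) by (rule transition_analytic[OF atlas d c q(1,2)])
      have "real_analytic_at (\<lambda>z. transition c d z $ k) (snd c q)"
        using transition_analytic[OF atlas c d q(2,1)] by (simp add: real_analytic_at_vec2_iff)
      from real_analytic_at_differentiable(2)[OF this, of i]
      show "real_analytic_at (pdiff i (\<lambda>z. transition c d z $ k)) (transition d c x)"
        unfolding td .
    qed
    have "\<forall>\<^sub>F y in nhds x. cinv d y \<in> fst c" "\<forall>\<^sub>F y in nhds x. y \<in> coord_image d"
      unfolding q(3)
      by (rule eventually_chart(2)[OF chartsD[OF d] q(1) eventually_nhds_in_open[OF chart_facts(1)[OF chartsD[OF c]] q(2)]])
        (rule eventually_nhds_in_open[OF chart_facts(2,3)[OF chartsD[OF d]]], rule q(1))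
    then have "\<forall>\<^sub>F y in nhds x. pdiff i (\<lambda>z. transition c d z $ k) (transition d c y) = coord_field c i d y $ k" for k
    proof eventually_elim
      case (elim y)
      have "real_analytic_at (transition c d) (transition d c y)"
        unfolding transition_eq[of d c]
        by (rule transition_analytic[OF atlas c d elim(1) chart_facts(5)[OF chartsD[OF d] elim(2)]])
      from jacobian_nth[OF real_analytic_at_vec2_differentiable[OF this]]
      show ?case by (simp add: coord_field_def matrix_vector_mult_basis column_def)
    qed
    from real_analytic_at_cong[OF this an]
    show "real_analytic_at (coord_field c i d) x" by (simp add: real_analytic_at_vec2_iff)
  qed
next
  fix d e x assume d: "d \<in> charts A" and e: "e \<in> charts A" and "x \<in> snd d ` (fst d \<inter> fst e \<inter> fst c)"
  then obtain q where q: "q \<in> fst d" "q \<in> fst e" "q \<in> fst c" "x = snd d q" by blast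
  show "coord_field c i e (transition d e x) = jacobian (transition d e) (at x) *v coord_field c i d x"
    unfolding coord_field_def q(4) transition_snd[OF atlas d q(1)] transition_snd[OF atlas e q(2)]
      jacobian_transition[OF atlas c d e q(3,1,2)] matrix_vector_mul_assoc ..
qed

text \<open>The torsion is evaluated on the two coordinate fields, whose components in
  \<open>c\<close> are constant, so only derivatives of the entries of \<open>L\<close> remain. Its
  first component rearranges to the first equation and its second component to the second.\<close>

lemma nijenhuis_chart:
  assumes nij: "nijenhuis A L" and c: "c \<in> charts A" and x: "x \<in> coord_image c"
  defines "l \<equiv> (\<lambda>i j y. L c y $ i $ j)"
  defines "v \<equiv> (\<lambda>y. l 1 1 y + l 2 2 y)" and "u \<equiv> (\<lambda>y. l 1 2 y * l 2 1 y - l 1 1 y * l 2 2 y)"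
  shows "l 1 2 x * pdiff 1 v x = l 1 1 x * pdiff 2 v x + pdiff 2 u x"
    and "l 2 1 x * pdiff 2 v x = l 2 2 x * pdiff 1 v x + pdiff 1 u x"
proof -
  note ch = chartsD[OF c]
  obtain q where q: "q \<in> fst c" "x = snd c q" using x unfolding coord_image_def by blast
  define X where "X = coord_field c 1"
  define Y where "Y = coord_field c 2"
  have E: "coord_field c i c y = axis i 1" if "y \<in> coord_image c" for i y
  proof -
    have "transition c c y = snd c (cinv c y)" by (simp add: transition_eq)
    then show ?thesis
      using jacobian_transition_self[OF atlas c chart_facts(5)[OF ch that]] by (simp add: coord_field_def)
  qed
  have ev: "\<forall>\<^sub>F y in nhds x. y \<in> coord_image c"
    by (rule eventually_nhds_in_open[OF chart_facts(2)[OF ch] x])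
  have "torsion L X Y c x = 0"
    using nij vector_field_coord_field[OF c] chart_facts(1)[OF ch] c q
    unfolding nijenhuis_def X_def Y_def by blast
  moreover have J0: "jacobian (X c) (at x) = 0" "jacobian (Y c) (at x) = 0"
  proof -
    have "\<forall>\<^sub>F y in nhds x. X c y = axis 1 1" "\<forall>\<^sub>F y in nhds x. Y c y = axis 2 1"
      using ev by (eventually_elim, simp add: X_def Y_def E)+
    from this[THEN jacobian_cong] show "jacobian (X c) (at x) = 0" "jacobian (Y c) (at x) = 0"
      by (simp_all add: jacobian_const)
  qed
  have d: "l i j differentiable (at x)" for i j
    unfolding l_def q(2) by (rule real_analytic_at_differentiable(1)[OF tensor_analytic[OF c q(1)]])
  have JL: "jacobian (tapply L (coord_field c j) c) (at x) $ k $ m = pdiff m (l k j) x" for j k m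
  proof -
    have "\<forall>\<^sub>F y in nhds x. tapply L (coord_field c j) c y = (\<chi> k. l k j y)"
      using ev by eventually_elim (simp add: tapply_def E matrix_vector_mult_basis column_def l_def)
    from jacobian_cong[OF this] have "jacobian (tapply L (coord_field c j) c) (at x) = jacobian (\<lambda>y. \<chi> k. l k j y) (at x)" .
    moreover have "(\<lambda>y. (\<chi> k. l k j y) \<bullet> b) differentiable (at x)" if "b \<in> Basis" for b :: "real^2"
      using that d by (auto simp: Basis_vec_def inner_axis)
    then have "(\<lambda>y. \<chi> k. l k j y) differentiable (at x)" by (simp add: differentiable_componentwise_within[of "\<lambda>y. \<chi> k. l k j y"])
    from jacobian_nth[OF this] have "jacobian (\<lambda>y. \<chi> k. l k j y) (at x) $ k $ m = pdiff m (l k j) x" by simp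
    ultimately show ?thesis by simp
  qed
  have val: "X c x = axis 1 1" "Y c x = axis 2 1" by (simp_all add: X_def Y_def E x)
  have valL: "tapply L X c x $ k = l k 1 x" "tapply L Y c x $ k = l k 2 x" for k
    by (simp_all add: tapply_def val matrix_vector_mult_basis column_def l_def)
  have br: "lie_bracket X Y c x = 0" by (simp add: lie_bracket_def J0)
  have brX: "lie_bracket (tapply L X) Y c x $ k = - pdiff 2 (l k 1) x" for k
    by (simp add: lie_bracket_def J0 val matrix_vector_mult_basis column_def JL X_def)
  have brY: "lie_bracket X (tapply L Y) c x $ k = pdiff 1 (l k 2) x" for k
    by (simp add: lie_bracket_def J0 val matrix_vector_mult_basis column_def JL Y_def)
  have brXY: "lie_bracket (tapply L X) (tapply L Y) c x $ k =
      pdiff 1 (l k 2) x * l 1 1 x + pdiff 2 (l k 2) x * l 2 1 x - (pdiff 1 (l k 1) x * l 1 2 x + pdiff 2 (l k 1) x * l 2 2 x)" for k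
    by (simp add: lie_bracket_def matrix_vector_mult_def sum_2 valL, simp add: X_def Y_def JL)
  have LL: "tapply L Z c x $ k = l k 1 x * Z c x $ 1 + l k 2 x * Z c x $ 2" for Z k
    by (simp add: tapply_def matrix_vector_mult_def sum_2 l_def)
  ultimately have N: "0 = - (l k 1 x * - pdiff 2 (l 1 1) x + l k 2 x * - pdiff 2 (l 2 1) x)
      - (l k 1 x * pdiff 1 (l 1 2) x + l k 2 x * pdiff 1 (l 2 2) x)
      + (pdiff 1 (l k 2) x * l 1 1 x + pdiff 2 (l k 2) x * l 2 1 x - (pdiff 1 (l k 1) x * l 1 2 x + pdiff 2 (l k 1) x * l 2 2 x))" for k
    unfolding torsion_def vec_eq_iff vector_minus_component vector_add_component LL br brX brY brXY
    by (simp add: spec[of _ k])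
  have v: "pdiff i v x = pdiff i (l 1 1) x + pdiff i (l 2 2) x" for i
    unfolding v_def by (rule pdiff_add[OF d d])
  have u: "pdiff i u x = l 1 2 x * pdiff i (l 2 1) x + pdiff i (l 1 2) x * l 2 1 x
      - (l 1 1 x * pdiff i (l 2 2) x + pdiff i (l 1 1) x * l 2 2 x)" for i
    unfolding u_def using pdiff_diff[OF differentiable_mult[OF d d] differentiable_mult[OF d d]] pdiff_mult[OF d d] by simp
  show "l 1 2 x * pdiff 1 v x = l 1 1 x * pdiff 2 v x + pdiff 2 u x"
    using N[of 1] unfolding v u by (simp add: algebra_simps)
  show "l 2 1 x * pdiff 2 v x = l 2 2 x * pdiff 1 v x + pdiff 1 u x"
    using N[of 2] unfolding v u by (simp add: algebra_simps)
qed

end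

end

lemma eventually_derivs_cong0:
  assumes "\<forall>\<^sub>F q in nhds p. F q = G q"
  shows "\<forall>\<^sub>F q in nhds p. dz F q = dz G q" "\<forall>\<^sub>F q in nhds p. dw F q = dw G q"
  using eventually_cong_derivs[OF assms] by (auto elim: eventually_mono)

section \<open>Germs of Nijenhuis operators\<close>

text \<open>The two equations are the components of \<open>L\<^sup>* dv = v dv + du\<close>.\<close>

locale nijenhuis_germ =
  fixes M :: "real^2 \<Rightarrow> real^2^2"
  assumes an: "\<And>i j. real_analytic_at (\<lambda>x. M x $ i $ j) 0"
    and e1: "\<forall>\<^sub>F x in nhds 0. M x $ 1 $ 2 * pdiff 1 (\<lambda>x. M x $ 1 $ 1 + M x $ 2 $ 2) x =
        M x $ 1 $ 1 * pdiff 2 (\<lambda>x. M x $ 1 $ 1 + M x $ 2 $ 2) x +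
        pdiff 2 (\<lambda>x. M x $ 1 $ 2 * M x $ 2 $ 1 - M x $ 1 $ 1 * M x $ 2 $ 2) x"
    and e2: "\<forall>\<^sub>F x in nhds 0. M x $ 2 $ 1 * pdiff 2 (\<lambda>x. M x $ 1 $ 1 + M x $ 2 $ 2) x =
        M x $ 2 $ 2 * pdiff 1 (\<lambda>x. M x $ 1 $ 1 + M x $ 2 $ 2) x +
        pdiff 1 (\<lambda>x. M x $ 1 $ 2 * M x $ 2 $ 1 - M x $ 1 $ 1 * M x $ 2 $ 2) x"
    and m12: "M 0 $ 1 $ 2 \<noteq> 0"
begin

definition tr :: "real^2 \<Rightarrow> real" where
  "tr x = M x $ 1 $ 1 + M x $ 2 $ 2"

definition nu :: "real^2 \<Rightarrow> real" where
  "nu x = M x $ 1 $ 2 * M x $ 2 $ 1 - M x $ 1 $ 1 * M x $ 2 $ 2"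

definition disc :: "real^2 \<Rightarrow> real" where
  "disc x = (tr x)\<^sup>2 + 4 * nu x"

text \<open>A choice of holomorphic extension. As a germ it is unique by the identity theorem, while
  its values farther away are arbitrary; hence the statements about it are statements about
  germs.\<close>

definition Lc :: "2 \<Rightarrow> 2 \<Rightarrow> complex \<times> complex \<Rightarrow> complex" where
  "Lc i j = (SOME F. hol2 F 0 \<and> (\<forall>\<^sub>F x in nhds 0. of_real (M x $ i $ j) = F (cp x)))"

definition V :: "complex \<times> complex \<Rightarrow> complex" where
  "V q = Lc 1 1 q + Lc 2 2 q"

definition U :: "complex \<times> complex \<Rightarrow> complex" where
  "U q = Lc 1 2 q * Lc 2 1 q - Lc 1 1 q * Lc 2 2 q"

definition D :: "complex \<times> complex \<Rightarrow> complex" where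
  "D q = (V q)\<^sup>2 + 4 * U q"

lemma Lc: "hol2 (Lc i j) 0" "\<forall>\<^sub>F x in nhds 0. of_real (M x $ i $ j) = Lc i j (cp x)"
proof -
  let ?P = "\<lambda>F. hol2 F 0 \<and> (\<forall>\<^sub>F x in nhds 0. of_real (M x $ i $ j) = F (cp x))"
  obtain F where "hol2 F 0" "\<forall>\<^sub>F x in nhds 0. of_real (M x $ i $ j) = F (cp x)"
    by (rule real_analytic_at_hol2E[OF an[of i j], unfolded cp_0]) (rule that)
  then have "?P F" by (rule conjI)
  then have P: "?P (Lc i j)" unfolding Lc_def by (rule someI[where P = ?P])
  show "hol2 (Lc i j) 0" by (rule conjunct1[OF P])
  show "\<forall>\<^sub>F x in nhds 0. of_real (M x $ i $ j) = Lc i j (cp x)" by (rule conjunct2[OF P])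
qed

lemma Lc_at_0: "Lc i j 0 = of_real (M 0 $ i $ j)"
  using eventually_nhds_x_imp_x[OF Lc(2)[of i j]] by simp

lemma hol2_V: "hol2 V 0" and hol2_U: "hol2 U 0"
  unfolding V_def[abs_def] U_def[abs_def] by (intro hol2_add hol2_diff hol2_mult Lc)+

lemma hol2_D: "hol2 D 0"
  unfolding D_def[abs_def] by (intro hol2_add hol2_power hol2_mult hol2_const hol2_V hol2_U)

lemma real_values:
  "\<forall>\<^sub>F x in nhds 0. of_real (tr x) = V (cp x)"
  "\<forall>\<^sub>F x in nhds 0. of_real (nu x) = U (cp x)"
  "\<forall>\<^sub>F x in nhds 0. of_real (disc x) = D (cp x)"
proof -
  have 1: "\<forall>\<^sub>F x in nhds 0. of_real (tr x) = V (cp x) \<and> of_real (nu x) = U (cp x) \<and> of_real (disc x) = D (cp x)"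
    using Lc(2)[of 1 1] Lc(2)[of 1 2] Lc(2)[of 2 1] Lc(2)[of 2 2]
    by eventually_elim (simp add: disc_def tr_def nu_def V_def U_def D_def)
  show "\<forall>\<^sub>F x in nhds 0. of_real (tr x) = V (cp x)"
    "\<forall>\<^sub>F x in nhds 0. of_real (nu x) = U (cp x)"
    "\<forall>\<^sub>F x in nhds 0. of_real (disc x) = D (cp x)"
    using 1 by (auto elim: eventually_mono)
qed

lemma L12_nz: "\<forall>\<^sub>F q in nhds 0. Lc 1 2 q \<noteq> 0"
proof -
  have "\<forall>\<^sub>F q in nhds 0. Lc 1 2 q \<in> - {0}"
    by (rule eventually_nhds_isCont[OF hol2_isCont[OF Lc(1)]])
      (intro eventually_nhds_in_open; use m12 in \<open>auto simp: Lc_at_0\<close>)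
  then show ?thesis by eventually_elim simp
qed

text \<open>The difference of the two sides is holomorphic and vanishes at real points, so it
  vanishes as a germ.\<close>

lemma complex_equations:
  "\<forall>\<^sub>F q in nhds 0. Lc 1 2 q * dz V q = Lc 1 1 q * dw V q + dw U q"
  "\<forall>\<^sub>F q in nhds 0. Lc 2 1 q * dw V q = Lc 2 2 q * dz V q + dz U q"
proof -
  have V: "\<forall>\<^sub>F x in nhds 0. tr differentiable at x \<and> dz V (cp x) = of_real (pdiff 1 tr x) \<and> dw V (cp x) = of_real (pdiff 2 tr x)"
    by (rule hol2_extension_derivs) (simp_all add: hol2_V real_values)
  have U: "\<forall>\<^sub>F x in nhds 0. nu differentiable at x \<and> dz U (cp x) = of_real (pdiff 1 nu x) \<and> dw U (cp x) = of_real (pdiff 2 nu x)"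
    by (rule hol2_extension_derivs) (simp_all add: hol2_U real_values)
  have "\<forall>\<^sub>F q in nhds 0. Lc 1 2 q * dz V q - (Lc 1 1 q * dw V q + dw U q) = 0"
  proof (rule hol2_zero_on_cp)
    show "hol2 (\<lambda>q. Lc 1 2 q * dz V q - (Lc 1 1 q * dw V q + dw U q)) 0"
      by (intro hol2_diff hol2_add hol2_mult hol2_derivs Lc hol2_V hol2_U)
    show "\<forall>\<^sub>F x in nhds 0. Lc 1 2 (cp x) * dz V (cp x) - (Lc 1 1 (cp x) * dw V (cp x) + dw U (cp x)) = 0"
      using V U e1[folded tr_def nu_def] Lc(2)[of 1 1] Lc(2)[of 1 2]
    proof eventually_elim
      case (elim x)
      have "M x $ 1 $ 2 * pdiff 1 tr x = M x $ 1 $ 1 * pdiff 2 tr x + pdiff 2 nu x"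
        using elim(3) by (simp only: tr_def[abs_def] nu_def[abs_def])
      from arg_cong[OF this, of complex_of_real, unfolded of_real_mult of_real_add elim(4,5)]
      show ?case using elim(1,2) by simp
    qed
  qed
  then show "\<forall>\<^sub>F q in nhds 0. Lc 1 2 q * dz V q = Lc 1 1 q * dw V q + dw U q" by eventually_elim simp
  have "\<forall>\<^sub>F q in nhds 0. Lc 2 1 q * dw V q - (Lc 2 2 q * dz V q + dz U q) = 0"
  proof (rule hol2_zero_on_cp)
    show "hol2 (\<lambda>q. Lc 2 1 q * dw V q - (Lc 2 2 q * dz V q + dz U q)) 0"
      by (intro hol2_diff hol2_add hol2_mult hol2_derivs Lc hol2_V hol2_U)
    show "\<forall>\<^sub>F x in nhds 0. Lc 2 1 (cp x) * dw V (cp x) - (Lc 2 2 (cp x) * dz V (cp x) + dz U (cp x)) = 0"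
      using V U e2[folded tr_def nu_def] Lc(2)[of 2 1] Lc(2)[of 2 2]
    proof eventually_elim
      case (elim x)
      have "M x $ 2 $ 1 * pdiff 2 tr x = M x $ 2 $ 2 * pdiff 1 tr x + pdiff 1 nu x"
        using elim(3) by (simp only: tr_def[abs_def] nu_def[abs_def])
      from arg_cong[OF this, of complex_of_real, unfolded of_real_mult of_real_add elim(4,5)]
      show ?case using elim(1,2) by simp
    qed
  qed
  then show "\<forall>\<^sub>F q in nhds 0. Lc 2 1 q * dw V q = Lc 2 2 q * dz V q + dz U q" by eventually_elim simp
qed

text \<open>Elimination of \<open>dz V\<close> and \<open>dz U\<close>. The slope is (\<lambda> -
  l22) / l12 at the double eigenvalue \<lambda> = v / 2, and the remaining term is a multiple of
  \<open>D\<close> itself, so that zeros of \<open>D\<close> propagate along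
  characteristics.\<close>

lemma disc_transport:
  "\<forall>\<^sub>F q in nhds 0. dz D q = ((Lc 1 1 q - Lc 2 2 q) / (2 * Lc 1 2 q)) * dw D q + (dw V q / Lc 1 2 q) * D q"
  using complex_equations L12_nz hol2_V[unfolded hol2_iff_cdiff] hol2_U[unfolded hol2_iff_cdiff]
proof eventually_elim
  case (elim q)
  note sq = cdiff_mult[OF elim(4,4)]
  note u4 = cdiff_mult[OF conjunct1[OF cdiff_const[of 4 q]] elim(5)]
  note all = cdiff_add[OF conjunct1[OF sq] conjunct1[OF u4]]
  have DD: "D = (\<lambda>q. V q * V q + 4 * U q)" by (simp add: D_def fun_eq_iff power2_eq_square)
  have d: "dz D q = 2 * V q * dz V q + 4 * dz U q" "dw D q = 2 * V q * dw V q + 4 * dw U q"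
    unfolding DD using all sq u4 cdiff_const[of 4 q] by simp_all
  have "2 * Lc 1 2 q * dz D q = 4 * V q * (Lc 1 2 q * dz V q) + 8 * (Lc 1 2 q * dz U q)"
    unfolding d by (simp add: algebra_simps)
  also have "Lc 1 2 q * dz U q = Lc 1 2 q * Lc 2 1 q * dw V q - Lc 2 2 q * (Lc 1 2 q * dz V q)"
    unfolding eq_diff_eq[THEN iffD2, OF trans[OF add.commute elim(2)[symmetric]]] by (simp add: algebra_simps)
  also have "4 * V q * (Lc 1 2 q * dz V q) + 8 * (Lc 1 2 q * Lc 2 1 q * dw V q - Lc 2 2 q * (Lc 1 2 q * dz V q))
      = (Lc 1 1 q - Lc 2 2 q) * dw D q + 2 * dw V q * D q"
    unfolding elim(1) d D_def V_def[of q] U_def[of q] by (simp add: algebra_simps power2_eq_square)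
  finally show ?case using elim(3) by (simp add: field_simps)
qed

text \<open>Away from the zeros of \<open>2 \<Lambda> - V\<close> the equation \<open>L\<^sup>* d\<lambda> = \<lambda> d\<lambda>\<close> follows by differentiating
  the characteristic equation; the factor \<open>2 \<Lambda> - V\<close> can be cancelled in the ring of germs.\<close>

lemma eigen_transport:
  assumes \<Lambda>: "hol2 \<Lambda> 0" and char: "\<forall>\<^sub>F q in nhds 0. (\<Lambda> q)\<^sup>2 = V q * \<Lambda> q + U q"
    and ne: "\<not> (\<forall>\<^sub>F q in nhds 0. 2 * \<Lambda> q - V q = 0)"
  shows "\<forall>\<^sub>F q in nhds 0. dz \<Lambda> q = ((\<Lambda> q - Lc 2 2 q) / Lc 1 2 q) * dw \<Lambda> q"
proof -
  define Q where "Q = (\<lambda>q. Lc 1 2 q * dz \<Lambda> q + (Lc 2 2 q - \<Lambda> q) * dw \<Lambda> q)"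
  have hQ: "hol2 Q 0" unfolding Q_def by (intro hol2_add hol2_mult hol2_diff Lc \<Lambda> hol2_derivs)
  have h2: "hol2 (\<lambda>q. 2 * \<Lambda> q - V q) 0" by (intro hol2_diff hol2_mult hol2_const \<Lambda> hol2_V)
  have char': "\<forall>\<^sub>F q in nhds 0. \<Lambda> q * \<Lambda> q = V q * \<Lambda> q + U q"
    using char by eventually_elim (simp add: power2_eq_square)
  have "\<forall>\<^sub>F q in nhds 0. (2 * \<Lambda> q - V q) * Q q = 0"
    using complex_equations char' eventually_derivs_cong0[OF char'] hol2_V[unfolded hol2_iff_cdiff]
      hol2_U[unfolded hol2_iff_cdiff] \<Lambda>[unfolded hol2_iff_cdiff]
  proof eventually_elim
    case (elim q)
    note c = elim(6-8)
    note sq = cdiff_mult[OF c(3,3)]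
    note vl = cdiff_mult[OF c(1,3)]
    note vlu = cdiff_add[OF conjunct1[OF vl] c(2)]
    have z: "(2 * \<Lambda> q - V q) * dz \<Lambda> q = \<Lambda> q * dz V q + dz U q"
      using elim(4) sq vl vlu by (simp add: algebra_simps)
    have w: "(2 * \<Lambda> q - V q) * dw \<Lambda> q = \<Lambda> q * dw V q + dw U q"
      using elim(5) sq vl vlu by (simp add: algebra_simps)
    have "(2 * \<Lambda> q - V q) * Q q = Lc 1 2 q * ((2 * \<Lambda> q - V q) * dz \<Lambda> q) + (Lc 2 2 q - \<Lambda> q) * ((2 * \<Lambda> q - V q) * dw \<Lambda> q)"
      by (simp add: Q_def algebra_simps)
    also have "\<dots> = \<Lambda> q * (Lc 1 2 q * dz V q) + Lc 1 2 q * dz U q + (Lc 2 2 q - \<Lambda> q) * (\<Lambda> q * dw V q + dw U q)"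
      unfolding z w by (simp add: algebra_simps)
    also have "Lc 1 2 q * dz U q = Lc 1 2 q * Lc 2 1 q * dw V q - Lc 2 2 q * (Lc 1 2 q * dz V q)"
      unfolding eq_diff_eq[THEN iffD2, OF trans[OF add.commute elim(2)[symmetric]]] by (simp add: algebra_simps)
    also have "\<Lambda> q * (Lc 1 2 q * dz V q) + (Lc 1 2 q * Lc 2 1 q * dw V q - Lc 2 2 q * (Lc 1 2 q * dz V q)) + (Lc 2 2 q - \<Lambda> q) * (\<Lambda> q * dw V q + dw U q)
        = dw V q * (V q * \<Lambda> q + U q - \<Lambda> q * \<Lambda> q)"
      unfolding elim(1) by (simp add: V_def[of q] U_def[of q] algebra_simps)
    also have "\<dots> = 0" using elim(3) by simp
    finally show ?case .
  qed
  from hol2_mult_eq_0[OF h2 hQ this] ne have "\<forall>\<^sub>F q in nhds 0. Q q = 0" by blast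
  with L12_nz show ?thesis
  proof eventually_elim
    case (elim q)
    then have "Lc 1 2 q * dz \<Lambda> q = (\<Lambda> q - Lc 2 2 q) * dw \<Lambda> q"
      by (simp add: Q_def algebra_simps eq_diff_eq)
    then show ?case using elim(1) by (simp add: field_simps)
  qed
qed

lemma hol2_slope: "hol2 \<Lambda> 0 \<Longrightarrow> hol2 (\<lambda>q. (\<Lambda> q - Lc 2 2 q) / Lc 1 2 q) 0"
  by (intro hol2_divide hol2_diff Lc) (use m12 in \<open>auto simp: Lc_at_0\<close>)

text \<open>A non-real eigenvalue is a holomorphic function of a local complex coordinate \<open>G\<close>, so its
  imaginary part has no strict local maxima.\<close>

lemma complex_eigenvalue_disc_constant:
  assumes neg: "disc 0 < 0" and min: "\<forall>\<^sub>F x in nhds 0. disc 0 \<le> disc x"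
  shows "\<forall>\<^sub>F x in nhds 0. disc x = disc 0"
proof -
  \<comment> \<open>\<open>- D\<close> is positive at 0, hence off the branch cut of
    \<open>csqrt\<close> nearby; at real points near 0, \<open>\<Lambda>\<close> is the eigenvalue
    with positive imaginary part.\<close>
  define s where "s = (\<lambda>q. csqrt (- D q))"
  define \<Lambda> where "\<Lambda> = (\<lambda>q. (V q + \<i> * s q) / 2)"
  have D0: "D 0 = of_real (disc 0)" using eventually_nhds_x_imp_x[OF real_values(3)] by simp
  have hs: "hol2 s 0"
    unfolding s_def
  proof (rule hol2_chain[where f = csqrt and S = "- \<real>\<^sub>\<le>\<^sub>0"])
    show "hol2 (\<lambda>q. - D q) 0" by (rule hol2_uminus[OF hol2_D])
    show "csqrt holomorphic_on - \<real>\<^sub>\<le>\<^sub>0"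
      by (rule holomorphic_on_csqrt)
    show "- D 0 \<in> - \<real>\<^sub>\<le>\<^sub>0" using neg by (auto simp: D0 complex_nonpos_Reals_iff)
  qed (simp add: open_Compl)
  have h\<Lambda>: "hol2 \<Lambda> 0"
    unfolding \<Lambda>_def by (intro hol2_divide hol2_add hol2_mult hol2_const hs hol2_V) auto
  have s2: "s q * s q = - D q" for q
    unfolding s_def power2_eq_square[symmetric] by simp
  have char: "(\<Lambda> q)\<^sup>2 = V q * \<Lambda> q + U q" for q
  proof -
    have "4 * ((\<Lambda> q)\<^sup>2 - V q * \<Lambda> q - U q) = - (s q * s q) - V q * V q - 4 * U q"
      by (simp add: \<Lambda>_def power2_eq_square field_simps)
    also have "\<dots> = 0" unfolding s2 by (simp add: D_def power2_eq_square)
    finally have "(\<Lambda> q)\<^sup>2 - V q * \<Lambda> q - U q = 0"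
      by (metis mult_eq_0_iff zero_neq_numeral)
    then show ?thesis by (simp add: algebra_simps)
  qed
  have s0: "s 0 = of_real (sqrt (- disc 0))"
    unfolding s_def D0 of_real_minus[symmetric] using neg by (intro of_real_sqrt[symmetric]) simp
  have ne: "\<not> (\<forall>\<^sub>F q in nhds 0. 2 * \<Lambda> q - V q = 0)"
  proof
    assume "\<forall>\<^sub>F q in nhds 0. 2 * \<Lambda> q - V q = 0"
    from eventually_nhds_x_imp_x[OF this] show False using neg by (simp add: \<Lambda>_def s0)
  qed
  define A where "A = (\<lambda>q. (\<Lambda> q - Lc 2 2 q) / Lc 1 2 q)"
  have hA: "hol2 A 0" unfolding A_def by (rule hol2_slope[OF h\<Lambda>])
  have pde: "\<forall>\<^sub>F q in nhds 0. dz \<Lambda> q = A q * dw \<Lambda> q"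
    unfolding A_def by (rule eigen_transport[OF h\<Lambda> _ ne]) (simp add: char)
  obtain G where G: "hol2 G 0" "G 0 = 0" "dw G 0 = 1" "\<forall>\<^sub>F q in nhds 0. dz G q = A q * dw G q"
    and hom: "\<forall>\<^sub>F q in nhds 0. \<Lambda> q = \<Lambda> (0, G q)"
    using transport[OF hA] h\<Lambda> pde by blast
  define f where "f = (\<lambda>w. \<Lambda> (0, w))"
  obtain r where r: "r > 0" "\<And>z w. norm z < r \<Longrightarrow> norm w < r \<Longrightarrow> cdiff \<Lambda> (z, w)"
    by (rule hol2_bidisc[OF h\<Lambda>]) (rule that)
  have fh: "f holomorphic_on ball 0 r"
    unfolding f_def by (rule cdiff_holomorphic_snd) (use r in auto)
  define g :: "real^2 \<Rightarrow> real^2" where "g = (\<lambda>x. vector [Re (G (cp x)), Im (G (cp x))])"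
  have gan: "real_analytic_at g 0"
  proof -
    have "real_analytic_at (\<lambda>x. Re (G (cp x))) 0" "real_analytic_at (\<lambda>x. Im (G (cp x))) 0"
      by (rule real_analytic_at_bounded_linear[OF bounded_linear_Re] real_analytic_at_bounded_linear[OF bounded_linear_Im],
          use G(1) in \<open>auto simp: real_analytic_at_iff_hol2\<close>)+
    then show ?thesis by (simp add: real_analytic_at_vec2_iff forall_2 g_def)
  qed
  have g0: "g 0 = 0" by (simp add: g_def G vec_eq_iff forall_2)
  \<comment> \<open>The derivative of \<open>G\<close> at 0 is \<open>(A 0, 1)\<close>, so the
    Jacobian of its real and imaginary parts is \<open>- Im (A 0)\<close>. This is nonzero because
    \<open>A 0\<close> is a real affine function, with slope \<open>1 / M 0 $ 1 $ 2\<close>, of a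
    non-real eigenvalue.\<close>
  have jd: "jdet g 0 \<noteq> 0"
  proof -
    have dG: "((\<lambda>x. G (cp x)) has_derivative (\<lambda>h. A 0 * of_real (h$1) + of_real (h$2))) (at 0)"
      using hol2_cp_has_derivative[of G 0] hol2_at[OF G(1)] eventually_nhds_x_imp_x[OF G(4)] G(3) by simp
    have p: "pdiff i (\<lambda>x. Re (G (cp x))) 0 = Re (A 0 * of_real (axis i 1 $ 1) + of_real (axis i 1 $ 2))"
      "pdiff i (\<lambda>x. Im (G (cp x))) 0 = Im (A 0 * of_real (axis i 1 $ 1) + of_real (axis i 1 $ 2))" for i
      by (rule has_derivative_pdiff[OF bounded_linear.has_derivative[OF bounded_linear_Re dG]]
          has_derivative_pdiff[OF bounded_linear.has_derivative[OF bounded_linear_Im dG]])+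
    have "jdet g 0 = - Im (A 0)"
      by (simp add: jdet_def g_def p axis_def)
    moreover have "V 0 = of_real (tr 0)" using eventually_nhds_x_imp_x[OF real_values(1)] by simp
    then have "A 0 = Complex ((tr 0 / 2 - M 0 $ 2 $ 2) / M 0 $ 1 $ 2) (sqrt (- disc 0) / 2 / M 0 $ 1 $ 2)"
      by (simp add: A_def \<Lambda>_def s0 Lc_at_0 complex_eq_iff)
    ultimately show ?thesis using neg m12 by simp
  qed
  have ImL: "\<forall>\<^sub>F x in nhds 0. disc x < 0 \<and> Im (\<Lambda> (cp x)) = sqrt (- disc x) / 2"
  proof -
    have "\<forall>\<^sub>F x in nhds 0. D (cp x) \<in> {w. Re w < 0}"
    proof (rule eventually_nhds_isCont[where f = "\<lambda>x. D (cp x)"])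
      show "isCont (\<lambda>x. D (cp x)) 0"
        by (rule isCont_o2[OF isCont_cp]) (simp add: hol2_isCont[OF hol2_D])
      show "\<forall>\<^sub>F w in nhds (D (cp 0)). w \<in> {w. Re w < 0}"
        by (rule eventually_nhds_in_open[OF open_halfspace_Re_lt]) (use neg in \<open>simp add: D0\<close>)
    qed
    with real_values(1,3) show ?thesis
    proof eventually_elim
      case (elim x)
      have "disc x < 0" using elim(3) by (simp flip: elim(2))
      moreover have "s (cp x) = of_real (sqrt (- disc x))"
        unfolding s_def elim(2)[symmetric] of_real_minus[symmetric]
        using calculation by (intro of_real_sqrt[symmetric]) simp
      ultimately show ?case by (simp add: \<Lambda>_def flip: elim(1))
    qed
  qed
  have "isCont (\<lambda>x. G (cp x)) 0" by (rule isCont_o2[OF isCont_cp]) (simp add: hol2_isCont G)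
  then have Gr: "\<forall>\<^sub>F x in nhds 0. G (cp x) \<in> ball 0 \<rho>" if "\<rho> > 0" for \<rho>
    by (rule eventually_nhds_isCont) (intro eventually_nhds_in_open; use that G(2) in auto)
  have "\<forall>\<^sub>F q in nhds (cp 0). \<Lambda> q = f (G q)" using hom by (simp add: f_def)
  from ImL min eventually_cp[OF this]
  have "\<forall>\<^sub>F x in nhds 0. disc x < 0 \<and> Im (\<Lambda> (cp x)) = sqrt (- disc x) / 2 \<and> disc 0 \<le> disc x \<and> \<Lambda> (cp x) = f (G (cp x))"
    by eventually_elim simp
  then obtain W where W: "open W" "0 \<in> W" "\<And>x. x \<in> W \<Longrightarrow> disc x < 0 \<and> Im (\<Lambda> (cp x)) = sqrt (- disc x) / 2 \<and>
      disc 0 \<le> disc x \<and> \<Lambda> (cp x) = f (G (cp x))"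
    unfolding eventually_nhds by blast
  obtain P V' g' where PV: "open P" "0 \<in> P" "P \<subseteq> W" "open V'" "homeomorphism P V' g g'"
    by (rule real_analytic_local_diffeo[OF gan jd W(1,2)]) (rule that)
  have V0: "0 \<in> V'" using homeomorphism_image1[OF PV(5)] imageI[OF PV(2), of g] g0 by simp
  have z0: "(vector [0, 0] :: real^2) = 0" by (simp add: vec_eq_iff forall_2)
  have "isCont (\<lambda>w. vector [Re w, Im w] :: real^2) 0"
  proof -
    have "isCont (\<lambda>w. (vector [Re w, Im w] :: real^2) $ i) 0" for i
      using exhaust_2[of i] by (auto intro: continuous_intros)
    then have "isCont (\<lambda>w. \<chi> i. (vector [Re w, Im w] :: real^2) $ i) 0" unfolding isCont_def by (rule tendsto_vec_lambda)
    then show ?thesis by simp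
  qed
  then have "\<forall>\<^sub>F w in nhds 0. (vector [Re w, Im w] :: real^2) \<in> V'"
    by (rule eventually_nhds_isCont) (rule eventually_nhds_in_open[OF PV(4)], use V0 z0 in simp)
  then obtain \<rho>0 where \<rho>0: "\<rho>0 > 0" "\<And>w. norm w < \<rho>0 \<Longrightarrow> (vector [Re w, Im w] :: real^2) \<in> V'"
    unfolding eventually_nhds_metric by auto
  define \<rho> where "\<rho> = min r \<rho>0"
  have \<rho>: "\<rho> > 0" "\<rho> \<le> r" "\<rho> \<le> \<rho>0" using r \<rho>0 by (auto simp: \<rho>_def)
  have f\<rho>: "f holomorphic_on ball 0 \<rho>" by (rule holomorphic_on_subset[OF fh]) (use \<rho> in auto)
  have Imf0: "Im (f 0) = sqrt (- disc 0) / 2"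
  proof -
    have "\<Lambda> (cp 0) = f (G (cp 0))" "Im (\<Lambda> (cp 0)) = sqrt (- disc 0) / 2" using W(3)[OF W(2)] by blast+
    then show ?thesis using G(2) by simp
  qed
  \<comment> \<open>\<open>Im \<Lambda>\<close> is \<open>sqrt (- disc) / 2\<close> at real points,
    so a minimum of the discriminant is a maximum of \<open>Im f\<close>; every small
    \<open>w\<close> is \<open>G\<close> of a real point because \<open>g\<close> is a local
    homeomorphism.\<close>
  have Imf: "Im (f w) \<le> Im (f 0)" if "norm w < \<rho>" for w
  proof -
    have "vector [Re w, Im w] \<in> g ` P" using \<rho>0(2)[of w] that \<rho> homeomorphism_image1[OF PV(5)] by auto
    then obtain x where x: "x \<in> P" "g x = vector [Re w, Im w]" by auto
    have "G (cp x) = w" using x(2) by (simp add: g_def vec_eq_iff forall_2 complex_eq_iff)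
    moreover have "x \<in> W" using x(1) PV(3) by blast
    ultimately have "Im (f w) = sqrt (- disc x) / 2" "disc 0 \<le> disc x" using W(3)[of x] by auto
    moreover have "Im (f 0) = sqrt (- disc 0) / 2" by (rule Imf0)
    moreover have "sqrt (- disc x) \<le> sqrt (- disc 0)" using calculation(2) by simp
    ultimately show ?thesis by linarith
  qed
  have "f constant_on ball 0 \<rho>"
  proof (rule ccontr)
    assume "\<not> f constant_on ball 0 \<rho>"
    then have "open (f ` ball 0 \<rho>)"
      by (intro open_mapping_thm[OF f\<rho>]) auto
    moreover have "f 0 \<in> f ` ball 0 \<rho>" using \<rho> by auto
    ultimately obtain e where e: "e > 0" "ball (f 0) e \<subseteq> f ` ball 0 \<rho>" using open_contains_ball by blast
    have "f 0 + \<i> * of_real (e / 2) \<in> ball (f 0) e" using e(1) by (simp add: dist_norm norm_mult)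
    then obtain w where "norm w < \<rho>" "f w = f 0 + \<i> * of_real (e / 2)" using e(2) by (auto simp: image_iff subset_iff)
    with Imf[of w] e(1) show False by simp
  qed
  then have fc: "f w = f 0" if "norm w < \<rho>" for w
    using that \<rho>(1) unfolding constant_on_def by auto
  show ?thesis
    using eventually_nhds_in_open[OF W(1,2)] Gr[OF \<rho>(1)]
  proof eventually_elim
    case (elim x)
    have "\<Lambda> (cp x) = f (G (cp x))" "Im (\<Lambda> (cp x)) = sqrt (- disc x) / 2" using W(3)[OF elim(1)] by blast+
    then have "sqrt (- disc x) / 2 = sqrt (- disc 0) / 2"
      using fc[of "G (cp x)"] elim(2) Imf0 by simp
    then show ?case by simp
  qed
qed

end

section \<open>Factorisation at a zero in one variable\<close>

lemma holomorphic_factor: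
  assumes f: "f holomorphic_on ball 0 r" "r > 0" and f0: "f (0::complex) = 0"
    and nz: "\<not> (\<forall>\<^sub>F w in nhds 0. f w = 0)"
  obtains m e \<rho> where "m > 0" "0 < \<rho>" "\<rho> \<le> r" "e holomorphic_on ball 0 \<rho>"
    "\<And>w. norm w < \<rho> \<Longrightarrow> f w = w ^ m * e w" "\<And>w. norm w < \<rho> \<Longrightarrow> e w \<noteq> 0"
proof -
  have "\<not> f constant_on ball 0 r"
  proof
    assume "f constant_on ball 0 r"
    then have "f w = 0" if "w \<in> ball 0 r" for w
      using f0 f(2) that unfolding constant_on_def by auto
    then have "\<forall>\<^sub>F w in nhds 0. f w = 0"
      using eventually_nhds_in_open[of "ball 0 r" 0] f(2) by (auto elim: eventually_mono)
    with nz show False by blast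
  qed
  then obtain g \<rho> n where g: "0 < n" "0 < \<rho>" "ball 0 \<rho> \<subseteq> ball (0::complex) r" "g holomorphic_on ball 0 \<rho>"
    "\<And>w. w \<in> ball 0 \<rho> \<Longrightarrow> f w = (w - 0) ^ n * g w" "\<And>w. w \<in> ball 0 \<rho> \<Longrightarrow> g w \<noteq> 0"
    using holomorphic_factor_zero_nonconstant[OF f(1) open_ball connected_ball, of 0] f0 f(2) by (metis centre_in_ball)
  define \<rho>' where "\<rho>' = min \<rho> r"
  show ?thesis
    by (rule that[of n \<rho>' g]) (use g f(2) in \<open>auto simp: \<rho>'_def intro: holomorphic_on_subset\<close>)
qed

lemma holomorphic_nonzero_near:
  assumes f: "f holomorphic_on ball 0 r" "r > 0" and nz: "\<not> (\<forall>\<^sub>F w in nhds (0::complex). f w = 0)"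
  shows "\<forall>\<^sub>F w in nhds 0. w \<noteq> 0 \<longrightarrow> f w \<noteq> 0"
proof (cases "f 0 = 0")
  case True
  obtain m e \<rho> where "m > 0" "0 < \<rho>" "\<rho> \<le> r" "e holomorphic_on ball 0 \<rho>"
    "\<And>w. norm w < \<rho> \<Longrightarrow> f w = w ^ m * e w" "\<And>w. norm w < \<rho> \<Longrightarrow> e w \<noteq> 0"
    by (rule holomorphic_factor[OF f True nz]) (rule that)
  then show ?thesis unfolding eventually_nhds_metric by (intro exI[of _ \<rho>]) auto
next
  case False
  have "isCont f 0"
    using holomorphic_on_imp_continuous_on[OF f(1)] f(2) by (simp add: continuous_on_eq_continuous_at)
  then have "\<forall>\<^sub>F w in nhds 0. f w \<in> - {0}"
    by (rule eventually_nhds_isCont) (intro eventually_nhds_in_open; use False in auto)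
  then show ?thesis by eventually_elim simp
qed

text \<open>At real points \<open>e\<close> is real: for nonzero \<open>t\<close> by dividing by
  \<open>t ^ m\<close>, at 0 by continuity. The product with \<open>Re (e 0)\<close> expresses that
  \<open>Re e\<close> keeps its sign, without specifying the sign.\<close>

lemma holomorphic_factor_real:
  assumes f: "f holomorphic_on ball 0 r" "r > 0" and f0: "f (0::complex) = 0"
    and nz: "\<not> (\<forall>\<^sub>F w in nhds 0. f w = 0)"
    and re: "\<And>t. \<bar>t\<bar> < r \<Longrightarrow> Im (f (of_real t)) = 0"
  obtains m e \<rho> where "m > 0" "0 < \<rho>" "\<rho> \<le> r" "e holomorphic_on ball 0 \<rho>"
    "\<And>w. norm w < \<rho> \<Longrightarrow> f w = w ^ m * e w" "\<And>t. \<bar>t\<bar> < \<rho> \<Longrightarrow> Im (e (of_real t)) = 0"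
    "\<And>w. norm w < \<rho> \<Longrightarrow> 0 < Re (e 0) * Re (e w)"
proof -
  obtain m e \<rho> where e: "m > 0" "0 < \<rho>" "\<rho> \<le> r" "e holomorphic_on ball 0 \<rho>"
    "\<And>w. norm w < \<rho> \<Longrightarrow> f w = w ^ m * e w" "\<And>w. norm w < \<rho> \<Longrightarrow> e w \<noteq> 0"
    by (rule holomorphic_factor[OF f f0 nz]) (rule that)
  have ec: "isCont e 0"
    using holomorphic_on_imp_continuous_on[OF e(4)] e(2) by (simp add: continuous_on_eq_continuous_at)
  have im: "Im (e (of_real t)) = 0" if "\<bar>t\<bar> < \<rho>" "t \<noteq> 0" for t
  proof -
    have "f (of_real t) = of_real (t ^ m) * e (of_real t)" using e(5)[of "of_real t"] that by simp
    then have "t ^ m * Im (e (of_real t)) = 0" using re[of t] that e(3) by simp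
    then show ?thesis using that by simp
  qed
  have "((\<lambda>t. Im (e (of_real t))) \<longlongrightarrow> Im (e (of_real 0))) (at (0::real))"
  proof -
    have "isCont (\<lambda>t. e (complex_of_real t)) 0"
      by (rule isCont_o2[where f = complex_of_real and g = e]) (use ec in \<open>auto intro: continuous_intros\<close>)
    then show ?thesis unfolding isCont_def by (rule tendsto_Im)
  qed
  moreover have "\<forall>\<^sub>F t in at (0::real). Im (e (of_real t)) = 0"
    unfolding eventually_at using im e(2) by (intro exI[of _ \<rho>]) auto
  then have "((\<lambda>t. Im (e (of_real t))) \<longlongrightarrow> 0) (at (0::real))" by (rule tendsto_eventually)
  ultimately have im0: "Im (e 0) = 0" using tendsto_unique[OF at_neq_bot] by fastforce
  have re0: "Re (e 0) \<noteq> 0" using im0 e(6)[of 0] e(2) by (auto simp: complex_eq_iff)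
  have "isCont (\<lambda>w. Re (e 0) * Re (e w)) 0" using ec by (intro continuous_mult continuous_const isCont_Re)
  then have "\<forall>\<^sub>F w in nhds 0. Re (e 0) * Re (e w) \<in> {0<..}"
    by (rule eventually_nhds_isCont) (intro eventually_nhds_in_open; use re0 in \<open>auto simp: zero_less_mult_iff\<close>)
  then obtain d where d: "d > 0" "\<And>w. norm w < d \<Longrightarrow> 0 < Re (e 0) * Re (e w)"
    unfolding eventually_nhds_metric by auto
  define \<rho>' where "\<rho>' = min d \<rho>"
  have im': "Im (e (of_real t)) = 0" if "\<bar>t\<bar> < \<rho>" for t using im[OF that] im0 by (cases "t = 0") auto
  show ?thesis
    by (rule that[of m \<rho>' e]) (use e d im' in \<open>auto simp: \<rho>'_def intro: holomorphic_on_subset\<close>)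
qed

lemma hol2_slice:
  assumes "hol2 F 0"
  obtains r where "r > 0" "(\<lambda>w. F (0, w)) holomorphic_on ball 0 r"
proof -
  obtain r where r: "r > 0" "\<And>z w. norm z < r \<Longrightarrow> norm w < r \<Longrightarrow> cdiff F (z, w)"
    by (rule hol2_bidisc[OF assms]) (rule that)
  have "(\<lambda>w. F (0, w)) holomorphic_on ball 0 r"
    by (rule cdiff_holomorphic_snd) (use r in auto)
  with r(1) show ?thesis by (rule that)
qed

lemma hol2_eventually_0:
  assumes "hol2 G 0" "G 0 = 0" "\<forall>\<^sub>F w in nhds (0::complex). P w"
  shows "\<forall>\<^sub>F q in nhds 0. P (G q)"
  by (rule eventually_nhds_isCont[OF hol2_isCont[OF assms(1)]]) (simp add: assms)

lemma cp_vector: "cp (vector [s, t]) = (of_real s, of_real t)"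
  by (simp add: cp_def)

text \<open>The real points of the slice \<open>z = 0\<close>, on which the characteristic
  coordinate is the variable itself; sign and reality information about the one-variable functions
  is taken from there.\<close>

lemma eventually_nhds_vector:
  assumes "\<forall>\<^sub>F x in nhds (0::real^2). P x"
  obtains d where "d > 0" "\<And>t. \<bar>t\<bar> < d \<Longrightarrow> P (vector [0, t])"
proof -
  obtain d where d: "d > 0" "\<And>x. norm x < d \<Longrightarrow> P x"
    using assms unfolding eventually_nhds_metric by auto
  have "P (vector [0, t])" if "\<bar>t\<bar> < d" for t
  proof (rule d(2))
    have "norm (vector [0, t] :: real^2) \<le> \<bar>t\<bar>"
      using norm_le_l1_cart[of "vector [0, t] :: real^2"] by (simp add: sum_2)
    with that show "norm (vector [0, t] :: real^2) < d" by simp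
  qed
  with d(1) show ?thesis by (rule that)
qed

section \<open>Square root of the discriminant and the two eigenvalue branches\<close>

context nijenhuis_germ
begin

lemma D_0: "D 0 = of_real (disc 0)" and V_0: "V 0 = of_real (tr 0)"
  using eventually_nhds_x_imp_x[OF real_values(3)] eventually_nhds_x_imp_x[OF real_values(1)] by simp_all

lemma D_not_zero:
  assumes "\<not> (\<forall>\<^sub>F x in nhds 0. disc x = 0)"
  shows "\<not> (\<forall>\<^sub>F q in nhds 0. D q = 0)"
proof
  assume "\<forall>\<^sub>F q in nhds 0. D q = 0"
  then have "\<forall>\<^sub>F x in nhds 0. D (cp x) = 0" by (intro eventually_cp) simp
  with real_values(3) have "\<forall>\<^sub>F x in nhds 0. disc x = 0" by eventually_elim (metis of_real_eq_0_iff)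
  with assms show False by blast
qed

text \<open>The zero set of the discriminant is a single characteristic curve, along which the order of
  vanishing is constant; semidefiniteness makes this order even.\<close>

lemma disc_sqrt:
  assumes d0: "disc 0 = 0" and pos: "\<forall>\<^sub>F x in nhds 0. 0 \<le> disc x"
    and ne: "\<not> (\<forall>\<^sub>F x in nhds 0. disc x = 0)"
  obtains S where "hol2 S 0" "\<forall>\<^sub>F q in nhds 0. (S q)\<^sup>2 = D q"
proof -
  define A where "A = (\<lambda>q. (Lc 1 1 q - Lc 2 2 q) / (2 * Lc 1 2 q))"
  define B where "B = (\<lambda>q. dw V q / Lc 1 2 q)"
  have hA: "hol2 A 0" unfolding A_def
    by (intro hol2_divide hol2_diff hol2_mult hol2_const Lc) (use m12 in \<open>auto simp: Lc_at_0\<close>)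
  have hB: "hol2 B 0" unfolding B_def
    by (intro hol2_divide hol2_derivs hol2_V Lc) (use m12 in \<open>auto simp: Lc_at_0\<close>)
  have "\<forall>\<^sub>F q in nhds 0. dz D q = A q * dw D q + B q * D q"
    unfolding A_def B_def by (rule disc_transport)
  then obtain G H where G: "hol2 G 0" "G 0 = 0" and H: "hol2 H 0"
    and DG: "\<forall>\<^sub>F q in nhds 0. D q = D (0, G q) * exp (H q)"
    using transport[OF hA] hol2_D hB by blast
  define d where "d = (\<lambda>w. D (0, w))"
  obtain r0 where r0: "r0 > 0" "d holomorphic_on ball 0 r0"
    unfolding d_def by (rule hol2_slice[OF hol2_D]) (erule (1) that[unfolded d_def])
  have dn: "\<not> (\<forall>\<^sub>F w in nhds 0. d w = 0)"
  proof
    assume "\<forall>\<^sub>F w in nhds 0. d w = 0"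
    from hol2_eventually_0[OF G this] DG have "\<forall>\<^sub>F q in nhds 0. D q = 0"
      by eventually_elim (simp add: d_def)
    with D_not_zero[OF ne] show False by blast
  qed
  have "\<forall>\<^sub>F x in nhds 0. of_real (disc x) = D (cp x) \<and> 0 \<le> disc x"
    using real_values(3) pos by eventually_elim simp
  then obtain \<delta> where \<delta>: "\<delta> > 0" "\<And>t. \<bar>t\<bar> < \<delta> \<Longrightarrow> of_real (disc (vector [0, t])) = D (cp (vector [0, t])) \<and> 0 \<le> disc (vector [0, t])"
    by (rule eventually_nhds_vector) (rule that)
  have dr: "Im (d (of_real t)) = 0" "0 \<le> Re (d (of_real t))" if "\<bar>t\<bar> < \<delta>" for t
  proof -
    have "d (of_real t) = of_real (disc (vector [0, t]))" using \<delta>(2)[OF that] by (simp add: d_def cp_vector)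
    then show "Im (d (of_real t)) = 0" "0 \<le> Re (d (of_real t))" using conjunct2[OF \<delta>(2)[OF that]] by simp_all
  qed
  define r where "r = min r0 \<delta>"
  have r: "r > 0" "r \<le> r0" "r \<le> \<delta>" using r0 \<delta> by (auto simp: r_def)
  have dh: "d holomorphic_on ball 0 r" by (rule holomorphic_on_subset[OF r0(2)]) (use r in auto)
  have dd0: "d 0 = 0" using D_0 d0 by (simp add: d_def zero_prod_def)
  have dr': "Im (d (of_real t)) = 0" if "\<bar>t\<bar> < r" for t
    by (rule dr(1)) (use that r in simp)
  obtain m e \<rho> where e: "m > 0" "0 < \<rho>" "\<rho> \<le> r" "e holomorphic_on ball 0 \<rho>"
    "\<And>w. norm w < \<rho> \<Longrightarrow> d w = w ^ m * e w" "\<And>t. \<bar>t\<bar> < \<rho> \<Longrightarrow> Im (e (of_real t)) = 0"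
    "\<And>w. norm w < \<rho> \<Longrightarrow> 0 < Re (e 0) * Re (e w)"
    by (rule holomorphic_factor_real[OF dh r(1) dd0 dn dr']) (assumption, rule that)
  have "even m"
  proof (rule ccontr)
    assume odd: "odd m"
    define t where "t = \<rho> / 2"
    have t: "0 < t" "\<bar>t\<bar> < \<rho>" "\<bar>- t\<bar> < \<rho>" "\<bar>t\<bar> < \<delta>" using e(2,3) r by (auto simp: t_def)
    have "d (of_real t) = of_real (t ^ m) * e (of_real t)" using e(5)[of "of_real t"] t by simp
    then have 1: "0 \<le> t ^ m * Re (e (of_real t))" using dr(2)[of t] t by simp
    have "d (of_real (- t)) = of_real ((- t) ^ m) * e (of_real (- t))"
      using e(5)[of "of_real (- t)"] t by (simp only: norm_of_real of_real_power)
    then have 2: "0 \<le> (- t) ^ m * Re (e (of_real (- t)))" using dr(2)[of "- t"] t by (simp del: of_real_minus)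
    have p: "0 < Re (e 0) * Re (e (of_real t))" "0 < Re (e 0) * Re (e (of_real (- t)))"
      using e(7)[of "of_real t"] e(7)[of "of_real (- t)"] t by (simp_all only: norm_of_real)
    have "t ^ m > 0" using t by simp
    with 1 2 have "0 \<le> Re (e (of_real t))" "Re (e (of_real (- t))) \<le> 0"
      using odd by (auto simp: zero_le_mult_iff mult_le_0_iff simp del: of_real_minus)
    with p show False by (auto simp: zero_less_mult_iff)
  qed
  then obtain k where k: "m = 2 * k" by blast
  \<comment> \<open>Division by \<open>e 0\<close> makes the argument of \<open>csqrt\<close> equal
    to 1 at 0, off the branch cut; the constant \<open>csqrt (e 0)\<close> restores the
    value.\<close>
  define S where "S = (\<lambda>q. G q ^ k * (csqrt (e 0) * csqrt (e (G q) / e 0)) * exp (H q / 2))"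
  have e0: "e 0 \<noteq> 0" using e(7)[of 0] e(2) by auto
  have he: "hol2 (\<lambda>q. e (G q)) 0"
    by (rule hol2_chain[OF G(1) e(4)]) (use G(2) e(2) in auto)
  have "hol2 (\<lambda>q. csqrt (e (G q) / e 0)) 0"
  proof (rule hol2_chain[where f = csqrt and S = "- \<real>\<^sub>\<le>\<^sub>0"])
    show "hol2 (\<lambda>q. e (G q) / e 0) 0" by (intro hol2_divide he hol2_const e0)
    show "csqrt holomorphic_on - \<real>\<^sub>\<le>\<^sub>0" by (rule holomorphic_on_csqrt)
    show "e (G 0) / e 0 \<in> - \<real>\<^sub>\<le>\<^sub>0" using e0 G(2) by simp
  qed (simp add: open_Compl)
  moreover have "hol2 (\<lambda>q. exp (H q / 2)) 0"
    by (rule hol2_chain[where f = exp and S = UNIV]) (auto intro!: hol2_divide H hol2_const holomorphic_intros)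
  ultimately have hS: "hol2 S 0"
    unfolding S_def by (intro hol2_mult hol2_power hol2_const G)
  have "\<forall>\<^sub>F w in nhds (0::complex). norm w < \<rho>"
    using e(2) unfolding eventually_nhds_metric by auto
  from hol2_eventually_0[OF G this] DG have "\<forall>\<^sub>F q in nhds 0. (S q)\<^sup>2 = D q"
  proof eventually_elim
    case (elim q)
    have "(S q)\<^sup>2 = G q ^ m * ((csqrt (e 0))\<^sup>2 * (csqrt (e (G q) / e 0))\<^sup>2) * (exp (H q / 2))\<^sup>2"
      by (simp only: S_def power_mult_distrib k power_mult[symmetric] mult.commute[of 2 k])
    also have "\<dots> = d (G q) * exp (H q)"
      using e(5)[OF elim(1)] e0 by (simp flip: exp_double)
    finally show ?case using elim(2) by (simp add: d_def)
  qed
  with hS show ?thesis by (rule that)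
qed

text \<open>\<open>G\<close> is the characteristic coordinate of this particular branch. The branch
  is a function \<open>f\<close> of \<open>G\<close>, and \<open>S\<close> is a function
  \<open>s\<close> of \<open>G\<close> times an exponential; both \<open>s\<close> and the
  derivative of \<open>f\<close> have no zeros near 0 other than 0 itself. So the singular set is
  the curve \<open>G q = 0\<close>, on which the branch is constant, and the branch has no critical
  points off that curve. The sign \<sigma> covers both branches.\<close>

lemma eigen_branch:
  fixes \<sigma> :: complex
  assumes S: "hol2 S 0" "\<forall>\<^sub>F q in nhds 0. (S q)\<^sup>2 = D q" "S 0 = 0"
    and Sn: "\<not> (\<forall>\<^sub>F q in nhds 0. S q = 0)"
    and \<sigma>: "\<sigma> * \<sigma> = 1"
    and chi: "\<not> (\<forall>\<^sub>F x in nhds 0. (tr 0 / 2)\<^sup>2 = tr x * (tr 0 / 2) + nu x)"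
    and \<Lambda>_def: "\<Lambda> = (\<lambda>q. (V q + \<sigma> * S q) / 2)"
  obtains G :: "complex \<times> complex \<Rightarrow> complex" where "hol2 \<Lambda> 0"
    "\<forall>\<^sub>F q in nhds 0. dz \<Lambda> q = ((\<Lambda> q - Lc 2 2 q) / Lc 1 2 q) * dw \<Lambda> q"
    "\<forall>\<^sub>F q in nhds 0. (G q = 0 \<longleftrightarrow> S q = 0) \<and> (G q = 0 \<longrightarrow> \<Lambda> q = of_real (tr 0 / 2)) \<and>
       (G q \<noteq> 0 \<longrightarrow> dw \<Lambda> q \<noteq> 0)"
proof -
  define \<Lambda>' where "\<Lambda>' = (\<lambda>q. (V q + (- \<sigma>) * S q) / 2)"
  have branch: "hol2 (\<lambda>q. (V q + \<tau> * S q) / 2) 0 \<and>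
      (\<forall>\<^sub>F q in nhds 0. dz (\<lambda>q. (V q + \<tau> * S q) / 2) q =
        (((V q + \<tau> * S q) / 2 - Lc 2 2 q) / Lc 1 2 q) * dw (\<lambda>q. (V q + \<tau> * S q) / 2) q)"
    if \<tau>: "\<tau> * \<tau> = 1" for \<tau>
  proof -
    have h: "hol2 (\<lambda>q. (V q + \<tau> * S q) / 2) 0"
      by (intro hol2_divide hol2_add hol2_mult hol2_const S hol2_V) auto
    have char: "\<forall>\<^sub>F q in nhds 0. ((V q + \<tau> * S q) / 2)\<^sup>2 = V q * ((V q + \<tau> * S q) / 2) + U q"
      using S(2)
    proof eventually_elim
      case (elim q)
      have "4 * (((V q + \<tau> * S q) / 2)\<^sup>2 - (V q * ((V q + \<tau> * S q) / 2) + U q)) = (\<tau> * \<tau>) * (S q)\<^sup>2 - (V q)\<^sup>2 - 4 * U q"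
        by (simp add: power2_eq_square field_simps)
      also have "\<dots> = 0" unfolding \<tau> elim by (simp add: D_def)
      finally have "((V q + \<tau> * S q) / 2)\<^sup>2 - (V q * ((V q + \<tau> * S q) / 2) + U q) = 0"
        by (metis mult_eq_0_iff zero_neq_numeral)
      then show ?case by simp
    qed
    have "\<not> (\<forall>\<^sub>F q in nhds 0. 2 * ((V q + \<tau> * S q) / 2) - V q = 0)"
    proof
      assume "\<forall>\<^sub>F q in nhds 0. 2 * ((V q + \<tau> * S q) / 2) - V q = 0"
      then have "\<forall>\<^sub>F q in nhds 0. S q = 0"
      proof eventually_elim
        case (elim q)
        have "\<tau> * S q = 2 * ((V q + \<tau> * S q) / 2) - V q" by (simp add: field_simps)
        with elim have "\<tau> * S q = 0" by metis
        with \<tau> show ?case by auto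
      qed
      with Sn show False by blast
    qed
    from eigen_transport[OF h char this] h show ?thesis by blast
  qed
  have h\<Lambda>: "hol2 \<Lambda> 0" and pde: "\<forall>\<^sub>F q in nhds 0. dz \<Lambda> q = ((\<Lambda> q - Lc 2 2 q) / Lc 1 2 q) * dw \<Lambda> q"
    using branch[OF \<sigma>] unfolding \<Lambda>_def by auto
  have h\<Lambda>': "hol2 \<Lambda>' 0" and pde': "\<forall>\<^sub>F q in nhds 0. dz \<Lambda>' q = ((\<Lambda>' q - Lc 2 2 q) / Lc 1 2 q) * dw \<Lambda>' q"
    using branch[of "- \<sigma>"] \<sigma> unfolding \<Lambda>'_def by auto
  define A where "A = (\<lambda>q. (\<Lambda> q - Lc 2 2 q) / Lc 1 2 q)"
  define B where "B = (\<lambda>q. dw \<Lambda>' q / Lc 1 2 q)"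
  have hA: "hol2 A 0" unfolding A_def by (rule hol2_slope[OF h\<Lambda>])
  have hB: "hol2 B 0" unfolding B_def
    by (intro hol2_divide hol2_derivs h\<Lambda>' Lc) (use m12 in \<open>auto simp: Lc_at_0\<close>)
  have SL: "S = (\<lambda>q. \<sigma> * (\<Lambda> q - \<Lambda>' q))"
  proof
    fix q have "\<sigma> * (\<Lambda> q - \<Lambda>' q) = (\<sigma> * \<sigma>) * S q" by (simp add: \<Lambda>_def \<Lambda>'_def field_simps)
    then show "S q = \<sigma> * (\<Lambda> q - \<Lambda>' q)" by (simp add: \<sigma>)
  qed
  \<comment> \<open>\<open>S\<close> is \<sigma> times the difference of the branches. Their slopes
    differ by \<open>(\<Lambda> - \<Lambda>') / Lc 1 2\<close>, which is proportional to
    \<open>S\<close>; replacing the slope of \<open>\<Lambda>'\<close> by that of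
    \<open>\<Lambda>\<close> therefore costs only a term of order zero.\<close>
  have Spde: "\<forall>\<^sub>F q in nhds 0. dz S q = A q * dw S q + B q * S q"
    using pde pde' h\<Lambda>[unfolded hol2_iff_cdiff] h\<Lambda>'[unfolded hol2_iff_cdiff] L12_nz
  proof eventually_elim
    case (elim q)
    note df = cdiff_diff[OF elim(3,4)]
    note c = cdiff_mult[OF conjunct1[OF cdiff_const[of \<sigma> q]] conjunct1[OF df]]
    have d: "dz S q = \<sigma> * (dz \<Lambda> q - dz \<Lambda>' q)" "dw S q = \<sigma> * (dw \<Lambda> q - dw \<Lambda>' q)"
      unfolding SL using c df cdiff_const[of \<sigma> q] by simp_all
    have Sq: "S q = \<sigma> * (\<Lambda> q - \<Lambda>' q)" by (simp add: SL)
    show ?case unfolding d Sq elim(1,2) A_def B_def using elim(5) by (simp add: field_simps)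
  qed
  have pdeA: "\<forall>\<^sub>F q in nhds 0. dz \<Lambda> q = A q * dw \<Lambda> q" using pde by (simp add: A_def)
  obtain G where G: "hol2 G 0" "G 0 = 0" "dw G 0 = 1"
    and hom: "\<forall>\<^sub>F q in nhds 0. \<Lambda> q = \<Lambda> (0, G q)"
    and inh: "\<exists>H. hol2 H 0 \<and> (\<forall>\<^sub>F q in nhds 0. S q = S (0, G q) * exp (H q))"
    using transport[OF hA] h\<Lambda> pdeA S(1) hB Spde by blast
  obtain H where H: "\<forall>\<^sub>F q in nhds 0. S q = S (0, G q) * exp (H q)" using inh by blast
  define s where "s = (\<lambda>w. S (0, w))"
  define f where "f = (\<lambda>w. \<Lambda> (0, w))"
  have s0: "s 0 = 0" using S(3) by (simp add: s_def zero_prod_def)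
  have f0: "f 0 = of_real (tr 0 / 2)" using S(3) V_0 by (simp add: f_def \<Lambda>_def zero_prod_def)
  obtain r1 where r1: "r1 > 0" "(\<lambda>w. S (0, w)) holomorphic_on ball 0 r1"
    by (rule hol2_slice[OF S(1)]) (rule that)
  have "\<not> (\<forall>\<^sub>F w in nhds 0. s w = 0)"
  proof
    assume "\<forall>\<^sub>F w in nhds 0. s w = 0"
    from hol2_eventually_0[OF G(1,2) this] H have "\<forall>\<^sub>F q in nhds 0. S q = 0"
      by eventually_elim (simp add: s_def)
    with Sn show False by blast
  qed
  from holomorphic_nonzero_near[OF r1(2,1) this[unfolded s_def]]
  have sn: "\<forall>\<^sub>F w in nhds 0. w \<noteq> 0 \<longrightarrow> s w \<noteq> 0" by (simp add: s_def)
  obtain r2 where r2: "r2 > 0" "(\<lambda>w. \<Lambda> (0, w)) holomorphic_on ball 0 r2"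
    by (rule hol2_slice[OF h\<Lambda>]) (rule that)
  have fh: "f holomorphic_on ball 0 r2" using r2(2) by (simp add: f_def)
  have fd: "(f has_field_derivative deriv f w) (at w)" if "norm w < r2" for w
    by (rule holomorphic_derivI[OF fh open_ball]) (use that in simp)
  \<comment> \<open>Otherwise the branch is the constant \<open>tr 0 / 2\<close>, and the
    characteristic equation makes this number an eigenvalue on a neighbourhood, against
    \<open>chi\<close>.\<close>
  have "\<not> (\<forall>\<^sub>F w in nhds 0. deriv f w = 0)"
  proof
    assume "\<forall>\<^sub>F w in nhds 0. deriv f w = 0"
    then obtain d where d: "d > 0" "\<And>w. norm w < d \<Longrightarrow> deriv f w = 0"
      unfolding eventually_nhds_metric by auto
    define \<rho> where "\<rho> = min d r2"
    have \<rho>: "\<rho> > 0" "\<rho> \<le> d" "\<rho> \<le> r2" using d r2 by (auto simp: \<rho>_def)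
    have "\<exists>c. \<forall>w\<in>ball 0 \<rho>. f w = c"
    proof (rule has_field_derivative_zero_constant[OF convex_ball])
      fix w :: complex assume "w \<in> ball 0 \<rho>"
      then show "(f has_field_derivative 0) (at w within ball 0 \<rho>)"
        using fd[of w] d(2)[of w] \<rho> by (auto intro: has_field_derivative_at_within)
    qed
    then obtain c where c: "\<forall>w\<in>ball 0 \<rho>. f w = c" by blast
    have K: "f w = f 0" if "norm w < \<rho>" for w using c that \<rho>(1) by auto
    have "\<forall>\<^sub>F w in nhds 0. f w = f 0"
    proof (rule eventually_nhds_metric[THEN iffD2], intro exI[of _ \<rho>] conjI allI impI \<rho>(1))
      fix w :: complex assume "dist w 0 < \<rho>"
      then show "f w = f 0" by (intro K) simp
    qed
    from hol2_eventually_0[OF G(1,2) this] hom have "\<forall>\<^sub>F q in nhds 0. \<Lambda> q = of_real (tr 0 / 2)"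
    proof eventually_elim
      case (elim q)
      have "\<Lambda> q = f (G q)" using elim(2) by (simp add: f_def)
      then show ?case using elim(1) f0 by simp
    qed
    with S(2) have "\<forall>\<^sub>F q in nhds 0. (of_real (tr 0 / 2))\<^sup>2 = V q * of_real (tr 0 / 2) + U q"
    proof eventually_elim
      case (elim q)
      have "4 * ((\<Lambda> q)\<^sup>2 - (V q * \<Lambda> q + U q)) = (\<sigma> * \<sigma>) * (S q)\<^sup>2 - (V q)\<^sup>2 - 4 * U q"
        by (simp add: \<Lambda>_def power2_eq_square field_simps)
      also have "\<dots> = 0" unfolding \<sigma> elim(1) by (simp add: D_def)
      finally have "(\<Lambda> q)\<^sup>2 - (V q * \<Lambda> q + U q) = 0" by (metis mult_eq_0_iff zero_neq_numeral)
      then show ?case unfolding elim(2) by simp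
    qed
    then have "\<forall>\<^sub>F x in nhds 0. (of_real (tr 0 / 2))\<^sup>2 = V (cp x) * of_real (tr 0 / 2) + U (cp x)"
      by (intro eventually_cp) simp
    with real_values(1,2) have "\<forall>\<^sub>F x in nhds 0. (tr 0 / 2)\<^sup>2 = tr x * (tr 0 / 2) + nu x"
    proof eventually_elim
      case (elim x)
      from elim(3) have "complex_of_real ((tr 0 / 2)\<^sup>2) = of_real (tr x * (tr 0 / 2) + nu x)"
        unfolding elim(1)[symmetric] elim(2)[symmetric] by simp
      then show ?case by (simp only: of_real_eq_iff)
    qed
    with chi show False by blast
  qed
  from holomorphic_nonzero_near[OF holomorphic_deriv[OF fh open_ball] r2(1) this]
  have fn: "\<forall>\<^sub>F w in nhds 0. w \<noteq> 0 \<longrightarrow> deriv f w \<noteq> 0" .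
  have "\<forall>\<^sub>F q in nhds 0. dw G q \<in> - {0}"
    by (rule eventually_nhds_isCont[OF hol2_isCont[OF hol2_derivs(2)[OF G(1)]]])
      (rule eventually_nhds_in_open, use G(3) in auto)
  moreover have "\<forall>\<^sub>F w in nhds (0::complex). norm w < r2"
    using r2(1) unfolding eventually_nhds_metric by auto
  from hol2_eventually_0[OF G(1,2) this] have "\<forall>\<^sub>F q in nhds 0. norm (G q) < r2" .
  moreover have "\<forall>\<^sub>F q in nhds 0. \<Lambda> q = f (G q)" using hom by (simp add: f_def)
  note eventually_derivs_cong0(2)[OF this]
  ultimately have "\<forall>\<^sub>F q in nhds 0. (G q = 0 \<longleftrightarrow> S q = 0) \<and> (G q = 0 \<longrightarrow> \<Lambda> q = of_real (tr 0 / 2)) \<and>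
       (G q \<noteq> 0 \<longrightarrow> dw \<Lambda> q \<noteq> 0)"
    using hol2_eventually_0[OF G(1,2) sn] hol2_eventually_0[OF G(1,2) fn] H hom G(1)[unfolded hol2_iff_cdiff]
  proof eventually_elim
    case (elim q)
    have "dw \<Lambda> q = deriv f (G q) * dw G q"
      using cdiff_chain[OF elim(8) fd[OF elim(2)]] elim(3) by simp
    moreover have "S q = s (G q) * exp (H q)" "\<Lambda> q = f (G q)" using elim(6,7) by (simp_all add: s_def f_def)
    ultimately show ?case using elim(1,4,5) s0 f0 by auto
  qed
  note G_zero = this
  show ?thesis by (rule that[of G]) (rule h\<Lambda> pde G_zero)+
qed

end

section \<open>Real solutions, the normal form, and eigenvalues as local coordinates\<close>

lemma pdiff_Re_cp:
  assumes "hol2 F 0"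
  shows "\<forall>\<^sub>F x in nhds 0. pdiff 1 (\<lambda>x. Re (F (cp x))) x = Re (dz F (cp x)) \<and>
           pdiff 2 (\<lambda>x. Re (F (cp x))) x = Re (dw F (cp x))"
proof -
  have "\<forall>\<^sub>F q in nhds (cp 0). cdiff F q" using assms by (simp add: hol2_iff_cdiff)
  from eventually_cp[OF this] show ?thesis
  proof eventually_elim
    case (elim x)
    note d = bounded_linear.has_derivative[OF bounded_linear_Re hol2_cp_has_derivative[OF elim]]
    show ?case using has_derivative_pdiff[OF d, of 1] has_derivative_pdiff[OF d, of 2] by (simp add: axis_def)
  qed
qed

text \<open>The real part of \<open>G\<close> at real points has a holomorphic extension
  \<open>G'\<close>. Because the slope is real there, \<open>G'\<close> solves the same equation at
  real points, hence as a germ, with the same initial values; uniqueness gives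
  \<open>G' = G\<close>.\<close>

lemma transport_real:
  assumes A: "hol2 A 0" and Ar: "\<forall>\<^sub>F x in nhds 0. Im (A (cp x)) = 0"
    and G: "hol2 G 0" and pde: "\<forall>\<^sub>F q in nhds 0. dz G q = A q * dw G q"
    and init: "\<forall>\<^sub>F q in nhds 0. fst q = 0 \<longrightarrow> G q = snd q"
  shows "\<forall>\<^sub>F x in nhds 0. Im (G (cp x)) = 0"
proof -
  define g where "g = (\<lambda>x. Re (G (cp x)))"
  have "real_analytic_at g 0" unfolding g_def by (rule real_analytic_at_Re) (simp add: G)
  then obtain G' where G': "hol2 G' (cp 0)" "\<forall>\<^sub>F x in nhds 0. of_real (g x) = G' (cp x)"
    by (rule real_analytic_at_hol2E) (rule that)
  have hG': "hol2 G' 0" using G'(1) by simp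
  have "\<forall>\<^sub>F q in nhds 0. dz G' q - A q * dw G' q = 0"
  proof (rule hol2_zero_on_cp)
    show "hol2 (\<lambda>q. dz G' q - A q * dw G' q) 0" by (intro hol2_diff hol2_mult hol2_derivs hG' A)
    have "\<forall>\<^sub>F q in nhds (cp 0). dz G q = A q * dw G q" using pde by simp
    from hol2_extension_derivs[OF G'] pdiff_Re_cp[OF G] eventually_cp[OF this] Ar
    show "\<forall>\<^sub>F x in nhds 0. dz G' (cp x) - A (cp x) * dw G' (cp x) = 0"
    proof eventually_elim
      case (elim x)
      have "dz G' (cp x) = of_real (Re (dz G (cp x)))" "dw G' (cp x) = of_real (Re (dw G (cp x)))"
        using elim(1,2) by (simp_all add: g_def)
      then show ?case using elim(3,4) by (simp add: complex_eq_iff)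
    qed
  qed
  then have pde': "\<forall>\<^sub>F q in nhds 0. dz G' q = A q * dw G' q" by eventually_elim simp
  have "isCont (\<lambda>x. vector [0, x $ 2] :: real^2) 0"
  proof -
    have "isCont (\<lambda>x. (vector [0, x $ 2] :: real^2) $ i) 0" for i
      using exhaust_2[of i] by (auto intro: continuous_intros)
    then have "isCont (\<lambda>x. \<chi> i. (vector [0, x $ 2] :: real^2) $ i) 0" unfolding isCont_def by (rule tendsto_vec_lambda)
    then show ?thesis by simp
  qed
  moreover have "(vector [0, 0] :: real^2) = 0" by (simp add: vec_eq_iff forall_2)
  moreover have "\<forall>\<^sub>F x in nhds 0. of_real (g x) = G' (cp x) \<and> (fst (cp x) = 0 \<longrightarrow> G (cp x) = snd (cp x))"
    using G'(2) eventually_cp[where p = 0 and P = "\<lambda>q. fst q = 0 \<longrightarrow> G q = snd q"] init by (auto elim: eventually_elim2)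
  ultimately have ev: "\<forall>\<^sub>F x in nhds (0::real^2). of_real (g (vector [0, x $ 2])) = G' (cp (vector [0, x $ 2])) \<and>
      (fst (cp (vector [0, x $ 2])) = 0 \<longrightarrow> G (cp (vector [0, x $ 2])) = snd (cp (vector [0, x $ 2])))"
    using eventually_nhds_isCont[where f = "\<lambda>x. vector [0, x $ 2] :: real^2" and p = 0] by simp
  have "\<forall>\<^sub>F q in nhds (0 :: complex \<times> complex). G' (0, snd q) - snd q = 0"
  proof (rule hol2_zero_on_cp)
    show "hol2 (\<lambda>q. G' (0, snd q) - snd q) 0"
      by (intro hol2_diff hol2_snd hol2_compose[OF hol2_const hol2_snd]) (use hG' in \<open>simp add: zero_prod_def\<close>)
    show "\<forall>\<^sub>F x in nhds 0. G' (0, snd (cp x)) - snd (cp x) = 0"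
      using ev
    proof eventually_elim
      case (elim x)
      have "G (0, of_real (x $ 2)) = of_real (x $ 2)" "of_real (g (vector [0, x $ 2])) = G' (0, of_real (x $ 2))"
        using elim by (simp_all add: cp_vector)
      then show ?case by (simp add: g_def cp_vector) (simp add: cp_def)
    qed
  qed
  then have init': "\<forall>\<^sub>F q in nhds 0. fst q = 0 \<longrightarrow> G' q = snd q"
    by eventually_elim (metis eq_iff_diff_eq_0 prod.collapse)
  have "\<forall>\<^sub>F q in nhds 0. G' q - G q = 0"
  proof (rule ck_unique[OF A hol2_diff[OF hG' G]])
    show "\<forall>\<^sub>F q in nhds 0. dz (\<lambda>q. G' q - G q) q = A q * dw (\<lambda>q. G' q - G q) q"
      using hG'[unfolded hol2_iff_cdiff] G[unfolded hol2_iff_cdiff] pde pde'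
      by eventually_elim (simp add: cdiff_diff algebra_simps)
    show "\<forall>\<^sub>F q in nhds 0. fst q = 0 \<longrightarrow> G' q - G q = 0"
      using init init' by eventually_elim simp
  qed
  then have "\<forall>\<^sub>F x in nhds 0. G' (cp x) - G (cp x) = 0" by (intro eventually_cp) simp
  with G'(2) show ?thesis
  proof eventually_elim
    case (elim x)
    then have "G (cp x) = of_real (g x)" by simp
    then show ?case by simp
  qed
qed

context nijenhuis_germ
begin

text \<open>The second coordinate is an \<open>m\<close>-th root of \<open>\<plusminus> (v - 2 c)\<close>; the first one is then found by
  solving a linear first-order equation.\<close>

lemma normal_form:
  fixes c :: real
  assumes c: "c = tr 0 / 2" and ne: "\<not> (\<forall>\<^sub>F x in nhds 0. disc x = 0)"
    and chi: "\<forall>\<^sub>F x in nhds 0. c\<^sup>2 = tr x * c + nu x"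
  obtains \<Phi> :: "real^2 \<Rightarrow> real^2" and m :: nat and \<epsilon> :: real where
    "real_analytic_at \<Phi> 0" "\<Phi> 0 = 0" "jdet \<Phi> 0 \<noteq> 0" "m > 0" "\<epsilon> = 1 \<or> \<epsilon> = - 1" "odd m \<Longrightarrow> \<epsilon> = 1"
    "\<forall>\<^sub>F x in nhds 0. jacobian \<Phi> (at x) ** (M x - c *\<^sub>R mat 1) =
       (vector [vector [0, 1], vector [0, \<epsilon> * (\<Phi> x $ 2) ^ m]] :: real^2^2) ** jacobian \<Phi> (at x)"
proof -
  define C where "C = complex_of_real c"
  have "\<forall>\<^sub>F q in nhds 0. C\<^sup>2 - (V q * C + U q) = 0"
  proof (rule hol2_zero_on_cp)
    show "hol2 (\<lambda>q. C\<^sup>2 - (V q * C + U q)) 0" by (intro hol2_diff hol2_add hol2_mult hol2_const hol2_V hol2_U)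
    show "\<forall>\<^sub>F x in nhds 0. C\<^sup>2 - (V (cp x) * C + U (cp x)) = 0"
      using chi real_values(1,2)
    proof eventually_elim
      case (elim x)
      show ?case using arg_cong[OF elim(1), of complex_of_real] by (simp add: C_def flip: elim(2,3))
    qed
  qed
  then have chiC: "\<forall>\<^sub>F q in nhds 0. C\<^sup>2 = V q * C + U q" by eventually_elim simp
  \<comment> \<open>\<open>C\<close> is the constant eigenvalue and \<open>\<Lambda>\<close> the
    other one; \<tau> is their difference, and as germs \<open>D = \<tau>\<^sup>2\<close>. Differing
    from \<open>\<Lambda>\<close> by a constant, \<tau> obeys the transport equation of
    \<open>\<Lambda>\<close>.\<close>
  define \<tau> where "\<tau> = (\<lambda>q. V q - 2 * C)"
  define \<Lambda> where "\<Lambda> = (\<lambda>q. V q - C)"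
  have h\<tau>: "hol2 \<tau> 0" and h\<Lambda>: "hol2 \<Lambda> 0"
    unfolding \<tau>_def \<Lambda>_def by (intro hol2_diff hol2_V hol2_const)+
  have \<tau>0: "\<tau> 0 = 0" by (simp add: \<tau>_def V_0 C_def c)
  have \<tau>ne: "\<not> (\<forall>\<^sub>F q in nhds 0. \<tau> q = 0)"
  proof
    assume "\<forall>\<^sub>F q in nhds 0. \<tau> q = 0"
    with chiC have "\<forall>\<^sub>F q in nhds 0. D q = 0"
    proof eventually_elim
      case (elim q)
      have "D q = \<tau> q * \<tau> q - 4 * (C\<^sup>2 - (V q * C + U q))" by (simp add: D_def \<tau>_def power2_eq_square algebra_simps)
      then show ?case using elim by simp
    qed
    with D_not_zero[OF ne] show False by blast
  qed
  have pde\<Lambda>: "\<forall>\<^sub>F q in nhds 0. dz \<Lambda> q = ((\<Lambda> q - Lc 2 2 q) / Lc 1 2 q) * dw \<Lambda> q"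
  proof (rule eigen_transport[OF h\<Lambda>])
    show "\<forall>\<^sub>F q in nhds 0. (\<Lambda> q)\<^sup>2 = V q * \<Lambda> q + U q"
      using chiC by eventually_elim (simp add: \<Lambda>_def power2_eq_square algebra_simps)
    have "(\<lambda>q. 2 * \<Lambda> q - V q) = \<tau>" by (simp add: \<Lambda>_def \<tau>_def fun_eq_iff)
    then show "\<not> (\<forall>\<^sub>F q in nhds 0. 2 * \<Lambda> q - V q = 0)" using \<tau>ne by (metis (no_types, lifting) eventually_mono)
  qed
  define A where "A = (\<lambda>q. (\<Lambda> q - Lc 2 2 q) / Lc 1 2 q)"
  have hA: "hol2 A 0" unfolding A_def by (rule hol2_slope[OF h\<Lambda>])
  have pde\<tau>: "\<forall>\<^sub>F q in nhds 0. dz \<tau> q = A q * dw \<tau> q"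
    using pde\<Lambda> h\<Lambda>[unfolded hol2_iff_cdiff]
  proof eventually_elim
    case (elim q)
    have "\<tau> = (\<lambda>q. \<Lambda> q - C)" by (simp add: \<tau>_def \<Lambda>_def fun_eq_iff)
    then show ?case using cdiff_diff[OF elim(2) conjunct1[OF cdiff_const[of C q]]] cdiff_const[of C q] elim(1)
      by (simp add: A_def)
  qed
  obtain G where G: "hol2 G 0" "G 0 = 0" "dw G 0 = 1" "\<forall>\<^sub>F q in nhds 0. dz G q = A q * dw G q"
    "\<forall>\<^sub>F q in nhds 0. fst q = 0 \<longrightarrow> G q = snd q" and hom: "\<forall>\<^sub>F q in nhds 0. \<tau> q = \<tau> (0, G q)"
    using transport[OF hA] h\<tau> pde\<tau> by blast
  have Areal: "\<forall>\<^sub>F x in nhds 0. A (cp x) = of_real (((tr x - c) - M x $ 2 $ 2) / M x $ 1 $ 2)"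
    using real_values(1) Lc(2)[of 1 2] Lc(2)[of 2 2]
    by eventually_elim (simp add: A_def \<Lambda>_def C_def)
  then have Ar: "\<forall>\<^sub>F x in nhds 0. Im (A (cp x)) = 0" by eventually_elim simp
  have Gr: "\<forall>\<^sub>F x in nhds 0. Im (G (cp x)) = 0"
    by (rule transport_real[OF hA Ar G(1,4,5)])
  define f where "f = (\<lambda>w. \<tau> (0, w))"
  obtain r0 where r0: "r0 > 0" "(\<lambda>w. \<tau> (0, w)) holomorphic_on ball 0 r0"
    by (rule hol2_slice[OF h\<tau>]) (rule that)
  obtain \<delta> where \<delta>: "\<delta> > 0" "\<And>t. \<bar>t\<bar> < \<delta> \<Longrightarrow> of_real (tr (vector [0, t])) = V (cp (vector [0, t]))"
    by (rule eventually_nhds_vector[OF real_values(1)]) (rule that)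
  define r where "r = min r0 \<delta>"
  have r: "r > 0" "r \<le> r0" "r \<le> \<delta>" using r0 \<delta> by (auto simp: r_def)
  have fh: "f holomorphic_on ball 0 r"
    unfolding f_def by (rule holomorphic_on_subset[OF r0(2)]) (use r in auto)
  have f0: "f 0 = 0" using \<tau>0 by (simp add: f_def zero_prod_def)
  have fr: "Im (f (of_real t)) = 0" if "\<bar>t\<bar> < r" for t
  proof -
    have "V (0, of_real t) = of_real (tr (vector [0, t]))" using \<delta>(2)[of t] that r by (simp add: cp_vector)
    then show ?thesis by (simp add: f_def \<tau>_def C_def)
  qed
  have fn: "\<not> (\<forall>\<^sub>F w in nhds 0. f w = 0)"
  proof
    assume "\<forall>\<^sub>F w in nhds 0. f w = 0"
    from hol2_eventually_0[OF G(1,2) this] hom have "\<forall>\<^sub>F q in nhds 0. \<tau> q = 0"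
      by eventually_elim (simp add: f_def)
    with \<tau>ne show False by blast
  qed
  obtain m e \<rho> where e: "m > 0" "0 < \<rho>" "\<rho> \<le> r" "e holomorphic_on ball 0 \<rho>"
    "\<And>w. norm w < \<rho> \<Longrightarrow> f w = w ^ m * e w" "\<And>t. \<bar>t\<bar> < \<rho> \<Longrightarrow> Im (e (of_real t)) = 0"
    "\<And>w. norm w < \<rho> \<Longrightarrow> 0 < Re (e 0) * Re (e w)"
    by (rule holomorphic_factor_real[OF fh r(1) f0 fn fr]) (assumption, rule that)
  \<comment> \<open>Multiplied by its sign, the unit \<open>e\<close> has positive real part near 0;
    the principal logarithm then gives a holomorphic \<open>m\<close>-th root \<open>R\<close> that
    is real at real points.\<close>
  define \<epsilon> where "\<epsilon> = sgn (Re (e 0))"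
  have \<epsilon>: "\<epsilon> = 1 \<or> \<epsilon> = - 1" using e(7)[of 0] e(2) by (auto simp: \<epsilon>_def sgn_if)
  have \<epsilon>e: "0 < Re (of_real \<epsilon> * e w)" if "norm w < \<rho>" for w
    using e(7)[OF that] by (auto simp: \<epsilon>_def sgn_if zero_less_mult_iff)
  define R where "R = (\<lambda>w. exp (Ln (of_real \<epsilon> * e w) / of_nat m))"
  have Rh: "R holomorphic_on ball 0 \<rho>"
    unfolding R_def
  proof (intro holomorphic_intros e(4))
    show "of_real \<epsilon> * e w \<notin> \<real>\<^sub>\<le>\<^sub>0" if "w \<in> ball 0 \<rho>" for w
      using \<epsilon>e[of w] that by (auto simp: complex_nonpos_Reals_iff)
  qed (use e(1) in auto)
  have Rm: "R w ^ m = of_real \<epsilon> * e w" if "norm w < \<rho>" for w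
  proof -
    have "of_real \<epsilon> * e w \<noteq> 0" using \<epsilon>e[OF that] by force
    moreover have "R w ^ m = exp (of_nat m * (Ln (of_real \<epsilon> * e w) / of_nat m))"
      unfolding R_def by (rule exp_of_nat_mult[symmetric])
    ultimately show ?thesis using e(1) by simp
  qed
  have Rr: "Im (R (of_real t)) = 0" if "\<bar>t\<bar> < \<rho>" for t
  proof -
    have 1: "of_real \<epsilon> * e (of_real t) = of_real (\<epsilon> * Re (e (of_real t)))"
      using e(6)[OF that] by (simp add: complex_eq_iff)
    have "0 < \<epsilon> * Re (e (of_real t))" using \<epsilon>e[of "of_real t"] that by simp
    then have "R (of_real t) = of_real (exp (ln (\<epsilon> * Re (e (of_real t))) / real m))"
      unfolding R_def 1 by (simp only: Ln_of_real of_real_divide of_real_of_nat_eq flip: exp_of_real)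
    then show ?thesis by simp
  qed
  \<comment> \<open>For odd \<open>m\<close> the sign is absorbed by reversing the coordinate. An
    even power does not notice the reversal, so for even \<open>m\<close> the sign stays in the
    normal form as \<open>\<epsilon>'\<close>.\<close>
  define \<kappa> where "\<kappa> = (if odd m then \<epsilon> else 1)"
  define \<epsilon>' where "\<epsilon>' = (if odd m then 1 else \<epsilon>)"
  have \<kappa>: "\<kappa> = 1 \<or> \<kappa> = - 1" and \<epsilon>': "\<epsilon>' = 1 \<or> \<epsilon>' = - 1" "odd m \<Longrightarrow> \<epsilon>' = 1" using \<epsilon> by (auto simp: \<kappa>_def \<epsilon>'_def)
  have \<epsilon>\<kappa>: "\<epsilon>' * \<kappa> ^ m * \<epsilon> = 1" using \<epsilon> by (auto simp: \<kappa>_def \<epsilon>'_def)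
  define y where "y = (\<lambda>w. of_real \<kappa> * (w * R w))"
  define Y where "Y = (\<lambda>q. y (G q))"
  have yh: "y holomorphic_on ball 0 \<rho>" unfolding y_def by (intro holomorphic_intros Rh)
  have hY: "hol2 Y 0" unfolding Y_def by (rule hol2_chain[OF G(1) yh]) (use G(2) e(2) in auto)
  have yd: "(y has_field_derivative deriv y w) (at w)" if "norm w < \<rho>" for w
    by (rule holomorphic_derivI[OF yh open_ball]) (use that in simp)
  have "\<forall>\<^sub>F w in nhds (0::complex). norm w < \<rho>"
    using e(2) unfolding eventually_nhds_metric by auto
  note G\<rho> = hol2_eventually_0[OF G(1,2) this]
  have pdeY: "\<forall>\<^sub>F q in nhds 0. dz Y q = A q * dw Y q"
    using G\<rho> G(1)[unfolded hol2_iff_cdiff] G(4)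
  proof eventually_elim
    case (elim q)
    show ?case using cdiff_chain[OF elim(2) yd[OF elim(1)]] elim(3) by (simp add: Y_def)
  qed
  have dwY0: "dw Y 0 \<noteq> 0"
  proof -
    have "(y has_field_derivative of_real \<kappa> * (1 * R 0 + deriv R 0 * 0)) (at 0)"
      unfolding y_def
      by (intro DERIV_cmult DERIV_mult' DERIV_ident holomorphic_derivI[OF Rh open_ball, THEN DERIV_cong]) (use e(2) in \<open>auto intro!: derivative_eq_intros holomorphic_derivI[OF Rh open_ball]\<close>)
    then have "deriv y 0 = of_real \<kappa> * R 0" by (simp add: DERIV_imp_deriv)
    moreover have "dw Y 0 = deriv y 0"
      using cdiff_chain[OF hol2_at[OF G(1)], of y "deriv y 0"] yd[of 0] e(2) G(2,3) by (simp add: Y_def)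
    ultimately show ?thesis using \<kappa> by (auto simp: R_def)
  qed
  have Yr: "\<forall>\<^sub>F x in nhds 0. Im (Y (cp x)) = 0"
  proof -
    have "\<forall>\<^sub>F x in nhds 0. norm (G (cp x)) < \<rho>" by (rule eventually_cp) (simp add: G\<rho>)
    with Gr show ?thesis
    proof eventually_elim
      case (elim x)
      define t where "t = Re (G (cp x))"
      have t: "G (cp x) = of_real t" using elim(1) by (simp add: t_def complex_eq_iff)
      then have "\<bar>t\<bar> < \<rho>" using elim(2) by simp
      from Rr[OF this] show ?case by (simp add: Y_def y_def t)
    qed
  qed
  have \<tau>Y: "\<forall>\<^sub>F q in nhds 0. \<tau> q = of_real \<epsilon>' * Y q ^ m"
    using hom G\<rho>
  proof eventually_elim
    case (elim q)
    have "of_real \<epsilon>' * Y q ^ m = of_real \<epsilon>' * (of_real \<kappa> ^ m * (G q ^ m * R (G q) ^ m))"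
      by (simp add: Y_def y_def power_mult_distrib)
    also have "\<dots> = of_real (\<epsilon>' * \<kappa> ^ m * \<epsilon>) * (G q ^ m * e (G q))"
      unfolding Rm[OF elim(2)] by simp
    also have "\<dots> = f (G q)" unfolding \<epsilon>\<kappa> using e(5)[OF elim(2)] by simp
    finally show ?case using elim(1) by (simp add: f_def)
  qed
  \<comment> \<open>The first row of the intertwining relation reads dX (L - c) = dY. This is its
    second component, solved for the derivative in the first variable.\<close>
  define A1 where "A1 = (\<lambda>q. - ((Lc 2 2 q - C) / Lc 1 2 q))"
  define B1 where "B1 = (\<lambda>q. dw Y q / Lc 1 2 q)"
  have hA1: "hol2 A1 0" unfolding A1_def
    by (intro hol2_uminus hol2_divide hol2_diff hol2_const Lc) (use m12 in \<open>auto simp: Lc_at_0\<close>)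
  have hB1: "hol2 B1 0" unfolding B1_def
    by (intro hol2_divide hol2_derivs hY Lc) (use m12 in \<open>auto simp: Lc_at_0\<close>)
  obtain F where F: "hol2 F 0" "\<forall>\<^sub>F q in nhds 0. dz F q = A1 q * dw F q + B1 q"
    "\<forall>\<^sub>F q in nhds 0. fst q = 0 \<longrightarrow> F q = 0"
    using ck_exists[OF hA1 hB1] by blast
  have F0: "F 0 = 0" using eventually_nhds_x_imp_x[OF F(3)] by simp
  have dwF0: "dw F 0 = 0"
  proof -
    have "\<forall>\<^sub>F w in nhds 0. F (0, w) = 0"
      by (rule eventually_nhds_0_snd) (use F(3) in \<open>eventually_elim, metis prod.collapse\<close>)
    moreover have "((\<lambda>w. F (0, w)) has_field_derivative dw F (0, 0)) (at 0)"
      by (rule cdiff_snd_field_derivative) (use hol2_at[OF F(1)] in \<open>simp add: zero_prod_def\<close>)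
    ultimately have "((\<lambda>w. 0) has_field_derivative dw F (0, 0)) (at (0::complex))"
      using DERIV_cong_ev[of 0 0 "\<lambda>w. F (0, w)" "\<lambda>w. 0" "dw F (0, 0)" "dw F (0, 0)"] by simp
    then show ?thesis using DERIV_unique[OF _ DERIV_const] by (simp add: zero_prod_def)
  qed
  define X where "X = (\<lambda>x. Re (F (cp x)))"
  define yr where "yr = (\<lambda>x. Re (Y (cp x)))"
  define \<Phi> :: "real^2 \<Rightarrow> real^2" where "\<Phi> = (\<lambda>x. vector [X x, yr x])"
  have \<Phi>an: "real_analytic_at \<Phi> 0"
  proof -
    have "real_analytic_at X 0" "real_analytic_at yr 0"
      unfolding X_def yr_def by (rule real_analytic_at_Re, simp add: F hY)+
    then show ?thesis by (simp add: real_analytic_at_vec2_iff forall_2 \<Phi>_def)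
  qed
  have \<Phi>0: "\<Phi> 0 = 0" by (simp add: \<Phi>_def X_def yr_def F0 Y_def y_def G(2) vec_eq_iff forall_2)
  have pX: "\<forall>\<^sub>F x in nhds 0. pdiff 1 X x = Re (dz F (cp x)) \<and> pdiff 2 X x = Re (dw F (cp x))"
    unfolding X_def by (rule pdiff_Re_cp[OF F(1)])
  have py: "\<forall>\<^sub>F x in nhds 0. pdiff 1 yr x = Re (dz Y (cp x)) \<and> pdiff 2 yr x = Re (dw Y (cp x))"
    unfolding yr_def by (rule pdiff_Re_cp[OF hY])
  have "\<forall>\<^sub>F q in nhds (cp 0). Lc 1 2 q \<noteq> 0 \<and> dz Y q = A q * dw Y q \<and> dz F q = A1 q * dw F q + B1 q \<and> \<tau> q = of_real \<epsilon>' * Y q ^ m"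
    unfolding cp_0 using L12_nz pdeY F(2) \<tau>Y by eventually_elim blast
  note cx = eventually_cp[OF this]
  have real: "\<forall>\<^sub>F x in nhds 0. M x $ 1 $ 2 \<noteq> 0 \<and>
      M x $ 1 $ 2 * pdiff 1 yr x = ((tr x - c) - M x $ 2 $ 2) * pdiff 2 yr x \<and>
      M x $ 1 $ 2 * pdiff 1 X x = - ((M x $ 2 $ 2 - c) * pdiff 2 X x) + pdiff 2 yr x \<and>
      tr x - 2 * c = \<epsilon>' * yr x ^ m"
    using cx pX py Lc(2)[of 1 2] Lc(2)[of 2 2] real_values(1) Areal Yr
  proof eventually_elim
    case (elim x)
    have nz: "M x $ 1 $ 2 \<noteq> 0" using elim(1) by (metis elim(4) of_real_eq_0_iff)
    have 1: "pdiff 1 yr x = ((tr x - c) - M x $ 2 $ 2) / M x $ 1 $ 2 * pdiff 2 yr x"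
    proof -
      have "dz Y (cp x) = of_real (((tr x - c) - M x $ 2 $ 2) / M x $ 1 $ 2) * dw Y (cp x)"
        using elim(1,7) by metis
      then show ?thesis using elim(3) by (simp only: Re_complex_of_real times_complex.simps Im_complex_of_real mult_zero_left diff_zero)
    qed
    have 2: "pdiff 1 X x = - ((M x $ 2 $ 2 - c) / M x $ 1 $ 2) * pdiff 2 X x + pdiff 2 yr x / M x $ 1 $ 2"
    proof -
      have "A1 (cp x) = of_real (- ((M x $ 2 $ 2 - c) / M x $ 1 $ 2))"
        by (simp add: A1_def C_def flip: elim(4,5))
      moreover have "B1 (cp x) = dw Y (cp x) / of_real (M x $ 1 $ 2)"
        by (simp add: B1_def flip: elim(4))
      ultimately have "dz F (cp x) = of_real (- ((M x $ 2 $ 2 - c) / M x $ 1 $ 2)) * dw F (cp x) + dw Y (cp x) / of_real (M x $ 1 $ 2)"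
        using elim(1) by metis
      then show ?thesis using elim(2,3) by (simp only: plus_complex.simps Re_complex_of_real times_complex.simps Im_complex_of_real Re_divide_of_real mult_zero_left diff_zero)
    qed
    have "Y (cp x) = of_real (yr x)" using elim(8) by (simp add: yr_def complex_eq_iff)
    then have "complex_of_real (tr x - 2 * c) = of_real (\<epsilon>' * yr x ^ m)"
      using elim(1,6) by (simp add: \<tau>_def C_def)
    then have 3: "tr x - 2 * c = \<epsilon>' * yr x ^ m" by (simp only: of_real_eq_iff)
    show ?case using nz 1 2 3 by (simp add: field_simps)
  qed
  \<comment> \<open>Zero initial values give \<open>pdiff 2 X 0 = 0\<close>, so the Jacobian is
    \<open>pdiff 1 X 0 * pdiff 2 yr 0\<close>; by the equation for \<open>X\<close> the first factor
    is a nonzero multiple of the second.\<close>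
  have jd: "jdet \<Phi> 0 \<noteq> 0"
  proof -
    have r: "M 0 $ 1 $ 2 * pdiff 1 X 0 = - ((M 0 $ 2 $ 2 - c) * pdiff 2 X 0) + pdiff 2 yr 0"
      using eventually_nhds_x_imp_x[OF real] by blast
    have X2: "pdiff 2 X 0 = 0" using eventually_nhds_x_imp_x[OF pX] dwF0 by simp
    have "dw Y 0 = of_real (Re (dw Y 0))"
    proof -
      have "\<forall>\<^sub>F x in nhds 0. complex_of_real (yr x) = Y (cp x)"
        using Yr by eventually_elim (simp add: yr_def complex_eq_iff)
      moreover have "hol2 Y (cp 0)" using hY by simp
      ultimately have "\<forall>\<^sub>F x in nhds 0. yr differentiable at x \<and> dz Y (cp x) = of_real (pdiff 1 yr x) \<and>
          dw Y (cp x) = of_real (pdiff 2 yr x)"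
        by (intro hol2_extension_derivs)
      from eventually_nhds_x_imp_x[OF this] show ?thesis by simp
    qed
    then have y2: "pdiff 2 yr 0 \<noteq> 0" using eventually_nhds_x_imp_x[OF py] dwY0 by (metis cp_0 of_real_0)
    have "jdet \<Phi> 0 = pdiff 1 X 0 * pdiff 2 yr 0" by (simp add: jdet_def \<Phi>_def X2)
    moreover have "pdiff 1 X 0 \<noteq> 0" using r X2 y2 by auto
    ultimately show ?thesis using y2 by simp
  qed
  have "\<forall>\<^sub>F x in nhds 0. jacobian \<Phi> (at x) ** (M x - c *\<^sub>R mat 1) =
       (vector [vector [0, 1], vector [0, \<epsilon>' * (\<Phi> x $ 2) ^ m]] :: real^2^2) ** jacobian \<Phi> (at x)"
    using real chi real_analytic_at_eventually[OF \<Phi>an]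
  proof eventually_elim
    case (elim x)
    define a where "a = M x $ 1 $ 1 - c"
    define d where "d = M x $ 2 $ 2 - c"
    define b where "b = M x $ 1 $ 2"
    define k where "k = M x $ 2 $ 1"
    define t where "t = tr x - 2 * c"
    define X1 X2 y1 y2 where "X1 = pdiff 1 X x" and "X2 = pdiff 2 X x" and "y1 = pdiff 1 yr x" and "y2 = pdiff 2 yr x"
    have t: "t = a + d" by (simp add: t_def a_def d_def tr_def)
    \<comment> \<open>\<open>c\<close> is an eigenvalue, so \<open>L - c\<close> has determinant
      zero, and its trace \<open>t\<close> is its other eigenvalue. The second column of the matrix
      identity consists of the two differential equations; the first column follows after
      multiplication by \<open>b\<close>.\<close>
    have ad: "a * d = b * k"
      using elim(2) by (simp add: a_def b_def k_def d_def tr_def nu_def power2_eq_square algebra_simps)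
    have b0: "b \<noteq> 0" and ey: "b * y1 = a * y2" and eX: "b * X1 = - (d * X2) + y2"
      using elim(1) by (simp_all add: b_def y1_def y2_def X1_def X2_def a_def d_def tr_def)
    have J: "jacobian \<Phi> (at x) $ 1 $ 1 = X1" "jacobian \<Phi> (at x) $ 1 $ 2 = X2"
      "jacobian \<Phi> (at x) $ 2 $ 1 = y1" "jacobian \<Phi> (at x) $ 2 $ 2 = y2"
      unfolding jacobian_nth[OF real_analytic_at_vec2_differentiable[OF elim(3)]]
      by (simp_all add: \<Phi>_def X1_def X2_def y1_def y2_def)
    have 11: "X1 * a + X2 * k = y1"
    proof -
      have "b * (X1 * a + X2 * k) = a * (b * X1) + X2 * (b * k)" by (simp add: algebra_simps)
      also have "\<dots> = b * y1" unfolding eX ad[symmetric] ey by (simp add: algebra_simps)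
      finally show ?thesis using b0 by simp
    qed
    have 12: "X1 * b + X2 * d = y2" using eX by (simp add: algebra_simps)
    have 21: "y1 * a + y2 * k = t * y1"
    proof -
      have "b * (y1 * a + y2 * k) = a * (b * y1) + y2 * (b * k)" by (simp add: algebra_simps)
      also have "\<dots> = t * (b * y1)" unfolding ey ad[symmetric] t by (simp add: algebra_simps)
      finally have "b * (y1 * a + y2 * k) = b * (t * y1)" by (simp add: algebra_simps)
      then show ?thesis using b0 by simp
    qed
    have 22: "y1 * b + y2 * d = t * y2"
      unfolding mult.commute[of y1] ey t by (simp add: algebra_simps)
    have tt: "\<epsilon>' * (\<Phi> x $ 2) ^ m = t" using elim(1) by (simp add: \<Phi>_def t_def)
    show ?case
      unfolding tt vec_eq_iff forall_2 matrix_matrix_mult_def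
      using 11 12 21 22 by (simp add: sum_2 J mat_def flip: a_def b_def d_def k_def)
  qed
  note nf = this
  show ?thesis by (rule that[of \<Phi> m \<epsilon>', OF \<Phi>an \<Phi>0 jd e(1) \<epsilon>'(1) _ nf]) (rule \<epsilon>'(2))
qed

text \<open>Off the zeros of \<open>S\<close> the map formed by the two branches has Jacobian
  \<open>S / Lc 1 2 * (dw \<Lambda>1 * dw \<Lambda>2)\<close>, since the difference of the slopes is
  \<open>S / Lc 1 2\<close>. All factors are nonzero there by \<open>eigen_branch\<close>, so the
  eigenvalues are local coordinates and the smaller one can be raised with the larger one
  fixed.\<close>

lemma eigenvalues_open:
  assumes d0: "disc 0 = 0" and pos: "\<forall>\<^sub>F x in nhds 0. 0 \<le> disc x"
    and ne: "\<not> (\<forall>\<^sub>F x in nhds 0. disc x = 0)"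
    and chi: "\<not> (\<forall>\<^sub>F x in nhds 0. (tr 0 / 2)\<^sup>2 = tr x * (tr 0 / 2) + nu x)"
  shows "\<forall>\<^sub>F x in nhds 0. (tr x + sqrt (disc x)) / 2 \<noteq> tr 0 / 2 \<longrightarrow>
    (\<forall>W. open W \<longrightarrow> x \<in> W \<longrightarrow> (\<exists>y\<in>W. (tr y + sqrt (disc y)) / 2 = (tr x + sqrt (disc x)) / 2 \<and>
       (tr x - sqrt (disc x)) / 2 < (tr y - sqrt (disc y)) / 2))"
proof -
  obtain S where S: "hol2 S 0" "\<forall>\<^sub>F q in nhds 0. (S q)\<^sup>2 = D q"
    by (rule disc_sqrt[OF d0 pos ne]) (rule that)
  have S0: "S 0 = 0" using eventually_nhds_x_imp_x[OF S(2)] D_0 d0 by simp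
  have Sn: "\<not> (\<forall>\<^sub>F q in nhds 0. S q = 0)"
  proof
    assume "\<forall>\<^sub>F q in nhds 0. S q = 0"
    with S(2) have "\<forall>\<^sub>F q in nhds 0. D q = 0"
    proof eventually_elim
      case (elim q)
      then show ?case by (metis power_zero_numeral)
    qed
    with D_not_zero[OF ne] show False by blast
  qed
  define \<Lambda>1 where "\<Lambda>1 = (\<lambda>q. (V q + 1 * S q) / 2)"
  define \<Lambda>2 where "\<Lambda>2 = (\<lambda>q. (V q + (- 1) * S q) / 2)"
  obtain G1 :: "complex \<times> complex \<Rightarrow> complex" where G1: "hol2 \<Lambda>1 0"
    "\<forall>\<^sub>F q in nhds 0. dz \<Lambda>1 q = ((\<Lambda>1 q - Lc 2 2 q) / Lc 1 2 q) * dw \<Lambda>1 q"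
    "\<forall>\<^sub>F q in nhds 0. (G1 q = 0 \<longleftrightarrow> S q = 0) \<and> (G1 q = 0 \<longrightarrow> \<Lambda>1 q = of_real (tr 0 / 2)) \<and>
       (G1 q \<noteq> 0 \<longrightarrow> dw \<Lambda>1 q \<noteq> 0)"
    by (rule eigen_branch[OF S S0 Sn _ chi \<Lambda>1_def]) (simp, rule that)
  obtain G2 :: "complex \<times> complex \<Rightarrow> complex" where G2: "hol2 \<Lambda>2 0"
    "\<forall>\<^sub>F q in nhds 0. dz \<Lambda>2 q = ((\<Lambda>2 q - Lc 2 2 q) / Lc 1 2 q) * dw \<Lambda>2 q"
    "\<forall>\<^sub>F q in nhds 0. (G2 q = 0 \<longleftrightarrow> S q = 0) \<and> (G2 q = 0 \<longrightarrow> \<Lambda>2 q = of_real (tr 0 / 2)) \<and>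
       (G2 q \<noteq> 0 \<longrightarrow> dw \<Lambda>2 q \<noteq> 0)"
    by (rule eigen_branch[OF S S0 Sn _ chi \<Lambda>2_def]) (simp, rule that)
  define \<alpha> where "\<alpha> = (\<lambda>x. Re (\<Lambda>1 (cp x)))"
  define \<beta> where "\<beta> = (\<lambda>x. Re (\<Lambda>2 (cp x)))"
  define \<sigma> where "\<sigma> = (\<lambda>x. Re (S (cp x)))"
  have S_cp: "\<forall>\<^sub>F x in nhds 0. (S (cp x))\<^sup>2 = D (cp x)"
    by (rule eventually_cp) (simp add: S)
  have form: "\<forall>\<^sub>F x in nhds 0. Im (S (cp x)) = 0 \<and> sqrt (disc x) = \<bar>\<sigma> x\<bar> \<and> \<alpha> x = (tr x + \<sigma> x) / 2 \<and>
      \<beta> x = (tr x - \<sigma> x) / 2 \<and> of_real (\<alpha> x) = \<Lambda>1 (cp x) \<and> of_real (\<beta> x) = \<Lambda>2 (cp x)"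
    using S_cp real_values(1,3) pos
  proof eventually_elim
    case (elim x)
    define a where "a = Re (S (cp x))"
    define b where "b = Im (S (cp x))"
    have ab: "S (cp x) = Complex a b" by (simp add: a_def b_def)
    have "(Complex a b)\<^sup>2 = of_real (disc x)" using elim(1,3) ab by simp
    then have "a\<^sup>2 - b\<^sup>2 = disc x" "2 * a * b = 0"
      by (simp_all add: complex_eq_iff power2_eq_square)
    then have b: "b = 0" using elim(4) by (metis diff_0 mult_eq_0_iff neg_0_le_iff_le power2_less_eq_zero_iff power_zero_numeral zero_neq_numeral)
    with \<open>a\<^sup>2 - b\<^sup>2 = disc x\<close> have "sqrt (disc x) = \<bar>a\<bar>" by (metis diff_zero power_zero_numeral real_sqrt_abs)
    moreover have S': "S (cp x) = of_real a" using ab b by (simp add: complex_eq_iff)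
    ultimately show ?case
      by (simp add: \<sigma>_def \<alpha>_def \<beta>_def \<Lambda>1_def \<Lambda>2_def S' flip: elim(2))
  qed
  have \<alpha>an: "real_analytic_at \<alpha> 0" and \<beta>an: "real_analytic_at \<beta> 0" and \<sigma>an: "real_analytic_at \<sigma> 0"
    unfolding \<alpha>_def \<beta>_def \<sigma>_def by (rule real_analytic_at_Re, simp add: G1 G2 S)+
  define \<Phi> :: "real^2 \<Rightarrow> real^2" where "\<Phi> = (\<lambda>x. vector [\<alpha> x, \<beta> x])"
  have "real_analytic_at \<Phi> 0"
    using \<alpha>an \<beta>an by (simp add: real_analytic_at_vec2_iff forall_2 \<Phi>_def)
  note \<Phi>an = real_analytic_at_eventually[OF this]
  have fa: "\<forall>\<^sub>F x in nhds 0. of_real (\<alpha> x) = \<Lambda>1 (cp x)" and fb: "\<forall>\<^sub>F x in nhds 0. of_real (\<beta> x) = \<Lambda>2 (cp x)"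
    using form by (auto elim: eventually_mono)
  have da: "\<forall>\<^sub>F x in nhds 0. \<alpha> differentiable at x \<and> dz \<Lambda>1 (cp x) = of_real (pdiff 1 \<alpha> x) \<and> dw \<Lambda>1 (cp x) = of_real (pdiff 2 \<alpha> x)"
    by (rule hol2_extension_derivs[OF _ fa]) (simp add: G1)
  have db: "\<forall>\<^sub>F x in nhds 0. \<beta> differentiable at x \<and> dz \<Lambda>2 (cp x) = of_real (pdiff 1 \<beta> x) \<and> dw \<Lambda>2 (cp x) = of_real (pdiff 2 \<beta> x)"
    by (rule hol2_extension_derivs[OF _ fb]) (simp add: G2)
  have "\<forall>\<^sub>F q in nhds (cp 0). Lc 1 2 q \<noteq> 0 \<and>
      dz \<Lambda>1 q = ((\<Lambda>1 q - Lc 2 2 q) / Lc 1 2 q) * dw \<Lambda>1 q \<and>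
      dz \<Lambda>2 q = ((\<Lambda>2 q - Lc 2 2 q) / Lc 1 2 q) * dw \<Lambda>2 q \<and>
      ((G1 q = 0 \<longleftrightarrow> S q = 0) \<and> (G1 q = 0 \<longrightarrow> \<Lambda>1 q = of_real (tr 0 / 2)) \<and> (G1 q \<noteq> 0 \<longrightarrow> dw \<Lambda>1 q \<noteq> 0)) \<and>
      ((G2 q = 0 \<longleftrightarrow> S q = 0) \<and> (G2 q = 0 \<longrightarrow> \<Lambda>2 q = of_real (tr 0 / 2)) \<and> (G2 q \<noteq> 0 \<longrightarrow> dw \<Lambda>2 q \<noteq> 0))"
    unfolding cp_0 using L12_nz G1(2,3) G2(2,3) by eventually_elim blast
  note cx = eventually_cp[OF this]
  \<comment> \<open>The formulas must hold at all points close to \<open>x\<close>, because the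
    point to be found differs from \<open>x\<close>.\<close>
  have form': "\<forall>\<^sub>F x in nhds 0. \<forall>\<^sub>F y in nhds x. sqrt (disc y) = \<bar>\<sigma> y\<bar> \<and> \<alpha> y = (tr y + \<sigma> y) / 2 \<and> \<beta> y = (tr y - \<sigma> y) / 2"
    unfolding eventually_eventually using form by eventually_elim blast
  show ?thesis
    using cx form form' \<Phi>an real_analytic_at_eventually[OF \<sigma>an] da db
  proof eventually_elim
    case (elim x)
    show ?case
    proof (intro impI allI)
      fix W assume l: "(tr x + sqrt (disc x)) / 2 \<noteq> tr 0 / 2" and W: "open W" "x \<in> W"
      \<comment> \<open>Where \<open>S\<close> vanishes, \<open>\<Lambda>1\<close> is
        \<open>tr 0 / 2\<close> and is also the larger eigenvalue.\<close>
      have Snz: "S (cp x) \<noteq> 0"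
      proof
        assume s: "S (cp x) = 0"
        then have l1: "\<Lambda>1 (cp x) = of_real (tr 0 / 2)" using elim(1) by blast
        have "\<alpha> x = tr 0 / 2" unfolding \<alpha>_def l1 by (rule Re_complex_of_real)
        moreover have "\<sigma> x = 0" using s by (simp add: \<sigma>_def)
        ultimately show False using l elim(2) by simp
      qed
      then have \<sigma>nz: "\<sigma> x \<noteq> 0" using elim(2) by (simp add: \<sigma>_def complex_eq_iff)
      have "complex_of_real (jdet \<Phi> x) = dz \<Lambda>1 (cp x) * dw \<Lambda>2 (cp x) - dw \<Lambda>1 (cp x) * dz \<Lambda>2 (cp x)"
        using elim(6,7) by (simp add: jdet_def \<Phi>_def)
      also have "\<dots> = (((\<Lambda>1 (cp x) - Lc 2 2 (cp x)) - (\<Lambda>2 (cp x) - Lc 2 2 (cp x))) / Lc 1 2 (cp x)) * (dw \<Lambda>1 (cp x) * dw \<Lambda>2 (cp x))"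
      proof -
        have "dz \<Lambda>1 (cp x) = ((\<Lambda>1 (cp x) - Lc 2 2 (cp x)) / Lc 1 2 (cp x)) * dw \<Lambda>1 (cp x)"
          "dz \<Lambda>2 (cp x) = ((\<Lambda>2 (cp x) - Lc 2 2 (cp x)) / Lc 1 2 (cp x)) * dw \<Lambda>2 (cp x)"
          using elim(1) by blast+
        then show ?thesis by (simp only: diff_divide_distrib) (simp add: algebra_simps)
      qed
      also have "(\<Lambda>1 (cp x) - Lc 2 2 (cp x)) - (\<Lambda>2 (cp x) - Lc 2 2 (cp x)) = S (cp x)"
        by (simp add: \<Lambda>1_def \<Lambda>2_def field_simps)
      finally have "complex_of_real (jdet \<Phi> x) = S (cp x) / Lc 1 2 (cp x) * (dw \<Lambda>1 (cp x) * dw \<Lambda>2 (cp x))" .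
      moreover have "dw \<Lambda>1 (cp x) \<noteq> 0" "dw \<Lambda>2 (cp x) \<noteq> 0" "Lc 1 2 (cp x) \<noteq> 0" using elim(1) Snz by blast+
      ultimately have "complex_of_real (jdet \<Phi> x) \<noteq> 0" using Snz by simp
      then have jd: "jdet \<Phi> x \<noteq> 0" by simp
      have "\<forall>\<^sub>F y in nhds x. \<sigma> y * \<sigma> x \<in> {0<..}"
      proof (rule eventually_nhds_isCont[where f = "\<lambda>y. \<sigma> y * \<sigma> x"])
        show "isCont (\<lambda>y. \<sigma> y * \<sigma> x) x"
          by (intro continuous_mult continuous_const real_analytic_at_isCont[OF elim(5)])
        have "0 < \<sigma> x * \<sigma> x" using \<sigma>nz by (auto simp: zero_less_mult_iff)
        then show "\<forall>\<^sub>F z in nhds (\<sigma> x * \<sigma> x). z \<in> {0<..}" by (intro eventually_nhds_in_open) auto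
      qed
      with elim(3) eventually_nhds_in_open[OF W]
      have "\<forall>\<^sub>F y in nhds x. y \<in> W \<and> 0 < \<sigma> y * \<sigma> x \<and> sqrt (disc y) = \<bar>\<sigma> y\<bar> \<and> \<alpha> y = (tr y + \<sigma> y) / 2 \<and> \<beta> y = (tr y - \<sigma> y) / 2"
        by eventually_elim simp
      then obtain W' where W': "open W'" "x \<in> W'" and W'_def: "\<And>y. y \<in> W' \<Longrightarrow> y \<in> W \<and> 0 < \<sigma> y * \<sigma> x \<and>
          sqrt (disc y) = \<bar>\<sigma> y\<bar> \<and> \<alpha> y = (tr y + \<sigma> y) / 2 \<and> \<beta> y = (tr y - \<sigma> y) / 2"
        unfolding eventually_nhds by blast
      obtain P V' g where P: "open P" "x \<in> P" "P \<subseteq> W'" "open V'" "homeomorphism P V' \<Phi> g"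
        by (rule real_analytic_local_diffeo[OF elim(4) jd W']) (rule that)
      have "\<Phi> x \<in> V'" using homeomorphism_image1[OF P(5)] imageI[OF P(2), of \<Phi>] by simp
      then obtain e where e: "e > 0" "ball (\<Phi> x) e \<subseteq> V'" using P(4) open_contains_ball by blast
      \<comment> \<open>The displacement raises the smaller eigenvalue only: this is \<beta> if
        \<sigma> is positive and \<alpha> if it is negative, as the square root of the discriminant
        is the absolute value of \<sigma>. On \<open>W'\<close> the sign of \<sigma> does not
        change.\<close>
      define w :: "real^2" where "w = \<Phi> x + (if \<sigma> x > 0 then axis 2 (e / 2) else axis 1 (e / 2))"
      have "norm (axis i (e / 2) :: real^2) < e" for i
        using norm_le_l1_cart[of "axis i (e / 2) :: real^2"] e(1) exhaust_2[of i] by (auto simp: sum_2 axis_def)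
      then have "w \<in> ball (\<Phi> x) e" by (simp add: w_def dist_norm)
      then have "w \<in> \<Phi> ` P" using e(2) homeomorphism_image1[OF P(5)] by blast
      then obtain y where y: "y \<in> P" "\<Phi> y = w" by blast
      have ab: "\<alpha> y = \<alpha> x + (if \<sigma> x > 0 then 0 else e / 2)" "\<beta> y = \<beta> x + (if \<sigma> x > 0 then e / 2 else 0)"
        using arg_cong[OF y(2), of "\<lambda>v. v $ 1"] arg_cong[OF y(2), of "\<lambda>v. v $ 2"]
        by (auto simp: \<Phi>_def w_def axis_def split: if_splits)
      have "y \<in> W'" using y(1) P(3) by blast
      note y' = W'_def[OF this] and x' = W'_def[OF W'(2)]
      show "\<exists>y\<in>W. (tr y + sqrt (disc y)) / 2 = (tr x + sqrt (disc x)) / 2 \<and>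
          (tr x - sqrt (disc x)) / 2 < (tr y - sqrt (disc y)) / 2"
      proof (rule bexI[of _ y])
        show "y \<in> W" using y' by blast
        show "(tr y + sqrt (disc y)) / 2 = (tr x + sqrt (disc x)) / 2 \<and>
          (tr x - sqrt (disc x)) / 2 < (tr y - sqrt (disc y)) / 2"
        proof (cases "\<sigma> x > 0")
          case True
          then have "\<sigma> y > 0" using y' by (simp add: zero_less_mult_iff)
          with True ab x' y' e(1) show ?thesis by simp
        next
          case False
          then have "\<sigma> x < 0" "\<sigma> y < 0" using y' \<sigma>nz by (auto simp: zero_less_mult_iff)
          with False ab x' y' e(1) show ?thesis by simp
        qed
      qed
    qed
  qed
qed

end

section \<open>Algebraic types\<close>

text \<open>Stated over a general field, since the algebraic types refer to real as well as complex
  eigenvalues. In one direction the characteristic polynomial times each component of the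
  eigenvector vanishes; in the other an eigenvector is written down.\<close>

lemma eigenvalue_iff:
  fixes M :: "'k::field^2^2"
  shows "eigenvalue M z \<longleftrightarrow> z * z - (M$1$1 + M$2$2) * z + (M$1$1 * M$2$2 - M$1$2 * M$2$1) = 0"
proof
  assume "eigenvalue M z"
  then obtain w where w: "w \<noteq> 0" "M *v w = z *s w" unfolding eigenvalue_def by blast
  have 1: "M$1$1 * w$1 + M$1$2 * w$2 = z * w$1" and 2: "M$2$1 * w$1 + M$2$2 * w$2 = z * w$2"
    using arg_cong[OF w(2), of "\<lambda>v. v $ 1"] arg_cong[OF w(2), of "\<lambda>v. v $ 2"]
    by (simp_all add: matrix_vector_mult_def sum_2)
  let ?d = "z * z - (M$1$1 + M$2$2) * z + (M$1$1 * M$2$2 - M$1$2 * M$2$1)"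
  have "?d * w$1 = (M$2$2 - z) * (M$1$1 * w$1 + M$1$2 * w$2 - z * w$1) - M$1$2 * (M$2$1 * w$1 + M$2$2 * w$2 - z * w$2)"
    "?d * w$2 = (M$1$1 - z) * (M$2$1 * w$1 + M$2$2 * w$2 - z * w$2) - M$2$1 * (M$1$1 * w$1 + M$1$2 * w$2 - z * w$1)"
    by (simp_all add: algebra_simps)
  then have "?d * w$1 = 0" "?d * w$2 = 0" unfolding 1 2 by simp_all
  moreover have "w$1 \<noteq> 0 \<or> w$2 \<noteq> 0" using w(1) by (auto simp: vec_eq_iff forall_2)
  ultimately show "?d = 0" by auto
next
  assume d: "z * z - (M$1$1 + M$2$2) * z + (M$1$1 * M$2$2 - M$1$2 * M$2$1) = 0"
  then have e: "(z - M$1$1) * (z - M$2$2) = M$1$2 * M$2$1" by (simp add: algebra_simps)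
  \<comment> \<open>A vector annihilated by the first row of M - z if that row is nonzero, otherwise
    by the second row; if both rows vanish, \<open>M\<close> is scalar and any nonzero vector
    serves.\<close>
  define w :: "'k^2" where "w = (if M$1$2 \<noteq> 0 \<or> z \<noteq> M$1$1 then vector [M$1$2, z - M$1$1]
    else if z \<noteq> M$2$2 \<or> M$2$1 \<noteq> 0 then vector [z - M$2$2, M$2$1] else vector [1, 0])"
  have "w \<noteq> 0" by (auto simp: w_def vec_eq_iff forall_2)
  moreover have "M *v w = z *s w"
    using e by (auto simp: w_def vec_eq_iff forall_2 matrix_vector_mult_def sum_2 algebra_simps)
  ultimately show "eigenvalue M z" unfolding eigenvalue_def by blast
qed

definition mdisc :: "real^2^2 \<Rightarrow> real" where
  "mdisc M = (trace M)\<^sup>2 - 4 * det M"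

lemma distinct_real_type_iff: "distinct_real_type M \<longleftrightarrow> 0 < mdisc M"
proof
  let ?t = "M$1$1 + M$2$2" and ?d = "M$1$1 * M$2$2 - M$1$2 * M$2$1"
  assume "distinct_real_type M"
  then obtain l m where lm: "l \<noteq> m" "l * l - ?t * l + ?d = 0" "m * m - ?t * m + ?d = 0"
    unfolding distinct_real_type_def eigenvalue_iff by blast
  have "(l - m) * (l + m - ?t) = (l * l - ?t * l + ?d) - (m * m - ?t * m + ?d)" by (simp add: algebra_simps)
  then have t: "?t = l + m" using lm by simp
  have "?d = l * m" using lm(2) unfolding t by (simp add: algebra_simps)
  then have "mdisc M = (l - m)\<^sup>2" unfolding mdisc_def trace_2 det_2 t by (simp add: power2_eq_square algebra_simps)
  then show "0 < mdisc M" using lm(1) by simp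
next
  assume D: "0 < mdisc M"
  define s where "s = sqrt (mdisc M)"
  have s: "s * s = mdisc M" "s > 0" using D by (simp_all add: s_def)
  have "eigenvalue M ((trace M + s) / 2)" "eigenvalue M ((trace M - s) / 2)"
    unfolding eigenvalue_iff using s(1) by (simp_all add: mdisc_def trace_2 det_2 power2_eq_square field_simps)
  then show "distinct_real_type M"
    unfolding distinct_real_type_def using s(2) by (intro exI[of _ "(trace M + s) / 2"] exI[of _ "(trace M - s) / 2"]) auto
qed

lemma complex_conjugate_type_iff: "complex_conjugate_type M \<longleftrightarrow> mdisc M < 0"
proof
  let ?t = "M$1$1 + M$2$2" and ?d = "M$1$1 * M$2$2 - M$1$2 * M$2$1"
  assume "complex_conjugate_type M"
  then obtain z where z: "z \<noteq> cnj z" "z * z - of_real ?t * z + of_real ?d = 0"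
    unfolding complex_conjugate_type_def eigenvalue_iff by auto
  have b: "Im z \<noteq> 0" using z(1) by (auto simp: complex_eq_iff)
  have re: "Re z * Re z - Im z * Im z - ?t * Re z + ?d = 0" and im: "2 * Re z * Im z - ?t * Im z = 0"
    using arg_cong[OF z(2), of Re] arg_cong[OF z(2), of Im] by simp_all
  have "Im z * (2 * Re z - ?t) = 0" using im by (simp add: algebra_simps)
  then have t: "?t = 2 * Re z" using b by simp
  have "?d = Re z * Re z + Im z * Im z" using re unfolding t by (simp add: algebra_simps)
  then have "mdisc M = - (2 * Im z)\<^sup>2" unfolding mdisc_def trace_2 det_2 t by (simp add: power2_eq_square algebra_simps)
  then show "mdisc M < 0" using b by simp
next
  assume D: "mdisc M < 0"
  define s where "s = sqrt (- mdisc M)"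
  have s: "s * s = - mdisc M" "s > 0" using D by (simp_all add: s_def)
  define z where "z = Complex (trace M / 2) (s / 2)"
  have "eigenvalue (\<chi> i j. complex_of_real (M$i$j)) z" "eigenvalue (\<chi> i j. complex_of_real (M$i$j)) (cnj z)"
    unfolding eigenvalue_iff using s(1)
    by (simp_all add: z_def complex_eq_iff mdisc_def trace_2 det_2 power2_eq_square field_simps)
  moreover have "z \<noteq> cnj z" using s(2) by (simp add: z_def complex_eq_iff)
  ultimately show "complex_conjugate_type M" unfolding complex_conjugate_type_def by blast
qed

lemma matrix_conj_eq:
  fixes M P J :: "real^2^2"
  assumes "invertible P" "M ** P = P ** J"
  shows "M = P ** J ** matrix_inv P"
proof -
  have "M = M ** (P ** matrix_inv P)" by (simp add: matrix_inv_mult[OF assms(1)])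
  then show ?thesis unfolding matrix_mul_assoc assms(2) .
qed

lemma jordan_type_iff:
  assumes ns: "\<And>c. M \<noteq> c *\<^sub>R mat 1"
  shows "jordan_type M \<longleftrightarrow> mdisc M = 0"
proof
  assume "jordan_type M"
  then obtain P :: "real^2^2" and l where P: "invertible P" "M = P ** (vector [vector [l, 1], vector [0, l]] :: real^2^2) ** matrix_inv P"
    unfolding jordan_type_def by blast
  let ?J = "vector [vector [l, 1], vector [0, l]] :: real^2^2"
  have "trace M = trace (matrix_inv P ** (P ** ?J))" unfolding P(2) by (rule trace_mul_sym)
  then have t: "trace M = 2 * l" by (simp add: matrix_mul_assoc matrix_inv_mult[OF P(1)] trace_2)
  have "det P * det (matrix_inv P) = 1" using arg_cong[OF matrix_inv_mult(1)[OF P(1)], of det] by (simp add: det_mul)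
  then have "det M = det ?J" unfolding P(2) det_mul by (simp add: mult.commute mult.left_commute)
  then show "mdisc M = 0" unfolding mdisc_def t by (simp add: det_2 power2_eq_square)
next
  assume D: "mdisc M = 0"
  define l where "l = trace M / 2"
  \<comment> \<open>Jordan basis: the columns are (M - l) e and e, where e is the second standard
    vector if \<open>M$1$2 \<noteq> 0\<close> and the first one otherwise. In either case e lies
    outside the kernel of the nilpotent matrix M - l.\<close>
  define P :: "real^2^2" where "P = (if M$1$2 \<noteq> 0 then vector [vector [M$1$2, 0], vector [M$2$2 - l, 1]]
    else vector [vector [0, 1], vector [M$2$1, 0]])"
  have l: "M$1$1 = 2 * l - M$2$2" by (simp add: l_def trace_2 field_simps)
  have D': "(M$2$2 - l) * (M$2$2 - l) + M$1$2 * M$2$1 = 0"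
    using D unfolding mdisc_def trace_2 det_2 l by (simp add: power2_eq_square algebra_simps)
  have 22: "M$2$2 = l" if "M$1$2 = 0" using D' that by simp
  have nz: "M$2$1 \<noteq> 0" if "M$1$2 = 0"
  proof
    assume "M$2$1 = 0"
    then have "M = l *\<^sub>R mat 1" using that 22 l by (simp add: vec_eq_iff forall_2 mat_def)
    with ns show False by blast
  qed
  have "det P \<noteq> 0" using nz by (auto simp: P_def det_2)
  then have inv: "invertible P" by (simp add: invertible_det_nz)
  have "M ** P = P ** (vector [vector [l, 1], vector [0, l]] :: real^2^2)"
  proof (cases "M$1$2 = 0")
    case True
    then show ?thesis using 22[OF True] l
      by (simp add: P_def vec_eq_iff forall_2 matrix_matrix_mult_def sum_2 algebra_simps)
  next
    case False
    have "M$1$1 * M$1$2 + M$1$2 * (M$2$2 - l) = M$1$2 * l" unfolding l by (simp add: algebra_simps)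
    moreover have "M$2$1 * M$1$2 + M$2$2 * (M$2$2 - l) = (M$2$2 - l) * l" using D' by (simp add: algebra_simps)
    ultimately show ?thesis using False
      by (simp add: P_def vec_eq_iff forall_2 matrix_matrix_mult_def sum_2)
  qed
  from matrix_conj_eq[OF inv this] inv show "jordan_type M" unfolding jordan_type_def by blast
qed

lemma mult_sub_scaleR:
  fixes B J :: "real^2^2"
  shows "(B - c *\<^sub>R mat 1) ** J = B ** J - c *\<^sub>R J" "J ** (B - c *\<^sub>R mat 1) = J ** B - c *\<^sub>R J"
  by (simp_all add: vec_eq_iff forall_2 matrix_matrix_mult_def sum_2 mat_def algebra_simps)

section \<open>The discriminant on the surface and the algebraic types\<close>

context
  fixes A :: "'a::t2_space chart set" and L :: "'a tfield"
  assumes atlas: "analytic_atlas A" and tf: "tensor_field A L"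
begin

lemma discr_at_eq:
  assumes "c \<in> charts A" "q \<in> fst c"
  shows "discr_at A L q = mdisc (L c (snd c q))"
  unfolding discr_at_def Let_def tr_at_eq[OF atlas tf assms] det_at_eq[OF atlas tf assms] mdisc_def by simp

lemma discr_at_alt: "discr_at A L q = (tr_at A L q)\<^sup>2 - 4 * det_at A L q"
  by (simp add: discr_at_def Let_def)

lemma discr_analytic:
  assumes "c \<in> charts A" "q \<in> fst c"
  shows "real_analytic_at (\<lambda>x. discr_at A L (cinv c x)) (snd c q)"
  unfolding discr_at_alt power2_eq_square
  by (intro real_analytic_at_diff real_analytic_at_mult real_analytic_at_const tr_det_analytic[OF atlas tf assms])

lemma everywhere_iff:
  assumes "\<And>c x. c \<in> charts A \<Longrightarrow> x \<in> coord_image c \<Longrightarrow> P (L c x) \<longleftrightarrow> R (mdisc (L c x))"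
  shows "everywhere A L P \<longleftrightarrow> (\<forall>q. R (discr_at A L q))"
proof
  assume e: "everywhere A L P"
  show "\<forall>q. R (discr_at A L q)"
  proof
    fix q
    obtain c where c: "c \<in> charts A" "q \<in> fst c" using charts_cover[OF atlas] by blast
    have x: "snd c q \<in> coord_image c" using c(2) by (simp add: coord_image_def)
    then have "P (L c (snd c q))" using e c(1) unfolding everywhere_def by blast
    then show "R (discr_at A L q)" unfolding discr_at_eq[OF c] using assms[OF c(1) x] by blast
  qed
next
  assume r: "\<forall>q. R (discr_at A L q)"
  show "everywhere A L P"
    unfolding everywhere_def
  proof (intro ballI)
    fix c x assume c: "c \<in> charts A" and x: "x \<in> coord_image c"
    then obtain q where q: "q \<in> fst c" "x = snd c q" unfolding coord_image_def by blast
    have "R (mdisc (L c x))" using r discr_at_eq[OF c q(1)] q(2) by metis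
    then show "P (L c x)" using assms[OF c x] by blast
  qed
qed

lemma isCont_tr_det: "isCont (tr_at A L) q" "isCont (det_at A L) q" "isCont (discr_at A L) q"
proof -
  obtain c where c: "c \<in> charts A" "q \<in> fst c" using charts_cover[OF atlas] by blast
  show "isCont (tr_at A L) q" "isCont (det_at A L) q" "isCont (discr_at A L) q"
    by (rule isCont_via_chart[OF atlas c tr_det_analytic(1)[OF atlas tf c]]
        isCont_via_chart[OF atlas c tr_det_analytic(2)[OF atlas tf c]]
        isCont_via_chart[OF atlas c discr_analytic[OF c]])+
qed

text \<open>The three types are the three signs of the discriminant; for the Jordan type this uses
  that \<open>L\<close> is nowhere scalar. A discriminant without zeros has one sign by
  connectedness, and an identically zero one has empty \<open>Sing\<close> by definition.\<close>

lemma Sing_empty_iff_same_type: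
  assumes conn: "connected (UNIV :: 'a set)" and gl: "gl_regular A L"
  shows "Sing A L = {} \<longleftrightarrow> same_algebraic_type A L"
proof -
  let ?\<delta> = "discr_at A L"
  have ns: "L c x \<noteq> k *\<^sub>R mat 1" if "c \<in> charts A" "x \<in> coord_image c" for c x k
  proof
    assume "L c x = k *\<^sub>R mat 1"
    then have "k *\<^sub>R mat 1 + (- 1) *\<^sub>R L c x = 0" by simp
    with gl that have "(- 1 :: real) = 0" unfolding gl_regular_def by blast
    then show False by simp
  qed
  have 1: "everywhere A L distinct_real_type \<longleftrightarrow> (\<forall>q. 0 < ?\<delta> q)"
    by (rule everywhere_iff) (simp add: distinct_real_type_iff)
  have 2: "everywhere A L complex_conjugate_type \<longleftrightarrow> (\<forall>q. ?\<delta> q < 0)"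
    by (rule everywhere_iff) (simp add: complex_conjugate_type_iff)
  have 3: "everywhere A L jordan_type \<longleftrightarrow> (\<forall>q. ?\<delta> q = 0)"
    by (rule everywhere_iff) (simp add: jordan_type_iff ns)
  have "(\<forall>q. 0 < ?\<delta> q) \<or> (\<forall>q. ?\<delta> q < 0)" if nz: "\<forall>q. ?\<delta> q \<noteq> 0"
  proof (rule ccontr)
    assume "\<not> ?thesis"
    then obtain q1 q2 where q: "?\<delta> q1 < 0" "0 < ?\<delta> q2" using nz by (metis linorder_neqE_linordered_idom)
    have "connected (range ?\<delta>)"
      by (rule connected_continuous_image[OF _ conn]) (simp add: continuous_at_imp_continuous_on isCont_tr_det)
    then have "{?\<delta> q1..?\<delta> q2} \<subseteq> range ?\<delta>" by (rule connected_contains_Icc) auto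
    then have "0 \<in> range ?\<delta>" using q by (auto simp: subset_iff)
    then show False using nz by (metis rangeE)
  qed
  then show ?thesis unfolding same_algebraic_type_def 1 2 3 Sing_def by (auto split: if_splits) (metis less_irrefl)+
qed

end

section \<open>Centred charts with nonzero upper right entry\<close>

context
  fixes A :: "'a::t2_space chart set" and L :: "'a tfield"
  assumes atlas: "analytic_atlas A" and tf: "tensor_field A L"
begin

text \<open>Translation of \<open>q\<close> to the origin followed by an involution
  \<open>S\<close>, so that the same matrix serves for the map and for its inverse. The identity and
  the exchange of the coordinates are the two instances used.\<close>

lemma affine_chart:
  fixes S :: "real^2^2"
  assumes c: "c \<in> charts A" "q \<in> fst c" and S: "S ** S = mat 1"
  obtains c' where "c' \<in> charts A" "q \<in> fst c'" "snd c' q = 0" "L c' 0 ** S = S ** L c (snd c q)"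
proof -
  note ch = chartsD[OF c(1)]
  define x0 where "x0 = snd c q"
  have SS: "S *v (S *v x) = x" for x by (simp add: matrix_vector_mul_assoc S)
  define \<phi> where "\<phi> = (\<lambda>x. S *v (x - x0))"
  define \<psi> where "\<psi> = (\<lambda>y. S *v y + x0)"
  have inv: "\<psi> (\<phi> x) = x" "\<phi> (\<psi> x) = x" for x by (simp_all add: \<phi>_def \<psi>_def SS)
  have bl: "bounded_linear (\<lambda>x. S *v x)" by (rule matrix_vector_mul_bounded_linear)
  have cont: "continuous_on X \<phi>" "continuous_on X \<psi>" for X
    unfolding \<phi>_def \<psi>_def
    by (intro continuous_intros bounded_linear.continuous_on[OF bl])+
  define U where "U = coord_image c"
  define V where "V = \<psi> -` U"
  have U: "open U" "U \<subseteq> coord_image c" "x0 \<in> U"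
    using chart_facts(2,3)[OF ch] c(2) by (auto simp: U_def x0_def)
  have V: "open V" unfolding V_def by (rule open_vimage[OF U(1) cont(2)])
  have h: "homeomorphism U V \<phi> \<psi>"
    by (rule homeomorphismI[OF cont]) (auto simp: V_def inv)
  have an\<phi>: "real_analytic_at \<phi> x" and an\<psi>: "real_analytic_at \<psi> x" for x
    unfolding \<phi>_def \<psi>_def
    by (intro real_analytic_at_add real_analytic_at_const real_analytic_at_bounded_linear[OF bl]
        real_analytic_at_diff real_analytic_at_ident)+
  define c' where "c' = ({q \<in> fst c. snd c q \<in> U}, \<lambda>q. \<phi> (snd c q))"
  have 1: "c' \<in> charts A"
    unfolding c'_def by (rule chart_compose(1)[OF atlas c(1) U(2,1) V h an\<phi> an\<psi>])
  have "(\<phi> has_derivative (\<lambda>h. S *v h)) (at x0)"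
    unfolding \<phi>_def by (rule has_derivative_eq_rhs[OF bounded_linear.has_derivative[OF bl has_derivative_diff[OF has_derivative_ident has_derivative_const]]]) simp
  from jacobianI[OF this] have J: "jacobian \<phi> (at x0) = S" .
  have "L c' (\<phi> x0) ** S = S ** L c x0"
    using tensor_chart_compose(1)[OF atlas tf c(1) U(2,1) V h an\<phi> an\<psi> U(3)] unfolding J c'_def .
  moreover have "\<phi> x0 = 0" by (simp add: \<phi>_def)
  ultimately show ?thesis
    by (intro that[OF 1]) (use c(2) U(3) in \<open>auto simp: c'_def x0_def\<close>)
qed

text \<open>If the upper right entry is zero, the discriminant is the square of the difference of
  the diagonal entries; being nonpositive, it forces them to be equal. As \<open>L\<close> is not
  scalar, the lower left entry is then nonzero, and exchanging the coordinates moves it to the upper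
  right.\<close>

lemma centred_chart:
  assumes gl: "gl_regular A L" and neg: "discr_at A L q \<le> 0"
  obtains c where "c \<in> charts A" "q \<in> fst c" "snd c q = 0" "L c 0 $ 1 $ 2 \<noteq> 0"
proof -
  obtain c0 where c0: "c0 \<in> charts A" "q \<in> fst c0" using charts_cover[OF atlas] by blast
  define M where "M = L c0 (snd c0 q)"
  have D: "mdisc M \<le> 0" using neg discr_at_eq[OF atlas tf c0] by (simp add: M_def)
  show ?thesis
  proof (cases "M$1$2 = 0")
    case False
    obtain c' where c': "c' \<in> charts A" "q \<in> fst c'" "snd c' q = 0" "L c' 0 ** mat 1 = mat 1 ** L c0 (snd c0 q)"
      by (rule affine_chart[OF c0, of "mat 1"]) (simp, rule that)
    show ?thesis by (rule that[OF c'(1-3)]) (use c'(4) False in \<open>simp add: M_def\<close>)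
  next
    case True
    have "mdisc M = (M$1$1 - M$2$2)\<^sup>2"
      unfolding mdisc_def trace_2 det_2 using True by (simp add: power2_eq_square algebra_simps)
    with D have e: "M$1$1 = M$2$2" by simp
    have nz: "M$2$1 \<noteq> 0"
    proof
      assume "M$2$1 = 0"
      then have "M = (M$1$1) *\<^sub>R mat 1" using True e by (simp add: vec_eq_iff forall_2 mat_def)
      then have "(M$1$1) *\<^sub>R mat 1 + (- 1) *\<^sub>R L c0 (snd c0 q) = 0" by (simp add: M_def)
      moreover have "snd c0 q \<in> coord_image c0" using c0(2) by (simp add: coord_image_def)
      ultimately have "(- 1 :: real) = 0" using gl c0(1) unfolding gl_regular_def by blast
      then show False by simp
    qed
    let ?S = "vector [vector [0, 1], vector [1, 0]] :: real^2^2"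
    have "?S ** ?S = mat 1" by (simp add: vec_eq_iff forall_2 matrix_matrix_mult_def sum_2 mat_def)
    then obtain c' where c': "c' \<in> charts A" "q \<in> fst c'" "snd c' q = 0" "L c' 0 ** ?S = ?S ** L c0 (snd c0 q)"
      by (rule affine_chart[OF c0]) (rule that)
    have "L c' 0 $ 1 $ 2 = M $ 2 $ 1"
      using arg_cong[OF c'(4), of "\<lambda>X. X $ 1 $ 1"] by (simp add: matrix_matrix_mult_def sum_2 M_def)
    with nz show ?thesis by (intro that[OF c'(1-3)]) simp
  qed
qed

lemma centred_germ:
  assumes nij: "nijenhuis A L" and c: "c \<in> charts A" "q \<in> fst c" "snd c q = 0" "L c 0 $ 1 $ 2 \<noteq> 0"
  shows "nijenhuis_germ (L c)"
    and "\<forall>\<^sub>F x in nhds 0. nijenhuis_germ.tr (L c) x = tr_at A L (cinv c x) \<and>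
      nijenhuis_germ.nu (L c) x = - det_at A L (cinv c x) \<and>
      nijenhuis_germ.disc (L c) x = discr_at A L (cinv c x) \<and> x \<in> coord_image c"
proof -
  note ch = chartsD[OF c(1)]
  have ev: "\<forall>\<^sub>F x in nhds 0. x \<in> coord_image c"
    by (rule eventually_nhds_in_open[OF chart_facts(2)[OF ch]]) (use chart_facts(3)[OF ch c(2)] c(3) in simp)
  show g: "nijenhuis_germ (L c)"
  proof
    show "real_analytic_at (\<lambda>x. L c x $ i $ j) 0" for i j
      using tensor_analytic[OF atlas tf c(1,2)] c(3) by simp
    show "L c 0 $ 1 $ 2 \<noteq> 0" by (rule c(4))
    show "\<forall>\<^sub>F x in nhds 0. L c x $ 1 $ 2 * pdiff 1 (\<lambda>x. L c x $ 1 $ 1 + L c x $ 2 $ 2) x =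
        L c x $ 1 $ 1 * pdiff 2 (\<lambda>x. L c x $ 1 $ 1 + L c x $ 2 $ 2) x +
        pdiff 2 (\<lambda>x. L c x $ 1 $ 2 * L c x $ 2 $ 1 - L c x $ 1 $ 1 * L c x $ 2 $ 2) x"
      using ev by eventually_elim (rule nijenhuis_chart(1)[OF atlas tf nij c(1)])
    show "\<forall>\<^sub>F x in nhds 0. L c x $ 2 $ 1 * pdiff 2 (\<lambda>x. L c x $ 1 $ 1 + L c x $ 2 $ 2) x =
        L c x $ 2 $ 2 * pdiff 1 (\<lambda>x. L c x $ 1 $ 1 + L c x $ 2 $ 2) x +
        pdiff 1 (\<lambda>x. L c x $ 1 $ 2 * L c x $ 2 $ 1 - L c x $ 1 $ 1 * L c x $ 2 $ 2) x"
      using ev by eventually_elim (rule nijenhuis_chart(2)[OF atlas tf nij c(1)])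
  qed
  interpret nijenhuis_germ "L c" by (rule g)
  show "\<forall>\<^sub>F x in nhds 0. tr x = tr_at A L (cinv c x) \<and> nu x = - det_at A L (cinv c x) \<and>
      disc x = discr_at A L (cinv c x) \<and> x \<in> coord_image c"
    using ev
  proof eventually_elim
    case (elim x)
    note q = chart_facts(5,6)[OF ch elim]
    show ?case
      using tr_at_eq[OF atlas tf c(1) q(1)] det_at_eq[OF atlas tf c(1) q(1)] elim
      by (simp add: tr_def nu_def disc_def discr_at_alt[OF atlas tf] q(2) trace_2 det_2)
  qed
qed

lemma eventually_centred:
  assumes c: "c \<in> charts A" "q \<in> fst c" "snd c q = 0"
  shows "(\<forall>\<^sub>F x in nhds 0. P x) \<Longrightarrow> \<forall>\<^sub>F q' in nhds q. P (snd c q')"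
    and "(\<forall>\<^sub>F q' in nhds q. R q') \<Longrightarrow> \<forall>\<^sub>F x in nhds 0. R (cinv c x)"
    and "\<forall>\<^sub>F q' in nhds q. q' \<in> fst c \<and> cinv c (snd c q') = q'"
  using eventually_chart[OF chartsD[OF c(1)] c(2)] c(3)
    eventually_nhds_in_open[OF chart_facts(1)[OF chartsD[OF c(1)]] c(2)] chart_facts(4)[OF chartsD[OF c(1)]]
  by (auto elim: eventually_mono)

section \<open>The global argument on a closed surface\<close>

context
  assumes comp: "compact (UNIV :: 'a set)" and conn: "connected (UNIV :: 'a set)"
    and nij: "nijenhuis A L" and gl: "gl_regular A L" and Sing: "Sing A L \<noteq> {}"
begin

lemma discr_nonzero: "\<not> (\<forall>q. discr_at A L q = 0)" and Sing_eq: "Sing A L = {q. discr_at A L q = 0}"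
  using Sing unfolding Sing_def by (auto split: if_splits)

lemma discr_not_locally_zero: "\<not> (\<forall>\<^sub>F q' in nhds q. discr_at A L q' = 0)"
  using analytic_zero_everywhere[OF atlas conn, of "discr_at A L" q] discr_analytic[OF atlas tf] discr_nonzero by blast

lemma discr_nonneg: "0 \<le> discr_at A L q"
proof -
  have cont: "continuous_on UNIV (discr_at A L)"
    by (simp add: continuous_at_imp_continuous_on isCont_tr_det[OF atlas tf])
  obtain q0 where min: "\<And>q. discr_at A L q0 \<le> discr_at A L q"
    using continuous_attains_inf[OF comp _ cont] by auto
  show ?thesis
  proof (rule ccontr)
    assume "\<not> ?thesis"
    then have neg: "discr_at A L q0 < 0" using min[of q] by simp
    obtain c where c: "c \<in> charts A" "q0 \<in> fst c" "snd c q0 = 0" "L c 0 $ 1 $ 2 \<noteq> 0"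
      by (rule centred_chart[OF gl, of q0]) (use neg in simp, rule that)
    interpret nijenhuis_germ "L c" by (rule centred_germ(1)[OF nij c])
    note ev = centred_germ(2)[OF nij c]
    have c0: "cinv c 0 = q0" using chart_facts(4)[OF chartsD[OF c(1)] c(2)] c(3) by simp
    have d0: "disc 0 = discr_at A L q0" using eventually_nhds_x_imp_x[OF ev] c0 by simp
    have "\<forall>\<^sub>F x in nhds 0. disc x = disc 0"
    proof (rule complex_eigenvalue_disc_constant)
      show "disc 0 < 0" using neg d0 by simp
      show "\<forall>\<^sub>F x in nhds 0. disc 0 \<le> disc x" using ev by eventually_elim (simp add: d0 min)
    qed
    with ev have "\<forall>\<^sub>F x in nhds 0. discr_at A L (cinv c x) = discr_at A L q0"
      by eventually_elim (metis d0)
    from eventually_centred(1)[OF c(1-3) this] eventually_centred(3)[OF c(1-3)]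
    have "\<forall>\<^sub>F q in nhds q0. discr_at A L q - discr_at A L q0 = 0" by eventually_elim simp
    \<comment> \<open>Analytic continuation spreads the locally constant negative value over the
      whole surface, which leaves no room for a singular point.\<close>
    then have "discr_at A L q - discr_at A L q0 = 0" for q
      by (rule analytic_zero_everywhere[OF atlas conn, rotated])
        (intro real_analytic_at_diff real_analytic_at_const discr_analytic[OF atlas tf])
    moreover obtain p where "discr_at A L p = 0" using Sing Sing_eq by blast
    ultimately show False using neg by (metis diff_0 less_irrefl neg_equal_0_iff_equal)
  qed
qed

text \<open>If both eigenvalues were non-constant near the singular points with eigenvalue \<open>\<lambda>\<close>, the
  larger one would take a value \<open>\<mu> \<noteq> \<lambda>\<close> close to \<open>\<lambda>\<close>, and on its compact level set the smaller one
  would be maximal at a point where the two eigenvalues are local coordinates.\<close>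

lemma eigenvalue_constant:
  assumes p: "discr_at A L p = 0"
  shows "(tr_at A L p / 2)\<^sup>2 = tr_at A L q * (tr_at A L p / 2) - det_at A L q"
proof (rule ccontr)
  define k where "k = tr_at A L p / 2"
  \<comment> \<open>The characteristic polynomial at \<open>k\<close>, expressed by trace and
    determinant. In this form it is visibly analytic, with no square root, so vanishing near one
    point means vanishing everywhere.\<close>
  define \<theta> where "\<theta> = (\<lambda>q. k * k - tr_at A L q * k + det_at A L q)"
  assume "\<not> ?thesis"
  then have \<theta>q: "\<theta> q \<noteq> 0" by (simp add: \<theta>_def k_def power2_eq_square algebra_simps)
  have \<theta>an: "real_analytic_at (\<lambda>x. \<theta> (cinv c x)) (snd c q)" if "c \<in> charts A" "q \<in> fst c" for c q
    unfolding \<theta>_def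
    by (intro real_analytic_at_add real_analytic_at_diff real_analytic_at_mult real_analytic_at_const
        tr_det_analytic[OF atlas tf that])
  have \<theta>nz: "\<not> (\<forall>\<^sub>F q' in nhds s. \<theta> q' = 0)" for s
    using analytic_zero_everywhere[OF atlas conn \<theta>an, of s q] \<theta>q by blast
  define hi where "hi = (\<lambda>q. (tr_at A L q + sqrt (discr_at A L q)) / 2)"
  define lo where "lo = (\<lambda>q. (tr_at A L q - sqrt (discr_at A L q)) / 2)"
  have cont: "isCont hi s" "isCont lo s" for s
    unfolding hi_def lo_def by (intro continuous_intros isCont_tr_det[OF atlas tf]; simp)+
  have lo_le: "lo s \<le> hi s" for s using discr_nonneg[of s] by (simp add: lo_def hi_def)
  have \<theta>_eq: "\<theta> s = (k - hi s) * (k - lo s)" for s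
  proof -
    have "hi s * lo s = (tr_at A L s * tr_at A L s - sqrt (discr_at A L s) * sqrt (discr_at A L s)) / 4"
      by (simp add: hi_def lo_def algebra_simps)
    also have "\<dots> = det_at A L s" using discr_nonneg[of s] by (simp add: discr_at_alt[OF atlas tf] power2_eq_square)
    finally have "det_at A L s = hi s * lo s" by simp
    moreover have "tr_at A L s = hi s + lo s" by (simp add: hi_def lo_def field_simps)
    ultimately show ?thesis by (simp add: \<theta>_def algebra_simps)
  qed
  \<comment> \<open>The conclusion of \<open>eigenvalues_open\<close> weakened to a statement on the
    surface: \<open>s\<close> is not a maximum of \<open>lo\<close> on its level set of
    \<open>hi\<close>, except possibly on the level \<open>k\<close>.\<close>
  define good where "good = (\<lambda>s. hi s \<noteq> k \<longrightarrow> (\<exists>s'. hi s' = hi s \<and> lo s < lo s'))"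
  have loc: "\<forall>\<^sub>F s' in nhds s. good s'" if s: "discr_at A L s = 0" "tr_at A L s = 2 * k" for s
  proof -
    obtain c where c: "c \<in> charts A" "s \<in> fst c" "snd c s = 0" "L c 0 $ 1 $ 2 \<noteq> 0"
      by (rule centred_chart[OF gl, of s]) (use s in simp, rule that)
    interpret nijenhuis_germ "L c" by (rule centred_germ(1)[OF nij c])
    note ev = centred_germ(2)[OF nij c]
    have c0: "cinv c 0 = s" using chart_facts(4)[OF chartsD[OF c(1)] c(2)] c(3) by simp
    have k0: "tr 0 / 2 = k" and d0: "disc 0 = 0" using eventually_nhds_x_imp_x[OF ev] c0 s by simp_all
    obtain W where W: "open W" "0 \<in> W" "\<And>x. x \<in> W \<Longrightarrow> tr x = tr_at A L (cinv c x) \<and>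
      nu x = - det_at A L (cinv c x) \<and> disc x = discr_at A L (cinv c x) \<and> x \<in> coord_image c"
      using ev unfolding eventually_nhds by blast
    have hl: "hi (cinv c x) = (tr x + sqrt (disc x)) / 2" "lo (cinv c x) = (tr x - sqrt (disc x)) / 2" if "x \<in> W" for x
      using W(3)[OF that] by (simp_all add: hi_def lo_def)
    have "\<forall>\<^sub>F x in nhds 0. (tr x + sqrt (disc x)) / 2 \<noteq> tr 0 / 2 \<longrightarrow>
      (\<forall>W. open W \<longrightarrow> x \<in> W \<longrightarrow> (\<exists>y\<in>W. (tr y + sqrt (disc y)) / 2 = (tr x + sqrt (disc x)) / 2 \<and>
       (tr x - sqrt (disc x)) / 2 < (tr y - sqrt (disc y)) / 2))"
    proof (rule eigenvalues_open[OF d0])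
      show "\<forall>\<^sub>F x in nhds 0. 0 \<le> disc x" using ev by eventually_elim (simp add: discr_nonneg)
      show "\<not> (\<forall>\<^sub>F x in nhds 0. disc x = 0)"
      proof
        assume "\<forall>\<^sub>F x in nhds 0. disc x = 0"
        with ev have "\<forall>\<^sub>F x in nhds 0. discr_at A L (cinv c x) = 0" by eventually_elim simp
        from eventually_centred(1)[OF c(1-3) this] eventually_centred(3)[OF c(1-3)]
        have "\<forall>\<^sub>F q in nhds s. discr_at A L q = 0" by eventually_elim simp
        with discr_not_locally_zero show False by blast
      qed
      show "\<not> (\<forall>\<^sub>F x in nhds 0. (tr 0 / 2)\<^sup>2 = tr x * (tr 0 / 2) + nu x)"
      proof
        assume "\<forall>\<^sub>F x in nhds 0. (tr 0 / 2)\<^sup>2 = tr x * (tr 0 / 2) + nu x"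
        with ev have "\<forall>\<^sub>F x in nhds 0. \<theta> (cinv c x) = 0"
          unfolding k0 by eventually_elim (simp add: \<theta>_def power2_eq_square)
        from eventually_centred(1)[OF c(1-3) this] eventually_centred(3)[OF c(1-3)]
        have "\<forall>\<^sub>F q in nhds s. \<theta> q = 0" by eventually_elim simp
        with \<theta>nz show False by blast
      qed
    qed
    with eventually_nhds_in_open[OF W(1,2)] have "\<forall>\<^sub>F x in nhds 0. good (cinv c x)"
    proof eventually_elim
      case (elim x)
      show ?case
        unfolding good_def
      proof
        assume "hi (cinv c x) \<noteq> k"
        then have "(tr x + sqrt (disc x)) / 2 \<noteq> tr 0 / 2" unfolding k0 hl(1)[OF elim(1)] .
        with elim(2) W(1) elim(1) obtain y where y: "y \<in> W" "(tr y + sqrt (disc y)) / 2 = (tr x + sqrt (disc x)) / 2"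
          "(tr x - sqrt (disc x)) / 2 < (tr y - sqrt (disc y)) / 2" by blast
        then show "\<exists>s'. hi s' = hi (cinv c x) \<and> lo (cinv c x) < lo s'"
          using hl[OF elim(1)] hl[OF y(1)] by (intro exI[of _ "cinv c y"]) simp
      qed
    qed
    from eventually_centred(1)[OF c(1-3) this] eventually_centred(3)[OF c(1-3)]
    show ?thesis by eventually_elim simp
  qed
  \<comment> \<open>An open set that contains every singular point with double eigenvalue
    \<open>k\<close>, and not just \<open>p\<close>: the maximum sought below may be close to a
    different one.\<close>
  define N where "N = {s. \<forall>\<^sub>F s' in nhds s. good s'}"
  have "open N"
  proof (rule openI_nhds)
    fix s assume "s \<in> N"
    then show "\<forall>\<^sub>F s' in nhds s. s' \<in> N" unfolding N_def mem_Collect_eq by (subst eventually_eventually)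
  qed
  then have compN: "compact (- N)" using compact_Int_closed[OF comp, of "- N"] by (simp add: closed_Compl)
  \<comment> \<open>It vanishes only where both eigenvalues equal \<open>k\<close>, hence only
    inside \<open>N\<close>, and so has a positive lower bound \<epsilon> on the compact complement.
    A value below \<epsilon> certifies membership in \<open>N\<close>.\<close>
  define \<Phi> where "\<Phi> = (\<lambda>s. \<bar>hi s - k\<bar> + \<bar>lo s - k\<bar>)"
  have \<Phi>pos: "0 < \<Phi> s" if "s \<notin> N" for s
  proof (rule ccontr)
    assume "\<not> 0 < \<Phi> s"
    then have "hi s = k" "lo s = k" by (auto simp: \<Phi>_def)
    then have "tr_at A L s + sqrt (discr_at A L s) = 2 * k" "tr_at A L s - sqrt (discr_at A L s) = 2 * k"
      by (simp_all add: hi_def lo_def)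
    then have "tr_at A L s = 2 * k" "sqrt (discr_at A L s) = 0" by linarith+
    then have "s \<in> N" using loc[of s] by (simp add: N_def)
    with that show False by blast
  qed
  obtain \<epsilon> where \<epsilon>: "\<epsilon> > 0" "\<And>s. s \<notin> N \<Longrightarrow> \<epsilon> \<le> \<Phi> s"
  proof (cases "- N = {}")
    case True
    then show ?thesis using that[of 1] by auto
  next
    case False
    have "continuous_on (- N) \<Phi>"
      unfolding \<Phi>_def by (intro continuous_intros continuous_at_imp_continuous_on ballI cont)
    from continuous_attains_inf[OF compN False this] obtain s0 where "s0 \<in> - N" "\<forall>s\<in>- N. \<Phi> s0 \<le> \<Phi> s" by blast
    then show ?thesis using that[of "\<Phi> s0"] \<Phi>pos[of s0] by auto
  qed
  have pk: "hi p = k" "lo p = k" using p by (simp_all add: hi_def lo_def k_def)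
  have evp: "\<forall>\<^sub>F s in nhds p. \<bar>hi s - k\<bar> < \<epsilon> / 3 \<and> \<bar>lo s - k\<bar> < \<epsilon> / 3"
  proof -
    have "\<forall>\<^sub>F s in nhds p. hi s \<in> {k - \<epsilon> / 3<..<k + \<epsilon> / 3}"
      by (rule eventually_nhds_isCont[OF cont(1)], rule eventually_nhds_in_open) (use \<epsilon>(1) pk in auto)
    moreover have "\<forall>\<^sub>F s in nhds p. lo s \<in> {k - \<epsilon> / 3<..<k + \<epsilon> / 3}"
      by (rule eventually_nhds_isCont[OF cont(2)], rule eventually_nhds_in_open) (use \<epsilon>(1) pk in auto)
    ultimately show ?thesis by eventually_elim (unfold greaterThanLessThan_iff, arith)
  qed
  \<comment> \<open>If \<open>hi\<close> were equal to \<open>k\<close> near \<open>p\<close>, then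
    \<theta> would vanish there by its factorisation, and hence everywhere.\<close>
  obtain s1 where s1: "\<bar>hi s1 - k\<bar> < \<epsilon> / 3" "\<bar>lo s1 - k\<bar> < \<epsilon> / 3" "hi s1 \<noteq> k"
  proof (rule ccontr)
    assume "\<not> thesis"
    with that have "hi s = k" if "\<bar>hi s - k\<bar> < \<epsilon> / 3 \<and> \<bar>lo s - k\<bar> < \<epsilon> / 3" for s using that by blast
    with evp have "\<forall>\<^sub>F s in nhds p. \<theta> s = 0" by (auto elim!: eventually_mono simp: \<theta>_eq)
    with \<theta>nz show False by blast
  qed
  define K where "K = hi -` {hi s1}"
  have "closed K" unfolding K_def
    by (rule closed_vimage) (auto intro: continuous_at_imp_continuous_on cont)
  then have "compact K" using compact_Int_closed[OF comp] by simp
  moreover have "K \<noteq> {}" by (auto simp: K_def)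
  moreover have "continuous_on K lo" by (intro continuous_at_imp_continuous_on ballI cont)
  ultimately obtain m where m: "m \<in> K" "\<And>s. s \<in> K \<Longrightarrow> lo s \<le> lo m"
    using continuous_attains_sup[of K lo] by blast
  have hm: "hi m = hi s1" using m(1) by (simp add: K_def)
  have "lo s1 \<le> lo m" by (rule m(2)) (simp add: K_def)
  \<comment> \<open>\<open>lo s1 \<le> lo m \<le> hi m = hi s1\<close>, and both ends are within
    \<open>\<epsilon> / 3\<close> of \<open>k\<close>.\<close>
  with lo_le[of m] hm s1 have "\<bar>lo m - k\<bar> < \<epsilon> / 3" by arith
  then have "\<Phi> m < \<epsilon>" using s1 hm \<epsilon>(1) by (simp add: \<Phi>_def)
  then have "m \<in> N" using \<epsilon>(2)[of m] by force
  then have "good m" unfolding N_def using eventually_nhds_x_imp_x by blast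
  then obtain s' where "hi s' = hi m" "lo m < lo s'" using hm s1(3) unfolding good_def by auto
  with m(2)[of s'] hm show False by (simp add: K_def)
qed

text \<open>After shrinking, the map of \<open>normal_form\<close> turns into a chart of the maximal
  atlas. Its intertwining relation is the transformation law for L - k, so the components in the new
  chart can be read off by cancelling the invertible Jacobian.\<close>

lemma Sing_series_M:
  assumes p: "discr_at A L p = 0"
  shows "series_M A L p"
proof -
  define k where "k = tr_at A L p / 2"
  obtain c where c: "c \<in> charts A" "p \<in> fst c" "snd c p = 0" "L c 0 $ 1 $ 2 \<noteq> 0"
    by (rule centred_chart[OF gl, of p]) (use p in simp, rule that)
  interpret nijenhuis_germ "L c" by (rule centred_germ(1)[OF nij c])
  note ev = centred_germ(2)[OF nij c]
  have c0: "cinv c 0 = p" using chart_facts(4)[OF chartsD[OF c(1)] c(2)] c(3) by simp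
  have k0: "k = tr 0 / 2" using eventually_nhds_x_imp_x[OF ev] c0 by (simp add: k_def)
  have ne: "\<not> (\<forall>\<^sub>F x in nhds 0. disc x = 0)"
  proof
    assume "\<forall>\<^sub>F x in nhds 0. disc x = 0"
    with ev have "\<forall>\<^sub>F x in nhds 0. discr_at A L (cinv c x) = 0" by eventually_elim simp
    from eventually_centred(1)[OF c(1-3) this] eventually_centred(3)[OF c(1-3)]
    have "\<forall>\<^sub>F q in nhds p. discr_at A L q = 0" by eventually_elim simp
    with discr_not_locally_zero show False by blast
  qed
  have chi: "\<forall>\<^sub>F x in nhds 0. k\<^sup>2 = tr x * k + nu x"
    using ev by eventually_elim (use eigenvalue_constant[OF p] in \<open>simp add: k_def\<close>)
  obtain \<Phi> :: "real^2 \<Rightarrow> real^2" and m :: nat and \<epsilon> :: real where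
    \<Phi>: "real_analytic_at \<Phi> 0" "\<Phi> 0 = 0" "jdet \<Phi> 0 \<noteq> 0" and m: "m > 0" "\<epsilon> = 1 \<or> \<epsilon> = - 1" "odd m \<Longrightarrow> \<epsilon> = 1"
    and nf: "\<forall>\<^sub>F x in nhds 0. jacobian \<Phi> (at x) ** (L c x - k *\<^sub>R mat 1) =
       (vector [vector [0, 1], vector [0, \<epsilon> * (\<Phi> x $ 2) ^ m]] :: real^2^2) ** jacobian \<Phi> (at x)"
    by (rule normal_form[OF k0 ne chi]) (rule that)
  have "\<forall>\<^sub>F x in nhds 0. x \<in> coord_image c \<and> jacobian \<Phi> (at x) ** (L c x - k *\<^sub>R mat 1) =
       (vector [vector [0, 1], vector [0, \<epsilon> * (\<Phi> x $ 2) ^ m]] :: real^2^2) ** jacobian \<Phi> (at x)"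
    using ev nf by eventually_elim blast
  then obtain W where W: "open W" "0 \<in> W" "\<And>x. x \<in> W \<Longrightarrow> x \<in> coord_image c \<and> jacobian \<Phi> (at x) ** (L c x - k *\<^sub>R mat 1) =
       (vector [vector [0, 1], vector [0, \<epsilon> * (\<Phi> x $ 2) ^ m]] :: real^2^2) ** jacobian \<Phi> (at x)"
    unfolding eventually_nhds by blast
  obtain U V g where U: "open U" "0 \<in> U" "U \<subseteq> W" "open V" "homeomorphism U V \<Phi> g"
    "\<And>x. x \<in> U \<Longrightarrow> real_analytic_at \<Phi> x" "\<And>y. y \<in> V \<Longrightarrow> real_analytic_at g y"
    by (rule real_analytic_local_diffeo[OF \<Phi>(1,3) W(1,2)]) (rule that)
  have Uc: "U \<subseteq> coord_image c" using U(3) W(3) by blast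
  define c' where "c' = ({q \<in> fst c. snd c q \<in> U}, \<lambda>q. \<Phi> (snd c q))"
  have c': "c' \<in> charts A" "coord_image c' = V"
    unfolding c'_def using chart_compose[OF atlas c(1) Uc U(1,4,5,6,7)] by blast+
  have L: "L c' z - k *\<^sub>R mat 1 = vector [vector [0, 1], vector [0, \<epsilon> * (z $ 2) ^ m]]" if z: "z \<in> coord_image c'" for z
  proof -
    obtain x where x: "x \<in> U" "z = \<Phi> x" using z homeomorphism_image1[OF U(5)] unfolding c'(2) by blast
    define J where "J = jacobian \<Phi> (at x)"
    let ?N = "vector [vector [0, 1], vector [0, \<epsilon> * (z $ 2) ^ m]] :: real^2^2"
    have inv: "invertible J" and e: "L c' z ** J = J ** L c x"
      using tensor_chart_compose[OF atlas tf c(1) Uc U(1,4,5,6,7) x(1)] unfolding J_def c'_def x(2) by blast+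
    have "J ** (L c x - k *\<^sub>R mat 1) = ?N ** J" using W(3)[of x] x U(3) unfolding J_def by blast
    then have "(L c' z - k *\<^sub>R mat 1) ** J = ?N ** J" unfolding mult_sub_scaleR e .
    then have "(L c' z - k *\<^sub>R mat 1) ** (J ** matrix_inv J) = ?N ** (J ** matrix_inv J)"
      unfolding matrix_mul_assoc by simp
    then show ?thesis by (simp add: matrix_inv_mult[OF inv])
  qed
  have pc: "p \<in> fst c'" "snd c' p = 0" using c(2,3) U(2) \<Phi>(2) by (auto simp: c'_def)
  show ?thesis
    unfolding series_M_def
  proof (intro exI[of _ k] bexI[OF _ c'(1)] conjI pc)
    show "\<exists>n::nat. n \<ge> 1 \<and> ((\<forall>z\<in>coord_image c'. L c' z - k *\<^sub>R mat 1 =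
            vector [vector [0, 1], vector [0, (z$2) ^ (2*n - 1)]]) \<or>
         (\<exists>\<epsilon>\<in>{1, -1}. \<forall>z\<in>coord_image c'. L c' z - k *\<^sub>R mat 1 =
            vector [vector [0, 1], vector [0, \<epsilon> * (z$2) ^ (2*n)]]))"
    proof (cases "odd m")
      case True
      then obtain j where j: "m = 2 * j + 1" by (rule oddE)
      have "\<epsilon> = 1" by (rule m(3)[OF True])
      \<comment> \<open>\<open>m = 2 * j + 1 = 2 * (j + 1) - 1\<close>, so the index in the odd
        family is \<open>j + 1\<close>.\<close>
      then show ?thesis using L by (intro exI[of _ "j + 1"] conjI disjI1) (simp_all add: j)
    next
      case False
      then obtain j where j: "m = 2 * j" by (auto elim: evenE)
      have "j \<ge> 1" using m(1) j by simp
      moreover have "\<epsilon> \<in> {1, -1}" using m(2) by simp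
      ultimately show ?thesis using L unfolding j by blast
    qed
  qed
qed

end

end

theorem proposition6p2:
  fixes A :: "'a::{t2_space, second_countable_topology} chart set"
    and L :: "'a tfield"
  assumes "analytic_atlas A"
    and "compact (UNIV :: 'a set)"
    and "connected (UNIV :: 'a set)"
    and "tensor_field A L"
    and "nijenhuis A L"
    and "gl_regular A L"
  shows "(Sing A L = {} \<longleftrightarrow> same_algebraic_type A L) \<and>
    (Sing A L = {} \<or>
      ((\<forall>p\<in>Sing A L. series_M A L p) \<and>
       (\<exists>\<mu>::real. everywhere A L (\<lambda>M. eigenvalue M \<mu>))))"
proof (intro conjI)
  note h = assms(1,4,2,3,5,6)
  show "Sing A L = {} \<longleftrightarrow> same_algebraic_type A L"
    by (rule Sing_empty_iff_same_type[OF assms(1,4,3,6)])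
  show "Sing A L = {} \<or> ((\<forall>p\<in>Sing A L. series_M A L p) \<and> (\<exists>\<mu>::real. everywhere A L (\<lambda>M. eigenvalue M \<mu>)))"
  proof (cases "Sing A L = {}")
    case False
    have S: "discr_at A L p = 0" if "p \<in> Sing A L" for p
      using that Sing_eq[OF h False] by blast
    obtain p where p: "p \<in> Sing A L" using False by blast
    \<comment> \<open>Half the trace at a singular point is the double eigenvalue there, and this is
      the eigenvalue that is constant on the surface.\<close>
    define k where "k = tr_at A L p / 2"
    have "everywhere A L (\<lambda>M. eigenvalue M k)"
      unfolding everywhere_def
    proof (intro ballI)
      fix c x assume c: "c \<in> charts A" "x \<in> coord_image c"
      then obtain q where q: "q \<in> fst c" "x = snd c q" unfolding coord_image_def by blast
      have "k\<^sup>2 = trace (L c x) * k - det (L c x)"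
        using eigenvalue_constant[OF h False S[OF p], of q]
          tr_at_eq[OF assms(1,4) c(1) q(1)] det_at_eq[OF assms(1,4) c(1) q(1)] unfolding k_def q(2) by simp
      then show "eigenvalue (L c x) k"
        unfolding eigenvalue_iff trace_2 det_2 by (simp add: power2_eq_square)
    qed
    then show ?thesis using Sing_series_M[OF h False] S by blast
  qed simp
qed

end
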